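(* Let $A,B,C$ be $2\times2$ real upper-triangular matrices with $A$ nonsingular, let $\kappa(A)$ be the condition number of $A$, and let $\boldsymbol\epsilon$ be a given precision. Suppose that all floating-point operations in Algorithm RSVD22-$\tau_\eta$ (given in the context) are computed with a precision of at least $\mathcal O(\boldsymbol\epsilon\,\kappa(A)^{-1})$ and that the tolerance $\tau_\eta=8\kappa(A)$ is used. Then the algorithm computes $\overline A'$ stably with respect to the precision $\boldsymbol\epsilon$; that is, there exist orthonormal matrices $\mathcal P,\mathcal Q$ and a matrix $\delta A$ such that $\overline A'=\mathcal P^T(A+\delta A)\mathcal Q$ and $\|\delta A\|=\mathcal O(\boldsymbol\epsilon\|A\|)$.
   Context: Notation: $\|\cdot\|$ is the spectral norm and $\kappa(A)=\|A\|\|A^{-1}\|$; $|X|$ is the entrywise absolute value; $\mathrm{adj}$ is the adjugate; $J=\begin{bmatrix}0&1\\-1&0\end{bmatrix}$; orthonormal matrices are square real orthogonal matrices; lowercase letters denote entries. An unnormalized SVD $V^TMU=\Sigma$ has $U,V$ orthogonal and $\Sigma$ real diagonal. The $\mathcal O$-constants are absolute. Floating-point model (with working unit roundoff $u$, here $u=\mathcal O(\boldsymbol\epsilon\kappa(A)^{-1})$): $\mathrm{fl}(a\circ b)=(a\circ b)(1+\epsilon)$, $|\epsilon|\le u$, for $\circ\in\{+,-,\cdot,/\}$; absolute values and multiplication by $0,\pm1$ are exact; overflow, underflow, and higher-order terms are ignored. Overlined quantities are computed quantities. The matrix $M=C\,\mathrm{adj}(A)B$ is computed as the upper-triangular $\overline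 M$ with $\overline m_{11}=\mathrm{fl}(\mathrm{fl}(c_{11}a_{22})b_{11})$, $\overline m_{22}=\mathrm{fl}(c_{22}\mathrm{fl}(a_{11}b_{22}))$, and $\overline m_{12}=\mathrm{fl}(\mathrm{fl}(\mathrm{fl}(\mathrm{fl}(c_{11}a_{22})b_{12})+\mathrm{fl}(c_{12}\mathrm{fl}(a_{11}b_{22})))-\mathrm{fl}(\mathrm{fl}(c_{11}a_{12})b_{22}))$. Routines (LAPACK): xLASV2 computes an unnormalized SVD of a $2\times2$ upper-triangular $\overline M$, with computed $\overline U,\overline V$ whose entries are relative perturbations of at most $46.5u$ of those of $U,V$, where $V^T\overline MU=\mathrm{diag}(\sigma_1,\sigma_2)$ is an exact unnormalized SVD with $|\sigma_1|\ge|\sigma_2|$, and $\overline U=\overline V=I$ if $\overline M=0$. xLARTG computes from $f,g$ the rotation parameters $f/\sqrt{f^2+g^2}$, $g/\sqrt{f^2+g^2}$ with relative errors at most $6u$. Algorithm RSVD22-$\tau_\eta$. Input: $2\times2$ upper-triangular $A,B,C$ with $A$ nonsingular, and a tolerance $\tau_\eta\ge1$. (1) If $c_{11}=0$ and $b_{22}=0$: compute rotations $V$ with $(V^TC)_{22}=0$ and $U$ with $(BU)_{11}=0$, let $P=Q=J$, $A'=P^TAQ$, $B'=P^TBU$, $C'=V^TCQ$, set $b_{21}'=c_{21}'=0$, and stop. (2) Compute an unnormalized SVD $V^TMU=\Sigma$ of $M=C\,\mathrm{adj}(A)B$ with xLASV2. Let $c_{\max}=\max\{|u_{11}|,|v_{11}|\}$,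 $s_{\max}=\max\{|u_{12}|,|v_{12}|\}$. If $c_{11},c_{22},b_{11},b_{22}$ are all nonzero and $c_{\max}<s_{\max}$, replace $U$ by $UJ$ and $V$ by $VJ$. (3) Let $G=V^TC$ (optionally set $g_{22}=0$ if $c_{11}=0$), $L=BU$ (optionally set $l_{12}=0$ if $b_{22}=0$), $\widehat G=|V|^T|C|$, $H=\mathrm{adj}(A)L$, $\widehat H=|\mathrm{adj}(A)||B||U|$, $K=G\,\mathrm{adj}(A)$, $\widehat K=|V|^T|C||\mathrm{adj}(A)|$, $\widehat L=|B||U|$. (4) For $i=1,2$ put $\eta_g^{(i)}=(\widehat g_{i1}+\widehat g_{i2})/(|g_{i1}|+|g_{i2}|)$ and $\eta_k^{(i)}=(\widehat k_{i1}+\widehat k_{i2})/(|k_{i1}|+|k_{i2}|)$. Put $\eta_h^{(1)}=(\widehat h_{12}+\widehat h_{22})/(|h_{12}|+|h_{22}|)$, $\eta_l^{(1)}=(\widehat l_{12}+\widehat l_{22})/(|l_{12}|+|l_{22}|)$, $\eta_h^{(2)}=(\widehat h_{11}+\widehat h_{21})/(|h_{11}|+|h_{21}|)$, $\eta_l^{(2)}=(\widehat l_{11}+\widehat l_{21})/(|l_{11}|+|l_{21}|)$. Each is $\infty$ if its denominator is $0$. Put $\eta_{\max}^{(i)}=\max\{1,\min\{\eta_g^{(i)},\eta_h^{(i)}\},\min\{\eta_k^{(i)},\eta_l^{(i)}\}\}$. (5) If $\eta_{\max}^{(1)}\le\tau_\eta$ or $\eta_{\max}^{(1)}\le\eta_{\max}^{(2)}$,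 let $\eta_\bullet=\eta_\bullet^{(1)}$ for $\bullet\in\{g,h,k,l\}$. Otherwise let $\eta_\bullet=\eta_\bullet^{(2)}$ and replace $U,V,G,H,K,L$ by $UJ,VJ,J^TG,HJ,J^TK,LJ$. (6) If $|h_{12}|+|h_{22}|=0$ or ($|g_{11}|+|g_{12}|\ne0$ and $\eta_g\le\eta_h$), use xLARTG to compute a rotation $Q$ such that $GQ$ is lower triangular; otherwise compute $Q$ such that $Q^TH$ is lower triangular. (7) If $|k_{11}|+|k_{12}|=0$ or ($|l_{12}|+|l_{22}|\ne0$ and $\eta_l\le\eta_k$), use xLARTG to compute a rotation $P$ such that $P^TL$ is lower triangular; otherwise compute $P$ such that $KP$ is lower triangular. (8) Let $A'=P^TAQ$, $B'=P^TL$, $C'=GQ$, and set $a_{12}'=b_{12}'=c_{12}'=0$. *)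

theory Defs
  imports "HOL-Analysis.Analysis"
begin

type_synonym mat22 = "real^2^2"

definition mat2 :: "real \<Rightarrow> real \<Rightarrow> real \<Rightarrow> real \<Rightarrow> mat22" where
  "mat2 a b c d = vector [vector [a, b], vector [c, d]]"

definition adj2 :: "mat22 \<Rightarrow> mat22" where
  "adj2 X = mat2 (X$2$2) (- (X$1$2)) (- (X$2$1)) (X$1$1)"

definition J2 :: mat22 where
  "J2 = mat2 0 1 (-1) 0"

definition upper_triangular2 :: "mat22 \<Rightarrow> bool" where
  "upper_triangular2 X \<longleftrightarrow> X$2$1 = 0"

definition set_zero :: "2 \<Rightarrow> 2 \<Rightarrow> mat22 \<Rightarrow> mat22" where
  "set_zero i0 j0 X = (\<chi> i j. if i = i0 \<and> j = j0 then 0 else X$i$j)"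

definition spectral_norm :: "mat22 \<Rightarrow> real" where
  "spectral_norm X = onorm (\<lambda>x. X *v x)"

definition cond_num :: "mat22 \<Rightarrow> real" where
  "cond_num X = spectral_norm X * spectral_norm (matrix_inv X)"

text \<open>
  The entrywise absolute value is the library's \<open>\<bar>X\<bar>\<close> on \<open>real^2^2\<close> (\<open>abs_vec_def\<close>).
\<close>

subsection \<open>Floating-point model\<close>

text \<open>
  An arithmetic is given by arbitrary functions on the reals (no overflow, no underflow)
  that are only required to satisfy the error bounds below. Conventions:
  \<open>fl_svd M\<close> is the pair of computed factors \<open>(U, V)\<close> returned by xLASV2, and
  \<open>fl_rot f g\<close> is the pair of computed parameters \<open>(c, s)\<close> returned by xLARTG.
\<close>

record fp_system =
  fl_add :: "real \<Rightarrow> real \<Rightarrow> real"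
  fl_sub :: "real \<Rightarrow> real \<Rightarrow> real"
  fl_mul :: "real \<Rightarrow> real \<Rightarrow> real"
  fl_div :: "real \<Rightarrow> real \<Rightarrow> real"
  fl_svd :: "mat22 \<Rightarrow> mat22 \<times> mat22"
  fl_rot :: "real \<Rightarrow> real \<Rightarrow> real \<times> real"

definition rel_pert :: "real \<Rightarrow> real \<Rightarrow> real \<Rightarrow> bool" where
  "rel_pert b x y \<longleftrightarrow> (\<exists>e. \<bar>e\<bar> \<le> b \<and> y = x * (1 + e))"

definition rel_pert_mat :: "real \<Rightarrow> mat22 \<Rightarrow> mat22 \<Rightarrow> bool" where
  "rel_pert_mat b X Y \<longleftrightarrow> (\<forall>i j. rel_pert b (X$i$j) (Y$i$j))"

definition unnormalized_svd :: "mat22 \<Rightarrow> mat22 \<Rightarrow> mat22 \<Rightarrow> real \<Rightarrow> real \<Rightarrow> bool" where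
  "unnormalized_svd M U V \<sigma>1 \<sigma>2 \<longleftrightarrow>
     orthogonal_matrix U \<and> orthogonal_matrix V \<and>
     transpose V ** M ** U = mat2 \<sigma>1 0 0 \<sigma>2"

definition arith_model :: "real \<Rightarrow> fp_system \<Rightarrow> bool" where
  "arith_model u F \<longleftrightarrow>
     (\<forall>a b. rel_pert u (a + b) (fl_add F a b)) \<and>
     (\<forall>a b. rel_pert u (a - b) (fl_sub F a b)) \<and>
     (\<forall>a b. rel_pert u (a * b) (fl_mul F a b)) \<and>
     (\<forall>a b. b \<noteq> 0 \<longrightarrow> rel_pert u (a / b) (fl_div F a b)) \<and>
     (\<forall>a b. a \<in> {0, 1, -1} \<or> b \<in> {0, 1, -1} \<longrightarrow> fl_mul F a b = a * b)"

definition xlasv2_model :: "real \<Rightarrow> fp_system \<Rightarrow> bool" where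
  "xlasv2_model u F \<longleftrightarrow>
     fl_svd F 0 = (mat 1, mat 1) \<and>
     (\<forall>M. upper_triangular2 M \<and> M \<noteq> 0 \<longrightarrow>
        (\<exists>U V \<sigma>1 \<sigma>2. unnormalized_svd M U V \<sigma>1 \<sigma>2 \<and> \<bar>\<sigma>1\<bar> \<ge> \<bar>\<sigma>2\<bar> \<and>
           rel_pert_mat (46.5 * u) U (fst (fl_svd F M)) \<and>
           rel_pert_mat (46.5 * u) V (snd (fl_svd F M))))"

text \<open>As in LAPACK, the rotation computed from \<open>f = g = 0\<close> is the identity.\<close>

definition xlartg_model :: "real \<Rightarrow> fp_system \<Rightarrow> bool" where
  "xlartg_model u F \<longleftrightarrow>
     fl_rot F 0 0 = (1, 0) \<and>
     (\<forall>f g. f \<noteq> 0 \<or> g \<noteq> 0 \<longrightarrow>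
        rel_pert (6 * u) (f / sqrt (f\<^sup>2 + g\<^sup>2)) (fst (fl_rot F f g)) \<and>
        rel_pert (6 * u) (g / sqrt (f\<^sup>2 + g\<^sup>2)) (snd (fl_rot F f g)))"

definition fp_model :: "real \<Rightarrow> fp_system \<Rightarrow> bool" where
  "fp_model u F \<longleftrightarrow> arith_model u F \<and> xlasv2_model u F \<and> xlartg_model u F"

definition fl_mm :: "fp_system \<Rightarrow> mat22 \<Rightarrow> mat22 \<Rightarrow> mat22" where
  "fl_mm F X Y = (\<chi> i j. fl_add F (fl_mul F (X$i$1) (Y$1$j)) (fl_mul F (X$i$2) (Y$2$j)))"

definition fl_mm3 :: "fp_system \<Rightarrow> bool \<Rightarrow> mat22 \<Rightarrow> mat22 \<Rightarrow> mat22 \<Rightarrow> mat22" where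
  "fl_mm3 F left X Y Z = (if left then fl_mm F (fl_mm F X Y) Z else fl_mm F X (fl_mm F Y Z))"

text \<open>
  \<open>rot_first F f g\<close> is the computed rotation \<open>Q\<close> for which, in exact arithmetic,
  \<open>[f g] Q = [r 0]\<close>, equivalently \<open>transpose Q [f; g] = [r; 0]\<close>;
  \<open>rot_second F f g\<close> is the one for which \<open>[f g] Q = [0 r]\<close>,
  equivalently \<open>transpose Q [f; g] = [0; r]\<close>.
\<close>

definition rot_first :: "fp_system \<Rightarrow> real \<Rightarrow> real \<Rightarrow> mat22" where
  "rot_first F f g = (case fl_rot F f g of (c, s) \<Rightarrow> mat2 c (- s) s c)"

definition rot_second :: "fp_system \<Rightarrow> real \<Rightarrow> real \<Rightarrow> mat22" where
  "rot_second F f g = (case fl_rot F g f of (c, s) \<Rightarrow> mat2 c s (- s) c)"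

subsection \<open>Algorithm RSVD22 with tolerance\<close>

text \<open>
  What the description of the algorithm leaves to the implementation: the two optional
  assignments in step 3 and the order of evaluation of the threefold products
  (\<open>True\<close> stands for \<open>(XY)Z\<close>, \<open>False\<close> for \<open>X(YZ)\<close>).
\<close>

record rsvd22_variant =
  clear_g22 :: bool
  clear_l12 :: bool
  left_Hhat :: bool
  left_Khat :: bool
  left_A' :: bool
  left_B' :: bool
  left_C' :: bool

record rsvd22_result =
  out_A :: mat22
  out_B :: mat22
  out_C :: mat22
  out_P :: mat22
  out_Q :: mat22
  out_U :: mat22
  out_V :: mat22

definition fl_M :: "fp_system \<Rightarrow> mat22 \<Rightarrow> mat22 \<Rightarrow> mat22 \<Rightarrow> mat22" where
  "fl_M F A B C =
    (let ca = fl_mul F (C$1$1) (A$2$2);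
         ab = fl_mul F (A$1$1) (B$2$2);
         m11 = fl_mul F ca (B$1$1);
         m22 = fl_mul F (C$2$2) ab;
         m12 = fl_sub F (fl_add F (fl_mul F ca (B$1$2)) (fl_mul F (C$1$2) ab))
                        (fl_mul F (fl_mul F (C$1$1) (A$1$2)) (B$2$2))
     in mat2 m11 m12 0 m22)"

definition fl_eta :: "fp_system \<Rightarrow> real \<Rightarrow> real \<Rightarrow> real \<Rightarrow> real \<Rightarrow> ereal" where
  "fl_eta F n1 n2 d1 d2 =
    (let d = fl_add F \<bar>d1\<bar> \<bar>d2\<bar>
     in if d = 0 then \<infinity> else ereal (fl_div F (fl_add F n1 n2) d))"

definition eta_max :: "ereal \<Rightarrow> ereal \<Rightarrow> ereal \<Rightarrow> ereal \<Rightarrow> ereal" where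
  "eta_max \<eta>g \<eta>h \<eta>k \<eta>l = max 1 (max (min \<eta>g \<eta>h) (min \<eta>k \<eta>l))"

definition rsvd22_step1 ::
  "fp_system \<Rightarrow> rsvd22_variant \<Rightarrow> mat22 \<Rightarrow> mat22 \<Rightarrow> mat22 \<Rightarrow> rsvd22_result" where
  "rsvd22_step1 F w A B C =
    (let V = rot_first F (C$1$2) (C$2$2);
         U = rot_second F (B$1$1) (B$1$2);
         P = J2; Q = J2
     in \<lparr>out_A = fl_mm3 F (left_A' w) (transpose P) A Q,
         out_B = set_zero 2 1 (fl_mm3 F (left_B' w) (transpose P) B U),
         out_C = set_zero 2 1 (fl_mm3 F (left_C' w) (transpose V) C Q),
         out_P = P, out_Q = Q, out_U = U, out_V = V\<rparr>)"

definition rsvd22_step2 ::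
  "fp_system \<Rightarrow> mat22 \<Rightarrow> mat22 \<Rightarrow> mat22 \<Rightarrow> mat22 \<times> mat22" where
  "rsvd22_step2 F A B C =
    (let (U, V) = fl_svd F (fl_M F A B C);
         cmax = max \<bar>U$1$1\<bar> \<bar>V$1$1\<bar>;
         smax = max \<bar>U$1$2\<bar> \<bar>V$1$2\<bar>
     in if C$1$1 \<noteq> 0 \<and> C$2$2 \<noteq> 0 \<and> B$1$1 \<noteq> 0 \<and> B$2$2 \<noteq> 0 \<and> cmax < smax
        then (U ** J2, V ** J2) else (U, V))"

text \<open>
  Multiplication by \<open>J2\<close> in steps 2 and 5 only permutes columns or rows and changes signs, so the
  exact matrix product \<open>**\<close> is used for it.
  Steps 6 to 8 follow, with \<open>\<eta>g\<close>, \<open>\<eta>h\<close>, \<open>\<eta>k\<close>, \<open>\<eta>l\<close> as selected in step 5.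
\<close>

definition rsvd22_finish ::
  "fp_system \<Rightarrow> rsvd22_variant \<Rightarrow> mat22 \<Rightarrow> mat22 \<Rightarrow> mat22 \<Rightarrow> mat22 \<Rightarrow> mat22 \<Rightarrow> mat22 \<Rightarrow> mat22
   \<Rightarrow> ereal \<Rightarrow> ereal \<Rightarrow> ereal \<Rightarrow> ereal \<Rightarrow> rsvd22_result" where
  "rsvd22_finish F w A U V G H K L \<eta>g \<eta>h \<eta>k \<eta>l =
    (let Q = (if fl_add F \<bar>H$1$2\<bar> \<bar>H$2$2\<bar> = 0 \<or>
                 (fl_add F \<bar>G$1$1\<bar> \<bar>G$1$2\<bar> \<noteq> 0 \<and> \<eta>g \<le> \<eta>h)
              then rot_first F (G$1$1) (G$1$2) else rot_second F (H$1$2) (H$2$2));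
         P = (if fl_add F \<bar>K$1$1\<bar> \<bar>K$1$2\<bar> = 0 \<or>
                 (fl_add F \<bar>L$1$2\<bar> \<bar>L$2$2\<bar> \<noteq> 0 \<and> \<eta>l \<le> \<eta>k)
              then rot_second F (L$1$2) (L$2$2) else rot_first F (K$1$1) (K$1$2))
     in \<lparr>out_A = set_zero 1 2 (fl_mm3 F (left_A' w) (transpose P) A Q),
         out_B = set_zero 1 2 (fl_mm F (transpose P) L),
         out_C = set_zero 1 2 (fl_mm F G Q),
         out_P = P, out_Q = Q, out_U = U, out_V = V\<rparr>)"

definition rsvd22 ::
  "fp_system \<Rightarrow> rsvd22_variant \<Rightarrow> real \<Rightarrow> mat22 \<Rightarrow> mat22 \<Rightarrow> mat22 \<Rightarrow> rsvd22_result" where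
  "rsvd22 F w \<tau> A B C =
    (if C$1$1 = 0 \<and> B$2$2 = 0 then rsvd22_step1 F w A B C
     else
      let (U, V) = rsvd22_step2 F A B C;
          G0 = fl_mm F (transpose V) C;
          G = (if clear_g22 w \<and> C$1$1 = 0 then set_zero 2 2 G0 else G0);
          L0 = fl_mm F B U;
          L = (if clear_l12 w \<and> B$2$2 = 0 then set_zero 1 2 L0 else L0);
          Gh = fl_mm F (transpose \<bar>V\<bar>) \<bar>C\<bar>;
          H = fl_mm F (adj2 A) L;
          Hh = fl_mm3 F (left_Hhat w) \<bar>adj2 A\<bar> \<bar>B\<bar> \<bar>U\<bar>;
          K = fl_mm F G (adj2 A);
          Kh = fl_mm3 F (left_Khat w) (transpose \<bar>V\<bar>) \<bar>C\<bar> \<bar>adj2 A\<bar>;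
          Lh = fl_mm F \<bar>B\<bar> \<bar>U\<bar>;
          \<eta>g1 = fl_eta F (Gh$1$1) (Gh$1$2) (G$1$1) (G$1$2);
          \<eta>g2 = fl_eta F (Gh$2$1) (Gh$2$2) (G$2$1) (G$2$2);
          \<eta>k1 = fl_eta F (Kh$1$1) (Kh$1$2) (K$1$1) (K$1$2);
          \<eta>k2 = fl_eta F (Kh$2$1) (Kh$2$2) (K$2$1) (K$2$2);
          \<eta>h1 = fl_eta F (Hh$1$2) (Hh$2$2) (H$1$2) (H$2$2);
          \<eta>h2 = fl_eta F (Hh$1$1) (Hh$2$1) (H$1$1) (H$2$1);
          \<eta>l1 = fl_eta F (Lh$1$2) (Lh$2$2) (L$1$2) (L$2$2);
          \<eta>l2 = fl_eta F (Lh$1$1) (Lh$2$1) (L$1$1) (L$2$1);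
          \<eta>max1 = eta_max \<eta>g1 \<eta>h1 \<eta>k1 \<eta>l1;
          \<eta>max2 = eta_max \<eta>g2 \<eta>h2 \<eta>k2 \<eta>l2
      in if \<eta>max1 \<le> ereal \<tau> \<or> \<eta>max1 \<le> \<eta>max2
         then rsvd22_finish F w A U V G H K L \<eta>g1 \<eta>h1 \<eta>k1 \<eta>l1
         else rsvd22_finish F w A (U ** J2) (V ** J2) (transpose J2 ** G) (H ** J2)
                (transpose J2 ** K) (L ** J2) \<eta>g2 \<eta>h2 \<eta>k2 \<eta>l2)"

end

(*
Undoing the nearly orthogonal factors, everything reduces to showing that the entry p_1^T A q_2,
which the algorithm sets to zero, is O(kappa(A) u ||A||). Let g be the first row of V^T C, l the
second column of BU, k = g adj(A) and h = adj(A) l for the exact factors U, V of the computed M.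
Up to scaling, q_2 is orthogonal to g or parallel to h, and p_1 is orthogonal to l or parallel to k;
in each of the four combinations p_1^T A q_2 is 0 or a multiple of g adj(A) l, an off-diagonal entry
of V^T M U that is as small as the rounding errors in M. The rounding errors in g, h, k, l are
amplified by the cancellation factors eta of the vectors from which Q and P are computed.
For at least one of the two rows of V^T C there is no cancellation, since the columns of V cannot both
be almost orthogonal to (c_12, c_22); passing from g to k costs a factor O(kappa(A)). (If C = 0,
the same applies to BU.) Hence the smaller of the two eta_max is O(kappa(A)), and so is the chosen one.
*)

theory Submission
  imports Defs
begin

text \<open>A precision u of order \<epsilon>/\<kappa>(A) leaves room for losing one factor
  \<kappa>(A), yet the vector that determines Q and the one that determines P may both suffer
  cancellation of that order. Two facts keep the loss single: the vector errors enter p^T A q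
  additively, and the off-diagonal entry g adj(A) l is bounded term by term in such a way that no
  term contains two cancelling quantities. For this reason errors are measured entrywise against
  products of absolute values and not against norms; the factors eta are the price of returning from
  those products to the lengths of the vectors. Singular vectors may move far when M is perturbed,
  so U and V are never compared with factors of the exact product C adj(A) B; the rounding errors of
  M enter only through the residual g adj(A) l. All factors eta are held below 100 \<kappa>(A). This
  dominates the tolerance 8 \<kappa>(A), so a choice made by the tolerance and a choice made by
  comparison are treated alike.\<close>

section \<open>Entries, orthogonal matrices, the spectral norm and the condition number\<close>

lemma mat2_nth [simp]:
  "mat2 a b c d $ 1 $ 1 = a" "mat2 a b c d $ 1 $ 2 = b"
  "mat2 a b c d $ 2 $ 1 = c" "mat2 a b c d $ 2 $ 2 = d"
  by (simp_all add: mat2_def)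

lemma mm2_nth: "(X ** Y) $ i $ j = X $ i $ 1 * Y $ 1 $ j + X $ i $ 2 * Y $ 2 $ j"
  for X Y :: mat22
  by (simp add: matrix_matrix_mult_def sum_2)

lemma transpose2_nth: "transpose X $ i $ j = X $ j $ i"
  by (simp add: transpose_def)

lemma abs_mat22_nth: "\<bar>X\<bar> $ i $ j = \<bar>X $ i $ j\<bar>" for X :: mat22
  by (simp add: abs_vec_def)

lemma mat22_eq_iff:
  "X = Y \<longleftrightarrow> X$1$1 = Y$1$1 \<and> X$1$2 = Y$1$2 \<and> X$2$1 = Y$2$1 \<and> X$2$2 = Y$2$2" for X Y :: mat22
  by (auto simp: vec_eq_iff forall_2)

lemma adj2_nth:
  "adj2 X $ 1 $ 1 = X$2$2" "adj2 X $ 1 $ 2 = - (X$1$2)"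
  "adj2 X $ 2 $ 1 = - (X$2$1)" "adj2 X $ 2 $ 2 = X$1$1"
  by (simp_all add: adj2_def)

lemma J2_nth: "J2 $ 1 $ 1 = 0" "J2 $ 1 $ 2 = 1" "J2 $ 2 $ 1 = -1" "J2 $ 2 $ 2 = 0"
  by (simp_all add: J2_def)

lemma orthogonal_mat22_columns:
  fixes P :: mat22
  assumes "orthogonal_matrix P"
  shows "(P$1$1)\<^sup>2 + (P$2$1)\<^sup>2 = 1" "(P$1$2)\<^sup>2 + (P$2$2)\<^sup>2 = 1"
proof -
  have e: "transpose P ** P = mat 1"
    using assms by (simp add: orthogonal_matrix_def)
  show "(P$1$1)\<^sup>2 + (P$2$1)\<^sup>2 = 1" "(P$1$2)\<^sup>2 + (P$2$2)\<^sup>2 = 1"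
    using e by (simp_all add: mat22_eq_iff mm2_nth transpose2_nth mat_def power2_eq_square)
qed

lemma orthogonal_mat22_rows:
  fixes P :: mat22
  assumes "orthogonal_matrix P"
  shows "(P$1$1)\<^sup>2 + (P$1$2)\<^sup>2 = 1" "(P$2$1)\<^sup>2 + (P$2$2)\<^sup>2 = 1"
    "P$1$1 * P$2$1 + P$1$2 * P$2$2 = 0"
proof -
  have e: "P ** transpose P = mat 1"
    using assms by (simp add: orthogonal_matrix_def)
  show "(P$1$1)\<^sup>2 + (P$1$2)\<^sup>2 = 1" "(P$2$1)\<^sup>2 + (P$2$2)\<^sup>2 = 1"
    "P$1$1 * P$2$1 + P$1$2 * P$2$2 = 0"
    using e by (simp_all add: mat22_eq_iff mm2_nth transpose2_nth mat_def power2_eq_square)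
qed

lemma abs_le_1_if_sum_squares:
  fixes x y :: real
  assumes "x\<^sup>2 + y\<^sup>2 = 1"
  shows "\<bar>x\<bar> \<le> 1" "\<bar>y\<bar> \<le> 1"
proof -
  have "x\<^sup>2 \<le> 1" "y\<^sup>2 \<le> 1"
    using assms zero_le_power2[of x] zero_le_power2[of y] by linarith+
  then show "\<bar>x\<bar> \<le> 1" "\<bar>y\<bar> \<le> 1"
    by (simp_all add: abs_square_le_1)
qed

lemma orthogonal_mat22_abs_le_1:
  fixes P :: mat22
  assumes "orthogonal_matrix P"
  shows "\<bar>P$i$j\<bar> \<le> 1"
proof -
  have "\<forall>i j. \<bar>P$i$j\<bar> \<le> 1"
    using orthogonal_mat22_columns(1,2)[OF assms]
    by (auto simp: forall_2 dest: abs_le_1_if_sum_squares)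
  then show ?thesis by blast
qed

lemma orthogonal_rotation:
  assumes "c\<^sup>2 + s\<^sup>2 = (1::real)"
  shows "orthogonal_matrix (mat2 c (- s) s c)" "orthogonal_matrix (mat2 c s (- s) c)"
  using assms assms[unfolded add.commute[of "c\<^sup>2"]]
  by (simp_all add: orthogonal_matrix mat22_eq_iff mm2_nth transpose2_nth mat_def power2_eq_square)

lemma orthogonal_J2: "orthogonal_matrix J2"
  by (simp add: orthogonal_matrix mat22_eq_iff mm2_nth transpose2_nth mat_def J2_nth)

lemma abs_nth_le_spectral_norm: "\<bar>X$i$j\<bar> \<le> spectral_norm X"
  unfolding spectral_norm_def by (rule matrix_component_le_onorm)

lemma spectral_norm_le:
  assumes "\<And>i j. \<bar>X$i$j\<bar> \<le> D"
  shows "spectral_norm X \<le> 4 * D"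
  using onorm_le_matrix_component[of X D] assms by (simp add: spectral_norm_def)

text \<open>The inverse is adj(A)/(a d), so up to sign its entries are those of A divided by a d.
  With \<open>m\<close> the largest entry, m/|a d| is at most the norm of the inverse; multiplying
  by \<open>m \<le> spectral_norm A\<close> gives the quadratic bound, the form in which \<kappa>(A)
  later controls cancellation.\<close>

lemma max_entry_cond_num:
  assumes tri: "upper_triangular2 A" and inv: "invertible A"
  obtains m where "0 < m" "\<bar>A$1$1\<bar> \<le> m" "\<bar>A$1$2\<bar> \<le> m" "\<bar>A$2$2\<bar> \<le> m"
    "m \<le> spectral_norm A" "m\<^sup>2 \<le> cond_num A * \<bar>A$1$1 * A$2$2\<bar>"
    "A$1$1 \<noteq> 0" "A$2$2 \<noteq> 0" "1 \<le> cond_num A"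
proof -
  define N where "N = matrix_inv A"
  define a b d where "a = A$1$1" and "b = A$1$2" and "d = A$2$2"
  have "A ** N = mat 1"
    using inv unfolding N_def matrix_inv_def invertible_def by (rule someI2_ex) simp
  then have eqs: "a * N$1$1 + b * N$2$1 = 1" "a * N$1$2 + b * N$2$2 = 0" "d * N$2$1 = 0"
    "d * N$2$2 = 1"
    using tri by (simp_all add: mat22_eq_iff mm2_nth mat_def upper_triangular2_def a_def b_def d_def)
  have d0: "d \<noteq> 0" using eqs(4) by auto
  then have N21: "N$2$1 = 0" using eqs(3) by simp
  then have a0: "a \<noteq> 0" using eqs(1) by auto
  define t where "t = spectral_norm N"
  have N11: "N$1$1 = d / (a * d)" using eqs(1) N21 a0 d0 by (simp add: field_simps)
  have N22: "N$2$2 = a / (a * d)" using eqs(4) a0 d0 by (simp add: field_simps)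
  have N12: "N$1$2 = - b / (a * d)"
    using eqs(2) N22 a0 d0 by (simp add: field_simps)
  define m where "m = max \<bar>a\<bar> (max \<bar>b\<bar> \<bar>d\<bar>)"
  have le: "\<bar>a\<bar> \<le> m" "\<bar>b\<bar> \<le> m" "\<bar>d\<bar> \<le> m" by (auto simp: m_def)
  have m0: "0 < m" using le(1) a0 by linarith
  have ms: "m \<le> spectral_norm A"
    unfolding m_def a_def b_def d_def by (simp add: abs_nth_le_spectral_norm)
  have "\<bar>a\<bar> / \<bar>a * d\<bar> \<le> t" "\<bar>b\<bar> / \<bar>a * d\<bar> \<le> t" "\<bar>d\<bar> / \<bar>a * d\<bar> \<le> t"
    using abs_nth_le_spectral_norm[of N 1 1] abs_nth_le_spectral_norm[of N 1 2]
      abs_nth_le_spectral_norm[of N 2 2] N11 N12 N22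
    by (simp_all only: t_def abs_divide abs_minus_cancel)
  then have "m / \<bar>a * d\<bar> \<le> t" unfolding m_def by (auto simp: max_def)
  then have mt: "m \<le> t * \<bar>a * d\<bar>" using a0 d0 by (simp add: divide_le_eq)
  have "0 \<le> t" using abs_nth_le_spectral_norm[of N 1 1] unfolding t_def by linarith
  have m2: "m\<^sup>2 \<le> cond_num A * \<bar>a * d\<bar>"
  proof -
    have "m * m \<le> spectral_norm A * (t * \<bar>a * d\<bar>)"
      using ms mt m0 by (intro mult_mono) auto
    then show ?thesis
      by (simp add: cond_num_def t_def N_def power2_eq_square mult.assoc)
  qed
  have "\<bar>a * d\<bar> \<le> m\<^sup>2"
    unfolding abs_mult power2_eq_square using le m0 by (intro mult_mono) auto
  then have "1 * \<bar>a * d\<bar> \<le> cond_num A * \<bar>a * d\<bar>" using m2 by linarith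
  then have "1 \<le> cond_num A" using a0 d0 by (simp only: mult_le_cancel_right) simp
  then show thesis
    using that[of m] m0 le ms m2 a0 d0 unfolding a_def b_def d_def by blast
qed

text \<open>The perturbation is the error carried back by the orthogonal factors. Its entries are
  sums of four products bounded by \<open>D\<close>, and the norm is at most four times the largest
  entry, whence 16.\<close>

lemma backward_error_of_product:
  fixes A P Q Y :: mat22
  assumes P: "orthogonal_matrix P" and Q: "orthogonal_matrix Q"
    and Y: "\<And>i j. \<bar>Y$i$j - (transpose P ** A ** Q)$i$j\<bar> \<le> D"
  shows "\<exists>\<delta>. Y = transpose P ** (A + \<delta>) ** Q \<and> spectral_norm \<delta> \<le> 16 * D"
proof -
  define E where "E = Y - transpose P ** A ** Q"
  define \<delta> where "\<delta> = P ** E ** transpose Q"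
  have PQ: "transpose P ** P = mat 1" "transpose Q ** Q = mat 1"
    using P Q by (simp_all add: orthogonal_matrix)
  have "transpose P ** \<delta> ** Q = (transpose P ** P) ** E ** (transpose Q ** Q)"
    by (simp add: \<delta>_def matrix_mul_assoc)
  also have "\<dots> = E" by (simp add: PQ)
  finally have "transpose P ** (A + \<delta>) ** Q = Y"
    by (simp add: matrix_add_ldistrib mm2_nth mat22_eq_iff E_def algebra_simps)
  moreover have "\<bar>\<delta>$i$j\<bar> \<le> 4 * D" for i j
  proof -
    have E: "\<bar>E$k$l\<bar> \<le> D" for k l using Y[of k l] by (simp add: E_def)
    then have D0: "0 \<le> D" using abs_ge_zero order_trans by blast
    have le: "\<bar>P$i$k * E$k$l * Q$j$l\<bar> \<le> D" for k l
    proof -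
      have "\<bar>P$i$k * E$k$l * Q$j$l\<bar> \<le> 1 * D * 1"
        unfolding abs_mult using E[of k l] D0 orthogonal_mat22_abs_le_1[OF P, of i k]
          orthogonal_mat22_abs_le_1[OF Q, of j l]
        by (intro mult_mono) auto
      then show ?thesis by simp
    qed
    have "\<delta>$i$j = P$i$1 * E$1$1 * Q$j$1 + P$i$2 * E$2$1 * Q$j$1
        + P$i$1 * E$1$2 * Q$j$2 + P$i$2 * E$2$2 * Q$j$2"
      by (simp add: \<delta>_def mm2_nth transpose2_nth algebra_simps)
    then show ?thesis
      using le[of 1 1] le[of 2 1] le[of 1 2] le[of 2 2] by linarith
  qed
  then have "spectral_norm \<delta> \<le> 4 * (4 * D)" by (rule spectral_norm_le)
  ultimately show ?thesis by (intro exI[of _ \<delta>]) simp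
qed

subsection \<open>Rounding errors\<close>

text \<open>
  \<open>Xb\<close> is the computed value of \<open>X\<close>, and \<open>Xh\<close> is the same expression with all factors replaced
  by their absolute values, i.e. the hatted matrix of the algorithm.
\<close>

definition err :: "real \<Rightarrow> mat22 \<Rightarrow> mat22 \<Rightarrow> mat22 \<Rightarrow> bool" where
  "err e Xb X Xh \<longleftrightarrow> (\<forall>i j. \<bar>X$i$j\<bar> \<le> Xh$i$j \<and> \<bar>Xb$i$j - X$i$j\<bar> \<le> e * Xh$i$j)"

lemma errD:
  assumes "err e Xb X Xh"
  shows "\<bar>X$i$j\<bar> \<le> Xh$i$j" "\<bar>Xb$i$j - X$i$j\<bar> \<le> e * Xh$i$j"
  using assms by (auto simp: err_def)

lemma err_exact: "err 0 X X \<bar>X\<bar>"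
  by (simp add: err_def abs_mat22_nth)

lemma err_mono:
  assumes "err e Xb X Xh" "e \<le> e'"
  shows "err e' Xb X Xh"
proof -
  have "e * Xh$i$j \<le> e' * Xh$i$j" for i j
    using assms(2) errD(1)[OF assms(1), of i j] by (intro mult_right_mono) auto
  then show ?thesis using assms(1) unfolding err_def by (meson order_trans)
qed

lemma err_transpose: "err e Xb X Xh \<Longrightarrow> err e (transpose Xb) (transpose X) (transpose Xh)"
  by (simp add: err_def transpose2_nth)

lemma err_abs:
  assumes "err e Xb X \<bar>X\<bar>"
  shows "err e \<bar>Xb\<bar> \<bar>X\<bar> \<bar>X\<bar>"
  using assms abs_triangle_ineq3 order_trans unfolding err_def abs_mat22_nth abs_idempotent
  by fast

lemma err_rel_pert:
  assumes "rel_pert_mat e X Xb"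
  shows "err e Xb X \<bar>X\<bar>"
  unfolding err_def abs_mat22_nth
proof (intro allI conjI)
  fix i j
  obtain z where z: "\<bar>z\<bar> \<le> e" "Xb$i$j = X$i$j * (1 + z)"
    using assms unfolding rel_pert_mat_def rel_pert_def by blast
  have "\<bar>Xb$i$j - X$i$j\<bar> = \<bar>z\<bar> * \<bar>X$i$j\<bar>" by (simp add: z(2) algebra_simps abs_mult)
  then show "\<bar>Xb$i$j - X$i$j\<bar> \<le> e * \<bar>X$i$j\<bar>" using z(1) by (simp add: mult_right_mono)
qed simp

lemma rel_pert_abs: "rel_pert b x y \<Longrightarrow> \<bar>y - x\<bar> \<le> b * \<bar>x\<bar>"
proof -
  assume "rel_pert b x y"
  then obtain z where z: "\<bar>z\<bar> \<le> b" "y = x * (1 + z)" unfolding rel_pert_def by blast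
  have "\<bar>y - x\<bar> = \<bar>z\<bar> * \<bar>x\<bar>" by (simp add: z(2) algebra_simps abs_mult)
  then show ?thesis using z(1) by (simp add: mult_right_mono)
qed

lemma arith_modelD:
  assumes "arith_model u F"
  shows "rel_pert u (a + b) (fl_add F a b)" "rel_pert u (a - b) (fl_sub F a b)"
    "rel_pert u (a * b) (fl_mul F a b)" "b \<noteq> 0 \<Longrightarrow> rel_pert u (a / b) (fl_div F a b)"
  using assms by (auto simp: arith_model_def)

lemma product_error:
  fixes x y :: real
  assumes "\<bar>x\<bar> \<le> xh" "\<bar>xb - x\<bar> \<le> e1 * xh" "\<bar>y\<bar> \<le> yh" "\<bar>yb - y\<bar> \<le> e2 * yh" "0 \<le> e1" "0 \<le> e2"
  shows "\<bar>xb * yb - x * y\<bar> \<le> (e1 + e2 + e1 * e2) * (xh * yh)"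
    "\<bar>xb * yb\<bar> \<le> (1 + e1) * (1 + e2) * (xh * yh)"
proof -
  have xb: "\<bar>xb\<bar> \<le> (1 + e1) * xh" and yb: "\<bar>yb\<bar> \<le> (1 + e2) * yh"
    using assms by (simp_all add: distrib_right)
  have "\<bar>xb * yb\<bar> \<le> ((1 + e1) * xh) * ((1 + e2) * yh)"
    unfolding abs_mult using xb yb by (intro mult_mono) auto
  then show "\<bar>xb * yb\<bar> \<le> (1 + e1) * (1 + e2) * (xh * yh)" by (simp add: algebra_simps)
  have "\<bar>(xb - x) * yb\<bar> \<le> (e1 * xh) * ((1 + e2) * yh)"
    unfolding abs_mult using assms yb by (intro mult_mono) auto
  moreover have "\<bar>x * (yb - y)\<bar> \<le> xh * (e2 * yh)"
    unfolding abs_mult using assms by (intro mult_mono) auto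
  moreover have "xb * yb - x * y = (xb - x) * yb + x * (yb - y)" by algebra
  ultimately have "\<bar>xb * yb - x * y\<bar> \<le> (e1 * xh) * ((1 + e2) * yh) + xh * (e2 * yh)"
    by linarith
  then show "\<bar>xb * yb - x * y\<bar> \<le> (e1 + e2 + e1 * e2) * (xh * yh)"
    by (simp add: algebra_simps)
qed

text \<open>The two products cost u of their own size; the addition costs u times the sum of the
  computed products, which is crudely at most \<open>2 * S\<close>.\<close>

lemma fl_dot_error:
  assumes F: "arith_model u F" and u: "0 \<le> u" "u \<le> 1/1000"
  shows "\<bar>fl_add F (fl_mul F p q) (fl_mul F r s) - (p * q + r * s)\<bar>
    \<le> 3 * u * (\<bar>p * q\<bar> + \<bar>r * s\<bar>)"
proof -
  define x y where "x = fl_mul F p q" and "y = fl_mul F r s"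
  define S where "S = \<bar>p * q\<bar> + \<bar>r * s\<bar>"
  have x: "\<bar>x - p * q\<bar> \<le> u * \<bar>p * q\<bar>" and y: "\<bar>y - r * s\<bar> \<le> u * \<bar>r * s\<bar>"
    unfolding x_def y_def by (intro rel_pert_abs arith_modelD[OF F])+
  have z: "\<bar>fl_add F x y - (x + y)\<bar> \<le> u * \<bar>x + y\<bar>"
    by (intro rel_pert_abs arith_modelD[OF F])
  have xy: "\<bar>(x - p * q) + (y - r * s)\<bar> \<le> u * S"
    using x y unfolding S_def by (simp add: distrib_left)
  have S0: "0 \<le> S" by (simp add: S_def)
  have "u * S \<le> 1 * S" using u S0 by (intro mult_right_mono) auto
  moreover have "\<bar>x + y\<bar> \<le> \<bar>(x - p * q) + (y - r * s)\<bar> + S"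
    unfolding S_def by linarith
  ultimately have "\<bar>x + y\<bar> \<le> 2 * S" using xy by linarith
  then have "u * \<bar>x + y\<bar> \<le> u * (2 * S)" using u by (intro mult_left_mono)
  then have "\<bar>fl_add F x y - (p * q + r * s)\<bar> \<le> u * (2 * S) + u * S" using z xy by linarith
  then show ?thesis by (simp add: x_def y_def S_def algebra_simps)
qed

text \<open>The part \<open>e1 + e2 + e1 * e2\<close> is inherited from the factors; the fresh
  roundoff is proportional to the computed factors and hence inflated by
  \<open>(1 + e1) * (1 + e2)\<close>. With \<open>e'\<close> left free, each use has to check one
  numerical inequality.\<close>

lemma err_fl_mm:
  assumes F: "arith_model u F" and u: "0 \<le> u" "u \<le> 1/1000"
    and X: "err e1 Xb X Xh" and Y: "err e2 Yb Y Yh" and e: "0 \<le> e1" "0 \<le> e2"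
    and e': "e1 + e2 + e1 * e2 + 3 * u * ((1 + e1) * (1 + e2)) \<le> e'"
  shows "err e' (fl_mm F Xb Yb) (X ** Y) (Xh ** Yh)"
  unfolding err_def
proof (intro allI conjI)
  fix i j
  let ?f = "e1 + e2 + e1 * e2" and ?g = "(1 + e1) * (1 + e2)"
  note p = product_error[OF errD(1)[OF X, of i 1] errD(2)[OF X, of i 1]
      errD(1)[OF Y, of 1 j] errD(2)[OF Y, of 1 j] e]
  note q = product_error[OF errD(1)[OF X, of i 2] errD(2)[OF X, of i 2]
      errD(1)[OF Y, of 2 j] errD(2)[OF Y, of 2 j] e]
  define S where "S = Xh$i$1 * Yh$1$j + Xh$i$2 * Yh$2$j"
  have nn: "0 \<le> Xh$k$l" "0 \<le> Yh$k$l" for k l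
    using errD(1)[OF X, of k l] errD(1)[OF Y, of k l] by linarith+
  have S0: "0 \<le> S" unfolding S_def using nn by (intro add_nonneg_nonneg mult_nonneg_nonneg)
  have "\<bar>X$i$k * Y$k$j\<bar> \<le> Xh$i$k * Yh$k$j" for k
    unfolding abs_mult using errD(1)[OF X, of i k] errD(1)[OF Y, of k j] nn
    by (intro mult_mono) auto
  from this[of 1] this[of 2] show "\<bar>(X ** Y)$i$j\<bar> \<le> (Xh ** Yh)$i$j"
    unfolding mm2_nth by linarith
  have "\<bar>fl_mm F Xb Yb$i$j - (Xb$i$1 * Yb$1$j + Xb$i$2 * Yb$2$j)\<bar>
      \<le> 3 * u * (\<bar>Xb$i$1 * Yb$1$j\<bar> + \<bar>Xb$i$2 * Yb$2$j\<bar>)"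
    unfolding fl_mm_def using fl_dot_error[OF F u] by simp
  also have "\<dots> \<le> 3 * u * (?g * S)"
    unfolding S_def distrib_left[of ?g] using p(2) q(2) u by (intro mult_left_mono add_mono) auto
  finally have "\<bar>fl_mm F Xb Yb$i$j - (X ** Y)$i$j\<bar> \<le> ?f * S + 3 * u * (?g * S)"
    using p(1) q(1) unfolding S_def mm2_nth distrib_left[of ?f] by linarith
  also have "\<dots> = (?f + 3 * u * ?g) * S" by algebra
  also have "\<dots> \<le> e' * S" using e' S0 by (rule mult_right_mono)
  finally show "\<bar>fl_mm F Xb Yb$i$j - (X ** Y)$i$j\<bar> \<le> e' * (Xh ** Yh)$i$j"
    by (simp add: S_def mm2_nth)
qed

text \<open>The bound is symmetric in \<open>e1\<close> and \<open>e2\<close>, so it serves both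
  orders of evaluation. The middle factor is always an input matrix or its absolute value, hence
  exact.\<close>

lemma err_fl_mm3:
  assumes F: "arith_model u F" and u: "0 \<le> u" "u \<le> 1/1000"
    and X: "err e1 Xb X Xh" and Y: "err 0 Y Y Yh" and Z: "err e2 Zb Z Zh"
    and e: "0 \<le> e1" "0 \<le> e2" "e1 \<le> 1/10" "e2 \<le> 1/10"
  shows "err (2 * e1 + 2 * e2 + 10 * u) (fl_mm3 F w Xb Y Zb) (X ** Y ** Z) (Xh ** Yh ** Zh)"
proof -
  \<comment> \<open>The product evaluated first contributes \<open>4 * u\<close>, the cross term at
    most \<open>0.4 * u\<close>, and the second product \<open>3 * u\<close> times 36/25; together
    less than \<open>10 * u\<close>.\<close>
  have *: "(f + 4 * u) + g + (f + 4 * u) * g + 3 * u * ((1 + (f + 4 * u)) * (1 + g))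
      \<le> 2 * f + 2 * g + 10 * u"
    if "0 \<le> f" "0 \<le> g" "f \<le> 1/10" "g \<le> 1/10" for f g
  proof -
    have "(f + 4 * u) * g \<le> f * (1/10) + 4 * u * (1/10)"
      using that u unfolding distrib_right by (intro add_mono mult_left_mono) auto
    moreover have "(1 + (f + 4 * u)) * (1 + g) \<le> 6/5 * (6/5)"
      using that u by (intro mult_mono) auto
    then have "3 * u * ((1 + (f + 4 * u)) * (1 + g)) \<le> 3 * u * (6/5 * (6/5))"
      using u by (intro mult_left_mono) auto
    ultimately show ?thesis using that u by linarith
  qed
  have **: "f + 3 * u * (1 + f) \<le> f + 4 * u" if "f \<le> 1/10" for f
  proof -
    have "3 * u * (1 + f) \<le> 3 * u * (11/10)" using that u by (intro mult_left_mono) auto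
    then show ?thesis using u by linarith
  qed
  show ?thesis
  proof (cases w)
    case True
    have "err (e1 + 4 * u) (fl_mm F Xb Y) (X ** Y) (Xh ** Yh)"
      using **[of e1] e by (intro err_fl_mm[OF F u X Y]) auto
    from err_fl_mm[OF F u this Z _ _ *[of e1 e2]] show ?thesis
      using e u True by (simp add: fl_mm3_def)
  next
    case False
    have "err (e2 + 4 * u) (fl_mm F Y Zb) (Y ** Z) (Yh ** Zh)"
      using **[of e2] e by (intro err_fl_mm[OF F u Y Z]) auto
    note YZ = this
    have "e1 + (e2 + 4 * u) + e1 * (e2 + 4 * u)
        + 3 * u * ((1 + e1) * (1 + (e2 + 4 * u))) \<le> 2 * e1 + 2 * e2 + 10 * u"
      using *[of e2 e1] e by (simp add: algebra_simps)
    from err_fl_mm[OF F u X YZ _ _ this]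
    have "err (2 * e1 + 2 * e2 + 10 * u) (fl_mm F Xb (fl_mm F Y Zb))
        (X ** (Y ** Z)) (Xh ** (Yh ** Zh))"
      using e u by simp
    then show ?thesis using False by (simp add: fl_mm3_def matrix_mul_assoc)
  qed
qed


subsection \<open>The entry annihilated by the two rotations\<close>

text \<open>
  The unit vector \<open>(c, s)\<close> is the computed direction of \<open>x\<close>; \<open>\<omega>\<close> is its error, \<open>X\<close> is the hatted
  version of \<open>x\<close> and \<open>T\<close> bounds the cancellation factor.
\<close>

definition near :: "real \<Rightarrow> real \<Rightarrow> real \<Rightarrow> real \<Rightarrow> real \<Rightarrow> real \<Rightarrow> real \<Rightarrow> real \<Rightarrow> bool" where
  "near \<omega> T x1 x2 X1 X2 c s \<longleftrightarrow> c\<^sup>2 + s\<^sup>2 = 1 \<and>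
     (\<exists>r>0. \<bar>x1 - r * c\<bar> \<le> \<omega> * r \<and> \<bar>x2 - r * s\<bar> \<le> \<omega> * r \<and> X1 \<le> T * r \<and> X2 \<le> T * r)"

lemma nearE:
  assumes "near \<omega> T x1 x2 X1 X2 c s" "\<omega> \<le> 1"
  obtains r where "0 < r" "\<bar>x1 - r * c\<bar> \<le> \<omega> * r" "\<bar>x2 - r * s\<bar> \<le> \<omega> * r"
    "X1 \<le> T * r" "X2 \<le> T * r" "\<bar>c\<bar> \<le> 1" "\<bar>s\<bar> \<le> 1" "\<bar>x1\<bar> \<le> 2 * r" "\<bar>x2\<bar> \<le> 2 * r"
proof -
  obtain r where r: "0 < r" "\<bar>x1 - r * c\<bar> \<le> \<omega> * r" "\<bar>x2 - r * s\<bar> \<le> \<omega> * r"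
      "X1 \<le> T * r" "X2 \<le> T * r"
    using assms unfolding near_def by blast
  have cs: "\<bar>c\<bar> \<le> 1" "\<bar>s\<bar> \<le> 1"
    using assms(1) abs_le_1_if_sum_squares unfolding near_def by blast+
  have "\<omega> * r \<le> 1 * r" using assms(2) r(1) by (intro mult_right_mono) auto
  moreover have "\<bar>r * c\<bar> \<le> r" "\<bar>r * s\<bar> \<le> r"
    using cs r(1) by (simp_all add: abs_mult mult_left_le)
  ultimately have "\<bar>x1\<bar> \<le> 2 * r" "\<bar>x2\<bar> \<le> 2 * r" using r(2,3) by linarith+
  then show thesis using that r cs by blast
qed

text \<open>Each of the three entries of the upper triangle costs \<open>3 * \<omega>\<close>:
  \<open>2 * \<omega>\<close> for replacing the left vector, because the entries of the right one
  are at most \<open>2 * t\<close>, and \<open>\<omega>\<close> for replacing the right one.\<close>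

lemma bilinear_perturbation:
  fixes a b d m :: real
  assumes abd: "\<bar>a\<bar> \<le> m" "\<bar>b\<bar> \<le> m" "\<bar>d\<bar> \<le> m" and \<omega>: "0 \<le> \<omega>" "\<omega> \<le> 1"
    and p: "\<bar>p1\<bar> \<le> 1" "\<bar>p2\<bar> \<le> 1" and q: "\<bar>q1\<bar> \<le> 1" "\<bar>q2\<bar> \<le> 1"
    and r: "0 < r" and t: "0 < t"
    and P: "\<bar>P1 - r * p1\<bar> \<le> \<omega> * r" "\<bar>P2 - r * p2\<bar> \<le> \<omega> * r"
    and Q: "\<bar>Q1 - t * q1\<bar> \<le> \<omega> * t" "\<bar>Q2 - t * q2\<bar> \<le> \<omega> * t"
    and R: "\<bar>P1 * (a * Q1 + b * Q2) + P2 * (d * Q2)\<bar> \<le> m * R * (r * t)"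
  shows "\<bar>p1 * (a * q1 + b * q2) + p2 * (d * q2)\<bar> \<le> m * (9 * \<omega> + R)"
proof -
  have term_bound: "\<bar>x * (Px * Qx) - x * (r * t * (px * qx))\<bar> \<le> m * (3 * \<omega> * (r * t))"
    if "\<bar>x\<bar> \<le> m" "\<bar>px\<bar> \<le> 1" "\<bar>qx\<bar> \<le> 1" "\<bar>Px - r * px\<bar> \<le> \<omega> * r" "\<bar>Qx - t * qx\<bar> \<le> \<omega> * t"
    for x Px Qx px qx
  proof -
    have "\<omega> * t \<le> 1 * t" using \<omega> t by (intro mult_right_mono) auto
    moreover have tq: "\<bar>t * qx\<bar> \<le> t" using that(3) t by (simp add: abs_mult mult_left_le)
    ultimately have Qx: "\<bar>Qx\<bar> \<le> 2 * t" using that(5) by linarith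
    have "\<bar>(Px - r * px) * Qx\<bar> \<le> (\<omega> * r) * (2 * t)"
      unfolding abs_mult using that(4) Qx \<omega> r by (intro mult_mono) auto
    moreover have "\<bar>r * px\<bar> \<le> r" using that(2) r by (simp add: abs_mult mult_left_le)
    then have "\<bar>(r * px) * (Qx - t * qx)\<bar> \<le> r * (\<omega> * t)"
      unfolding abs_mult[of "r * px"] using that(5) r by (intro mult_mono) auto
    moreover have "Px * Qx - r * t * (px * qx) = (Px - r * px) * Qx + (r * px) * (Qx - t * qx)"
      by algebra
    ultimately have "\<bar>Px * Qx - r * t * (px * qx)\<bar> \<le> (\<omega> * r) * (2 * t) + r * (\<omega> * t)"
      by linarith
    then have "\<bar>Px * Qx - r * t * (px * qx)\<bar> \<le> 3 * \<omega> * (r * t)" by (simp add: algebra_simps)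
    then have "\<bar>x\<bar> * \<bar>Px * Qx - r * t * (px * qx)\<bar> \<le> m * (3 * \<omega> * (r * t))"
      using that(1) by (intro mult_mono) auto
    then show ?thesis by (simp add: abs_mult[symmetric] right_diff_distrib)
  qed
  define Z where "Z = p1 * (a * q1 + b * q2) + p2 * (d * q2)"
  have split: "P1 * (a * Q1 + b * Q2) + P2 * (d * Q2) - r * t * Z =
      (a * (P1 * Q1) - a * (r * t * (p1 * q1))) + (b * (P1 * Q2) - b * (r * t * (p1 * q2)))
      + (d * (P2 * Q2) - d * (r * t * (p2 * q2)))"
    unfolding Z_def by algebra
  have "\<bar>r * t * Z\<bar> \<le> 3 * (m * (3 * \<omega> * (r * t))) + m * R * (r * t)"
    using term_bound[OF abd(1) p(1) q(1) P(1) Q(1)] term_bound[OF abd(2) p(1) q(2) P(1) Q(2)]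
      term_bound[OF abd(3) p(2) q(2) P(2) Q(2)] R split by linarith
  then have "\<bar>Z\<bar> * (r * t) \<le> (m * (9 * \<omega> + R)) * (r * t)"
    using r t by (simp add: abs_mult algebra_simps)
  then show ?thesis using r t unfolding Z_def by (simp add: mult_le_cancel_right)
qed

lemma mult3_mono:
  fixes x y z :: real
  assumes "0 \<le> x" "0 \<le> y" "0 \<le> z" "x \<le> x'" "y \<le> y'" "z \<le> z'"
  shows "x * y * z \<le> x' * y' * z'"
  using assms by (intro mult_mono mult_nonneg_nonneg order_trans[of 0 x x'] order_trans[of 0 y y'])

text \<open>
  Here \<open>g\<close> is a row of \<open>V\<^sup>TC\<close>, \<open>l\<close> a column of \<open>BU\<close>, and \<open>g adj(A) l\<close> would be an off-diagonal
  entry of \<open>\<Sigma>\<close>. The bound \<open>res\<close> on it is linear in the cancellation factors, because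
  \<open>g\<^sub>1\<close> and \<open>l\<^sub>2\<close> are single products and the entry of \<open>adj(A)\<close> that pairs the
  two cancelling entries \<open>g\<^sub>2\<close> and \<open>l\<^sub>1\<close> vanishes.
\<close>

lemma annihilated_entry_bound:
  fixes a b d m g1 g2 gh2 l1 l2 lh1 :: real
  defines "k1 \<equiv> d * g1" and "k2 \<equiv> a * g2 - b * g1" and "h1 \<equiv> d * l1 - b * l2" and "h2 \<equiv> a * l2"
  assumes abd: "\<bar>a\<bar> \<le> m" "\<bar>b\<bar> \<le> m" "\<bar>d\<bar> \<le> m"
    and \<omega>: "0 \<le> \<omega>" "\<omega> \<le> 1" and \<rho>: "0 \<le> \<rho>" and T: "0 \<le> T"
    and hats: "0 \<le> gh2" "0 \<le> lh1"
    and res: "\<bar>g1 * h1 + g2 * h2\<bar>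
      \<le> \<rho> * (\<bar>g1\<bar> * \<bar>d\<bar> * lh1 + \<bar>g1\<bar> * \<bar>b\<bar> * \<bar>l2\<bar> + gh2 * \<bar>a\<bar> * \<bar>l2\<bar>)"
    and Q: "near \<omega> T g1 g2 \<bar>g1\<bar> gh2 q2 (- q1) \<or>
      near \<omega> T h1 h2 (\<bar>d\<bar> * lh1 + \<bar>b\<bar> * \<bar>l2\<bar>) (\<bar>a\<bar> * \<bar>l2\<bar>) q1 q2"
    and P: "near \<omega> T l1 l2 lh1 \<bar>l2\<bar> (- p2) p1 \<or>
      near \<omega> T k1 k2 (\<bar>d\<bar> * \<bar>g1\<bar>) (\<bar>b\<bar> * \<bar>g1\<bar> + \<bar>a\<bar> * gh2) p1 p2"
  shows "\<bar>p1 * (a * q1 + b * q2) + p2 * (d * q2)\<bar> \<le> m * (9 * \<omega> + \<rho> * (4 * T + 4))"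
proof -
  have m0: "0 \<le> m" using abd(1) by linarith
  have nn: "0 \<le> m * (\<rho> * (4 * T + 4)) * (r * t)" if "0 < r" "0 < t" for r t
    using m0 \<rho> T that by simp
  from Q P show ?thesis
  proof (elim disjE)
    assume q: "near \<omega> T g1 g2 \<bar>g1\<bar> gh2 q2 (- q1)"
      and p: "near \<omega> T l1 l2 lh1 \<bar>l2\<bar> (- p2) p1"
    obtain t where t: "0 < t" "\<bar>g1 - t * q2\<bar> \<le> \<omega> * t" "\<bar>g2 - t * - q1\<bar> \<le> \<omega> * t"
        "\<bar>g1\<bar> \<le> T * t" "gh2 \<le> T * t"
        "\<bar>q2\<bar> \<le> 1" "\<bar>- q1\<bar> \<le> 1" "\<bar>g1\<bar> \<le> 2 * t" "\<bar>g2\<bar> \<le> 2 * t"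
      by (rule nearE[OF q \<omega>(2)])
    obtain r where r: "0 < r" "\<bar>l1 - r * - p2\<bar> \<le> \<omega> * r" "\<bar>l2 - r * p1\<bar> \<le> \<omega> * r"
        "lh1 \<le> T * r" "\<bar>l2\<bar> \<le> T * r"
        "\<bar>- p2\<bar> \<le> 1" "\<bar>p1\<bar> \<le> 1" "\<bar>l1\<bar> \<le> 2 * r" "\<bar>l2\<bar> \<le> 2 * r"
      by (rule nearE[OF p \<omega>(2)])
    \<comment> \<open>For 2x2 matrices adj(A) = J^T A^T J, so turning g and l by right angles
      transforms the bilinear form of A into -g adj(A) l.\<close>
    have "\<bar>l2 * (a * (- g2) + b * g1) + (- l1) * (d * g1)\<bar> = \<bar>g1 * h1 + g2 * h2\<bar>"
    proof -
      have "l2 * (a * (- g2) + b * g1) + (- l1) * (d * g1) = - (g1 * h1 + g2 * h2)"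
        unfolding h1_def h2_def by algebra
      then show ?thesis by (simp only: abs_minus_cancel)
    qed
    \<comment> \<open>A hatted entry costs \<open>T\<close> times the length, an actual entry 2
      times the length; the three terms add up to 2T + 4 + 2T.\<close>
    also have "\<dots> \<le> \<rho> * ((2 * t) * m * (T * r) + (2 * t) * m * (2 * r) + (T * t) * m * (2 * r))"
      by (rule order_trans[OF res mult_left_mono[OF add_mono[OF add_mono] \<rho>]];
          rule mult3_mono) (fact abs_ge_zero hats abd t r)+
    also have "\<dots> = m * (\<rho> * (4 * T + 4)) * (r * t)" by algebra
    finally have R: "\<bar>l2 * (a * (- g2) + b * g1) + (- l1) * (d * g1)\<bar>
        \<le> m * (\<rho> * (4 * T + 4)) * (r * t)" .
    have "\<bar>- l1 - r * p2\<bar> \<le> \<omega> * r" "\<bar>- g2 - t * q1\<bar> \<le> \<omega> * t" "\<bar>p2\<bar> \<le> 1" "\<bar>q1\<bar> \<le> 1"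
      using r(2,6) t(3,7) by linarith+
    from bilinear_perturbation[OF abd \<omega> r(7) this(3,4) t(6) r(1) t(1) r(3) this(1,2) t(2) R]
    show ?thesis .
  next
    assume q: "near \<omega> T g1 g2 \<bar>g1\<bar> gh2 q2 (- q1)"
      and p: "near \<omega> T k1 k2 (\<bar>d\<bar> * \<bar>g1\<bar>) (\<bar>b\<bar> * \<bar>g1\<bar> + \<bar>a\<bar> * gh2) p1 p2"
    obtain t where t: "0 < t" "\<bar>g1 - t * q2\<bar> \<le> \<omega> * t" "\<bar>g2 - t * - q1\<bar> \<le> \<omega> * t"
        "\<bar>g1\<bar> \<le> T * t" "gh2 \<le> T * t"
        "\<bar>q2\<bar> \<le> 1" "\<bar>- q1\<bar> \<le> 1" "\<bar>g1\<bar> \<le> 2 * t" "\<bar>g2\<bar> \<le> 2 * t"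
      by (rule nearE[OF q \<omega>(2)])
    obtain r where r: "0 < r" "\<bar>k1 - r * p1\<bar> \<le> \<omega> * r" "\<bar>k2 - r * p2\<bar> \<le> \<omega> * r"
        "\<bar>d\<bar> * \<bar>g1\<bar> \<le> T * r" "\<bar>b\<bar> * \<bar>g1\<bar> + \<bar>a\<bar> * gh2 \<le> T * r"
        "\<bar>p1\<bar> \<le> 1" "\<bar>p2\<bar> \<le> 1" "\<bar>k1\<bar> \<le> 2 * r" "\<bar>k2\<bar> \<le> 2 * r"
      by (rule nearE[OF p \<omega>(2)])
    \<comment> \<open>Since adj(A) A = (a d) I, the row k A is a multiple of g, which is orthogonal
      to (-g2, g1).\<close>
    have "k1 * (a * (- g2) + b * g1) + k2 * (d * g1) = 0" unfolding k1_def k2_def by algebra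
    then have R: "\<bar>k1 * (a * (- g2) + b * g1) + k2 * (d * g1)\<bar> \<le> m * (\<rho> * (4 * T + 4)) * (r * t)"
      using nn[OF r(1) t(1)] by simp
    have "\<bar>- g2 - t * q1\<bar> \<le> \<omega> * t" "\<bar>q1\<bar> \<le> 1"
      using t(3,7) by linarith+
    from bilinear_perturbation[OF abd \<omega> r(6,7) this(2) t(6) r(1) t(1) r(2,3) this(1) t(2) R]
    show ?thesis .
  next
    assume q: "near \<omega> T h1 h2 (\<bar>d\<bar> * lh1 + \<bar>b\<bar> * \<bar>l2\<bar>) (\<bar>a\<bar> * \<bar>l2\<bar>) q1 q2"
      and p: "near \<omega> T l1 l2 lh1 \<bar>l2\<bar> (- p2) p1"
    obtain t where t: "0 < t" "\<bar>h1 - t * q1\<bar> \<le> \<omega> * t" "\<bar>h2 - t * q2\<bar> \<le> \<omega> * t"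
        "\<bar>d\<bar> * lh1 + \<bar>b\<bar> * \<bar>l2\<bar> \<le> T * t" "\<bar>a\<bar> * \<bar>l2\<bar> \<le> T * t"
        "\<bar>q1\<bar> \<le> 1" "\<bar>q2\<bar> \<le> 1" "\<bar>h1\<bar> \<le> 2 * t" "\<bar>h2\<bar> \<le> 2 * t"
      by (rule nearE[OF q \<omega>(2)])
    obtain r where r: "0 < r" "\<bar>l1 - r * - p2\<bar> \<le> \<omega> * r" "\<bar>l2 - r * p1\<bar> \<le> \<omega> * r"
        "lh1 \<le> T * r" "\<bar>l2\<bar> \<le> T * r"
        "\<bar>- p2\<bar> \<le> 1" "\<bar>p1\<bar> \<le> 1" "\<bar>l1\<bar> \<le> 2 * r" "\<bar>l2\<bar> \<le> 2 * r"
      by (rule nearE[OF p \<omega>(2)])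
    \<comment> \<open>Since A adj(A) = (a d) I, the column A h is a multiple of l, which is
      orthogonal to (l2, -l1).\<close>
    have "l2 * (a * h1 + b * h2) + (- l1) * (d * h2) = 0" unfolding h1_def h2_def by algebra
    then have R: "\<bar>l2 * (a * h1 + b * h2) + (- l1) * (d * h2)\<bar> \<le> m * (\<rho> * (4 * T + 4)) * (r * t)"
      using nn[OF r(1) t(1)] by simp
    have "\<bar>- l1 - r * p2\<bar> \<le> \<omega> * r" "\<bar>p2\<bar> \<le> 1"
      using r(2,6) by linarith+
    from bilinear_perturbation[OF abd \<omega> r(7) this(2) t(6,7) r(1) t(1) r(3) this(1) t(2,3) R]
    show ?thesis .
  next
    assume q: "near \<omega> T h1 h2 (\<bar>d\<bar> * lh1 + \<bar>b\<bar> * \<bar>l2\<bar>) (\<bar>a\<bar> * \<bar>l2\<bar>) q1 q2"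
      and p: "near \<omega> T k1 k2 (\<bar>d\<bar> * \<bar>g1\<bar>) (\<bar>b\<bar> * \<bar>g1\<bar> + \<bar>a\<bar> * gh2) p1 p2"
    obtain t where t: "0 < t" "\<bar>h1 - t * q1\<bar> \<le> \<omega> * t" "\<bar>h2 - t * q2\<bar> \<le> \<omega> * t"
        "\<bar>d\<bar> * lh1 + \<bar>b\<bar> * \<bar>l2\<bar> \<le> T * t" "\<bar>a\<bar> * \<bar>l2\<bar> \<le> T * t"
        "\<bar>q1\<bar> \<le> 1" "\<bar>q2\<bar> \<le> 1" "\<bar>h1\<bar> \<le> 2 * t" "\<bar>h2\<bar> \<le> 2 * t"
      by (rule nearE[OF q \<omega>(2)])
    obtain r where r: "0 < r" "\<bar>k1 - r * p1\<bar> \<le> \<omega> * r" "\<bar>k2 - r * p2\<bar> \<le> \<omega> * r"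
        "\<bar>d\<bar> * \<bar>g1\<bar> \<le> T * r" "\<bar>b\<bar> * \<bar>g1\<bar> + \<bar>a\<bar> * gh2 \<le> T * r"
        "\<bar>p1\<bar> \<le> 1" "\<bar>p2\<bar> \<le> 1" "\<bar>k1\<bar> \<le> 2 * r" "\<bar>k2\<bar> \<le> 2 * r"
      by (rule nearE[OF p \<omega>(2)])
    have dl: "\<bar>d\<bar> * lh1 \<le> T * t" using t(4) mult_nonneg_nonneg[of "\<bar>b\<bar>" "\<bar>l2\<bar>"] by linarith
    have ag: "\<bar>a\<bar> * gh2 \<le> T * r" using r(5) mult_nonneg_nonneg[of "\<bar>b\<bar>" "\<bar>g1\<bar>"] by linarith
    have "k1 * (a * h1 + b * h2) + k2 * (d * h2) = (a * d) * (g1 * h1 + g2 * h2)"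
      unfolding h1_def h2_def k1_def k2_def by algebra
    then have "\<bar>k1 * (a * h1 + b * h2) + k2 * (d * h2)\<bar> = \<bar>a * d\<bar> * \<bar>g1 * h1 + g2 * h2\<bar>"
      by (simp only: abs_mult)
    also have "\<dots> \<le> \<bar>a * d\<bar> * (\<rho> * (\<bar>g1\<bar> * \<bar>d\<bar> * lh1 + \<bar>g1\<bar> * \<bar>b\<bar> * \<bar>l2\<bar> + gh2 * \<bar>a\<bar> * \<bar>l2\<bar>))"
      using res by (intro mult_left_mono) auto
    \<comment> \<open>Here k A h = (a d) g adj(A) l. The factor a d is spread over the terms so that
      only entries and hats of h and k remain, with one entry of A left over. Estimated separately
      it would leave g and l, whose sizes are not controlled by the lengths \<open>r\<close> and
      \<open>t\<close> of this case.\<close>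
    also have "\<dots> = \<rho> * (\<bar>a\<bar> * \<bar>k1\<bar> * (\<bar>d\<bar> * lh1) + \<bar>b\<bar> * \<bar>k1\<bar> * \<bar>h2\<bar> + \<bar>d\<bar> * (\<bar>a\<bar> * gh2) * \<bar>h2\<bar>)"
      unfolding k1_def h2_def abs_mult by algebra
    also have "\<dots> \<le> \<rho> * (m * (2 * r) * (T * t) + m * (2 * r) * (2 * t) + m * (T * r) * (2 * t))"
      by (rule mult_left_mono[OF add_mono[OF add_mono] \<rho>]; rule mult3_mono)
        (fact abs_ge_zero mult_nonneg_nonneg[OF abs_ge_zero hats(1)]
          mult_nonneg_nonneg[OF abs_ge_zero hats(2)] abd t r dl ag)+
    also have "\<dots> = m * (\<rho> * (4 * T + 4)) * (r * t)" by algebra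
    finally have R: "\<bar>k1 * (a * h1 + b * h2) + k2 * (d * h2)\<bar>
        \<le> m * (\<rho> * (4 * T + 4)) * (r * t)" .
    from bilinear_perturbation[OF abd \<omega> r(6,7) t(6,7) r(1) t(1) r(2,3) t(2,3) R]
    show ?thesis .
  qed
qed

text \<open>The hypothesis \<open>zero\<close> is the (1,2) entry of V^T M U written out, so the
  exact expression equals minus the same form of the rounding error of M. The three products in the
  bound on \<open>m12\<close> fall into three different groups, which is what produces the hatted
  entries of g and l.\<close>

lemma residual_bound:
  fixes a b d :: real
  assumes rho: "0 \<le> \<rho>"
    and zero: "v1 * m11 * x1 + v1 * m12 * x2 + v2 * m22 * x2 = 0"
    and m11: "\<bar>m11 - c11 * d * b11\<bar> \<le> \<rho> * \<bar>c11 * d * b11\<bar>"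
    and m12: "\<bar>m12 - (c11 * d * b12 + c12 * a * b22 - c11 * b * b22)\<bar>
      \<le> \<rho> * (\<bar>c11 * d * b12\<bar> + \<bar>c12 * a * b22\<bar> + \<bar>c11 * b * b22\<bar>)"
    and m22: "\<bar>m22 - c22 * a * b22\<bar> \<le> \<rho> * \<bar>c22 * a * b22\<bar>"
  shows "\<bar>(v1 * c11) * (d * (b11 * x1 + b12 * x2) - b * (b22 * x2))
        + (v1 * c12 + v2 * c22) * (a * (b22 * x2))\<bar>
    \<le> \<rho> * (\<bar>v1 * c11\<bar> * \<bar>d\<bar> * (\<bar>b11 * x1\<bar> + \<bar>b12 * x2\<bar>) + \<bar>v1 * c11\<bar> * \<bar>b\<bar> * \<bar>b22 * x2\<bar>
      + (\<bar>v1 * c12\<bar> + \<bar>v2 * c22\<bar>) * \<bar>a\<bar> * \<bar>b22 * x2\<bar>)"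
proof -
  define e11 e12 e22 where "e11 = m11 - c11 * d * b11"
    and "e12 = m12 - (c11 * d * b12 + c12 * a * b22 - c11 * b * b22)"
    and "e22 = m22 - c22 * a * b22"
  have eq: "(v1 * c11) * (d * (b11 * x1 + b12 * x2) - b * (b22 * x2))
        + (v1 * c12 + v2 * c22) * (a * (b22 * x2))
      = - (v1 * x1 * e11 + v1 * x2 * e12 + v2 * x2 * e22)"
    using zero unfolding e11_def e12_def e22_def by algebra
  have "\<bar>v1 * x1 * e11\<bar> \<le> \<bar>v1 * x1\<bar> * (\<rho> * \<bar>c11 * d * b11\<bar>)"
    unfolding abs_mult[of _ e11] using m11 e11_def by (intro mult_left_mono) auto
  moreover have "\<bar>v1 * x2 * e12\<bar>
      \<le> \<bar>v1 * x2\<bar> * (\<rho> * (\<bar>c11 * d * b12\<bar> + \<bar>c12 * a * b22\<bar> + \<bar>c11 * b * b22\<bar>))"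
    unfolding abs_mult[of _ e12] using m12 e12_def by (intro mult_left_mono) auto
  moreover have "\<bar>v2 * x2 * e22\<bar> \<le> \<bar>v2 * x2\<bar> * (\<rho> * \<bar>c22 * a * b22\<bar>)"
    unfolding abs_mult[of _ e22] using m22 e22_def by (intro mult_left_mono) auto
  moreover have "\<bar>- (x + y + z)\<bar> \<le> \<bar>x\<bar> + \<bar>y\<bar> + \<bar>z\<bar>" for x y z :: real by linarith
  ultimately have "\<bar>- (v1 * x1 * e11 + v1 * x2 * e12 + v2 * x2 * e22)\<bar>
      \<le> \<bar>v1 * x1\<bar> * (\<rho> * \<bar>c11 * d * b11\<bar>)
        + \<bar>v1 * x2\<bar> * (\<rho> * (\<bar>c11 * d * b12\<bar> + \<bar>c12 * a * b22\<bar> + \<bar>c11 * b * b22\<bar>))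
        + \<bar>v2 * x2\<bar> * (\<rho> * \<bar>c22 * a * b22\<bar>)"
    by (meson add_mono order_trans)
  also have "\<dots> = \<rho> * (\<bar>v1 * c11\<bar> * \<bar>d\<bar> * (\<bar>b11 * x1\<bar> + \<bar>b12 * x2\<bar>) + \<bar>v1 * c11\<bar> * \<bar>b\<bar> * \<bar>b22 * x2\<bar>
      + (\<bar>v1 * c12\<bar> + \<bar>v2 * c22\<bar>) * \<bar>a\<bar> * \<bar>b22 * x2\<bar>)"
    unfolding abs_mult by algebra
  finally show ?thesis unfolding eq .
qed

subsection \<open>The cancellation factors\<close>

text \<open>All roundings together change the quotient by well under a factor 2, the slack granted
  in both directions.\<close>

lemma fl_eta_bounds:
  assumes F: "arith_model u F" and u: "0 \<le> u" "u \<le> 1/100000"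
    and N: "0 \<le> N1" "0 \<le> N2" "\<bar>n1 - N1\<bar> \<le> 110 * u * N1" "\<bar>n2 - N2\<bar> \<le> 110 * u * N2"
  shows fl_eta_leD: "fl_eta F n1 n2 d1 d2 \<le> ereal t \<Longrightarrow>
      (d1 \<noteq> 0 \<or> d2 \<noteq> 0) \<and> N1 + N2 \<le> 2 * t * (\<bar>d1\<bar> + \<bar>d2\<bar>)"
    and fl_eta_leI: "d1 \<noteq> 0 \<or> d2 \<noteq> 0 \<Longrightarrow> N1 + N2 \<le> t * (\<bar>d1\<bar> + \<bar>d2\<bar>) \<Longrightarrow>
      fl_eta F n1 n2 d1 d2 \<le> ereal (2 * t)"
proof -
  define y where "y = n1 + n2"
  define D d S n z where "D = \<bar>d1\<bar> + \<bar>d2\<bar>" and "d = fl_add F \<bar>d1\<bar> \<bar>d2\<bar>" and "S = N1 + N2"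
    and "n = fl_add F n1 n2" and "z = fl_div F n d"
  have D0: "0 \<le> D" and S0: "0 \<le> S" using N by (simp_all add: D_def S_def)
  have small: "u * x \<le> x / 100000" if "0 \<le> x" for x :: real
    using mult_right_mono[OF u(2) that] by simp
  have d: "\<bar>d - D\<bar> \<le> D / 100000"
    using rel_pert_abs[OF arith_modelD(1)[OF F, of "\<bar>d1\<bar>" "\<bar>d2\<bar>"]] small[OF D0]
    by (simp add: d_def D_def)
  have sum: "\<bar>y - S\<bar> \<le> S * 11 / 10000"
  proof -
    have "\<bar>n1 - N1\<bar> \<le> 11/10000 * N1" "\<bar>n2 - N2\<bar> \<le> 11/10000 * N2"
      using N small[OF N(1)] small[OF N(2)] by linarith+
    then show ?thesis using S_def y_def by linarith
  qed
  then have "0 \<le> y" using S0 by linarith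
  then have "\<bar>n - y\<bar> \<le> y / 100000"
    using rel_pert_abs[OF arith_modelD(1)[OF F, of n1 n2]] small[of y] by (simp add: n_def y_def)
  with sum have n: "9/10 * S \<le> n" "n \<le> 11/10 * S" using S0 by linarith+
  have z: "9/10 * n \<le> z * d \<and> z * d \<le> 11/10 * n" if "0 < d"
  proof -
    define x where "x = n / d"
    have x0: "0 \<le> x" using n S0 that by (simp add: x_def)
    have "\<bar>z - x\<bar> \<le> x / 100000"
      using rel_pert_abs[OF arith_modelD(4)[OF F, of d n]] small[OF x0] that
      unfolding x_def[symmetric] z_def[symmetric] abs_of_nonneg[OF x0] by linarith
    then have "9/10 * x \<le> z" "z \<le> 11/10 * x" using x0 by linarith+
    then have "9/10 * x * d \<le> z * d" "z * d \<le> 11/10 * x * d"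
      using that by (simp_all only: mult_right_mono less_imp_le)
    then show ?thesis using that by (simp add: x_def)
  qed
  have eta: "fl_eta F n1 n2 d1 d2 = (if d = 0 then \<infinity> else ereal z)"
    by (simp add: fl_eta_def Let_def d_def n_def z_def)
  show "(d1 \<noteq> 0 \<or> d2 \<noteq> 0) \<and> N1 + N2 \<le> 2 * t * (\<bar>d1\<bar> + \<bar>d2\<bar>)"
    if "fl_eta F n1 n2 d1 d2 \<le> ereal t"
  proof -
    have "d \<noteq> 0" and zt: "z \<le> t" using that by (auto simp: eta split: if_splits)
    then have Dp: "0 < D" and dp: "0 < d" using d D0 by linarith+
    have "z * d \<le> t * d" using zt dp by simp
    then have "9/10 * n \<le> t * d" using z[OF dp] by linarith
    then have Std: "8/10 * S \<le> t * d" using n S0 by linarith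
    then have "0 \<le> t * d" using S0 by linarith
    then have "0 \<le> t" using dp by (simp add: zero_le_mult_iff)
    moreover have "d \<le> 11/10 * D" using d D0 by linarith
    ultimately have "t * d \<le> t * (11/10 * D)" by (intro mult_left_mono)
    moreover have "t * (11/10 * D) = 11/10 * (t * D)" by simp
    ultimately have "S \<le> 2 * (t * D)" using S0 Std by linarith
    then show ?thesis using Dp unfolding S_def D_def by auto
  qed
  show "fl_eta F n1 n2 d1 d2 \<le> ereal (2 * t)"
    if nz: "d1 \<noteq> 0 \<or> d2 \<noteq> 0" and le: "N1 + N2 \<le> t * (\<bar>d1\<bar> + \<bar>d2\<bar>)"
  proof -
    have Dp: "0 < D" using nz by (auto simp: D_def)
    then have dp: "0 < d" using d by linarith
    have SD: "S \<le> t * D" using le by (simp add: S_def D_def)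
    then have "0 \<le> t * D" using S0 by linarith
    then have t0: "0 \<le> t" using Dp by (simp add: zero_le_mult_iff)
    have "D \<le> 11/10 * d" using d D0 by linarith
    then have "t * D \<le> t * (11/10 * d)" using t0 by (rule mult_left_mono)
    moreover have "t * (11/10 * d) = 11/10 * (t * d)" by simp
    moreover have "0 \<le> t * d" using t0 dp by simp
    ultimately have "z * d \<le> (2 * t) * d" using z[OF dp] n SD S0 by linarith
    then show ?thesis using dp by (simp add: eta)
  qed
qed

text \<open>The two sums are the coordinates of (y, z) in an orthonormal basis, so the square of one
  of them is at least half of y^2 + z^2, while by Cauchy-Schwarz the sums of absolute values are at
  most the length of (y, z). The ratio sqrt 2 is rounded up to 2. If y = z = 0 nothing cancels, and
  \<open>x\<close> provides a nonzero vector.\<close>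

lemma one_column_without_cancellation:
  fixes v1 v2 w1 w2 x y z :: real
  assumes rows: "v1\<^sup>2 + w1\<^sup>2 = 1" "v2\<^sup>2 + w2\<^sup>2 = 1" "v1 * v2 + w1 * w2 = 0"
    and cols: "v1\<^sup>2 + v2\<^sup>2 = 1" "w1\<^sup>2 + w2\<^sup>2 = 1"
    and nz: "x \<noteq> 0 \<or> y \<noteq> 0 \<or> z \<noteq> 0"
  shows "(\<bar>v1 * y\<bar> + \<bar>v2 * z\<bar> \<le> 2 * \<bar>v1 * y + v2 * z\<bar> \<and> (v1 * x \<noteq> 0 \<or> v1 * y + v2 * z \<noteq> 0)) \<or>
    (\<bar>w1 * y\<bar> + \<bar>w2 * z\<bar> \<le> 2 * \<bar>w1 * y + w2 * z\<bar> \<and> (w1 * x \<noteq> 0 \<or> w1 * y + w2 * z \<noteq> 0))"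
proof (cases "y = 0 \<and> z = 0")
  case True
  have "v1 \<noteq> 0 \<or> w1 \<noteq> 0" using rows(1) by auto
  then show ?thesis using True nz by auto
next
  case False
  have cs: "(\<bar>s1 * y\<bar> + \<bar>s2 * z\<bar>)\<^sup>2 \<le> y\<^sup>2 + z\<^sup>2" if "s1\<^sup>2 + s2\<^sup>2 = 1" for s1 s2 :: real
  proof -
    \<comment> \<open>Lagrange's identity.\<close>
    have "(\<bar>s1\<bar> * \<bar>y\<bar> + \<bar>s2\<bar> * \<bar>z\<bar>)\<^sup>2 + (\<bar>s1\<bar> * \<bar>z\<bar> - \<bar>s2\<bar> * \<bar>y\<bar>)\<^sup>2
        = (\<bar>s1\<bar>\<^sup>2 + \<bar>s2\<bar>\<^sup>2) * (\<bar>y\<bar>\<^sup>2 + \<bar>z\<bar>\<^sup>2)"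
      by algebra
    also have "\<dots> = y\<^sup>2 + z\<^sup>2" using that by simp
    finally show ?thesis using zero_le_power2[of "\<bar>s1\<bar> * \<bar>z\<bar> - \<bar>s2\<bar> * \<bar>y\<bar>"]
      unfolding abs_mult by linarith
  qed
  have large: "\<bar>s1 * y\<bar> + \<bar>s2 * z\<bar> \<le> 2 * \<bar>s\<bar> \<and> s \<noteq> 0"
    if "s1\<^sup>2 + s2\<^sup>2 = 1" "y\<^sup>2 + z\<^sup>2 \<le> 2 * s\<^sup>2" for s1 s2 s :: real
  proof -
    have pos: "0 < y\<^sup>2 + z\<^sup>2" using False by (simp add: sum_power2_gt_zero_iff)
    have "(\<bar>s1 * y\<bar> + \<bar>s2 * z\<bar>)\<^sup>2 \<le> (2 * \<bar>s\<bar>)\<^sup>2"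
      using cs[OF that(1)] that(2) zero_le_power2[of s] by (simp only: power_mult_distrib power2_abs power2_eq_square[of 2])
    then have "\<bar>s1 * y\<bar> + \<bar>s2 * z\<bar> \<le> 2 * \<bar>s\<bar>" by (rule power2_le_imp_le) simp
    moreover have "s \<noteq> 0" using pos that(2) by auto
    ultimately show ?thesis by blast
  qed
  have "(v1 * y + v2 * z)\<^sup>2 + (w1 * y + w2 * z)\<^sup>2
      = (v1\<^sup>2 + w1\<^sup>2) * y\<^sup>2 + (v2\<^sup>2 + w2\<^sup>2) * z\<^sup>2 + 2 * (v1 * v2 + w1 * w2) * (y * z)"
    by algebra
  then have "(v1 * y + v2 * z)\<^sup>2 + (w1 * y + w2 * z)\<^sup>2 = y\<^sup>2 + z\<^sup>2" using rows by simp
  then have "y\<^sup>2 + z\<^sup>2 \<le> 2 * (v1 * y + v2 * z)\<^sup>2 \<or> y\<^sup>2 + z\<^sup>2 \<le> 2 * (w1 * y + w2 * z)\<^sup>2"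
    by linarith
  then show ?thesis using large[OF cols(1)] large[OF cols(2)] by blast
qed

text \<open>The row g is recovered from k through k A = (a d) g, so |a d| times its size is at most
  \<open>2 * m\<close> times the size of k; conversely the hat of k is at most \<open>2 * m\<close>
  times the size of g. The round trip costs 4 m^2/|a d|, hence at most
  \<open>4 * \<kappa>\<close>.\<close>

lemma bounded_cancellation:
  fixes a b d m :: real
  assumes abd: "\<bar>a\<bar> \<le> m" "\<bar>b\<bar> \<le> m" "\<bar>d\<bar> \<le> m" "a \<noteq> 0" "d \<noteq> 0"
    and m: "0 < m" "m\<^sup>2 \<le> \<kappa> * \<bar>a * d\<bar>" and \<kappa>: "1 \<le> \<kappa>" and u: "0 \<le> u" "\<kappa> * u \<le> 1/100000"
    and g: "g1 \<noteq> 0 \<or> g2 \<noteq> 0" "gh2 \<le> 2 * \<bar>g2\<bar>" "\<bar>g2\<bar> \<le> gh2"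
    and G: "\<bar>G1 - g1\<bar> \<le> 110 * u * \<bar>g1\<bar>" "\<bar>G2 - g2\<bar> \<le> 110 * u * gh2"
    and K: "\<bar>K1 - d * g1\<bar> \<le> 110 * u * (\<bar>d\<bar> * \<bar>g1\<bar>)"
      "\<bar>K2 - (a * g2 - b * g1)\<bar> \<le> 110 * u * (\<bar>b\<bar> * \<bar>g1\<bar> + \<bar>a\<bar> * gh2)"
  shows "G1 \<noteq> 0 \<or> G2 \<noteq> 0" "\<bar>g1\<bar> + gh2 \<le> 50 * \<kappa> * (\<bar>G1\<bar> + \<bar>G2\<bar>)"
    "K1 \<noteq> 0 \<or> K2 \<noteq> 0" "\<bar>d\<bar> * \<bar>g1\<bar> + (\<bar>b\<bar> * \<bar>g1\<bar> + \<bar>a\<bar> * gh2) \<le> 50 * \<kappa> * (\<bar>K1\<bar> + \<bar>K2\<bar>)"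
proof -
  define S where "S = \<bar>g1\<bar> + \<bar>g2\<bar>"
  have S: "0 < S" "\<bar>g1\<bar> + gh2 \<le> 2 * S" using g by (auto simp: S_def)
  have "1 * u \<le> \<kappa> * u" using \<kappa> u by (intro mult_right_mono)
  then have u5: "u \<le> 1/100000" using u by linarith
  have "\<bar>G1 - g1\<bar> + \<bar>G2 - g2\<bar> \<le> 110 * u * (\<bar>g1\<bar> + gh2)" using G by (simp add: distrib_left)
  also have "\<dots> \<le> 110 * (1/100000) * (2 * S)" using S u5 u g by (intro mult_mono) auto
  finally have GS: "S / 2 \<le> \<bar>G1\<bar> + \<bar>G2\<bar>"
    using S(1) S_def abs_triangle_ineq2_sym[of g1 G1] abs_triangle_ineq2_sym[of g2 G2] by linarith
  then show "G1 \<noteq> 0 \<or> G2 \<noteq> 0" using S(1) by auto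
  define GG where "GG = \<bar>G1\<bar> + \<bar>G2\<bar>"
  have "1 * GG \<le> \<kappa> * GG" using \<kappa> by (intro mult_right_mono) (auto simp: GG_def)
  then have "\<bar>g1\<bar> + gh2 \<le> 50 * (\<kappa> * GG)" using GS S GG_def by linarith
  then have "\<bar>g1\<bar> + gh2 \<le> 50 * (\<kappa> * (\<bar>G1\<bar> + \<bar>G2\<bar>))" by (simp only: GG_def)
  then show "\<bar>g1\<bar> + gh2 \<le> 50 * \<kappa> * (\<bar>G1\<bar> + \<bar>G2\<bar>)" by simp
  define k1 k2 kh s where "k1 = d * g1" and "k2 = a * g2 - b * g1"
    and "kh = \<bar>d\<bar> * \<bar>g1\<bar> + (\<bar>b\<bar> * \<bar>g1\<bar> + \<bar>a\<bar> * gh2)" and "s = \<bar>k1\<bar> + \<bar>k2\<bar>"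
  have gh0: "0 \<le> gh2" using g(3) by linarith
  have adS: "\<bar>a * d\<bar> * S \<le> 2 * m * s"
  proof -
    have "\<bar>a * d * g1\<bar> \<le> m * \<bar>k1\<bar>"
      unfolding k1_def mult.assoc[of a] abs_mult[of a] using abd(1) by (intro mult_right_mono) auto
    moreover have "a * d * g2 = d * k2 + b * k1" unfolding k1_def k2_def by algebra
    then have "\<bar>a * d * g2\<bar> \<le> \<bar>d\<bar> * \<bar>k2\<bar> + \<bar>b\<bar> * \<bar>k1\<bar>" by (metis abs_mult abs_triangle_ineq)
    moreover have "\<bar>d\<bar> * \<bar>k2\<bar> \<le> m * \<bar>k2\<bar>" "\<bar>b\<bar> * \<bar>k1\<bar> \<le> m * \<bar>k1\<bar>"
      using abd by (simp_all add: mult_right_mono)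
    moreover have "0 \<le> m * \<bar>k2\<bar>" using m by simp
    ultimately have "\<bar>a * d * g1\<bar> + \<bar>a * d * g2\<bar> \<le> 2 * (m * \<bar>k1\<bar>) + 2 * (m * \<bar>k2\<bar>)" by linarith
    then show ?thesis by (simp add: S_def s_def abs_mult algebra_simps)
  qed
  have "kh \<le> m * \<bar>g1\<bar> + (m * \<bar>g1\<bar> + m * gh2)"
    unfolding kh_def using abd gh0 by (intro add_mono mult_right_mono) auto
  also have "\<dots> = m * (2 * \<bar>g1\<bar> + gh2)" by algebra
  also have "\<dots> \<le> m * (2 * S)" using g(2) m by (intro mult_left_mono) (auto simp: S_def)
  finally have kh: "kh \<le> m * (2 * S)" .
  have kh0: "0 \<le> kh" unfolding kh_def using gh0 by simp
  have "\<bar>a * d\<bar> * kh \<le> \<bar>a * d\<bar> * (m * (2 * S))" using kh by (intro mult_left_mono) auto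
  also have "\<dots> = 2 * m * (\<bar>a * d\<bar> * S)" by algebra
  also have "\<dots> \<le> 2 * m * (2 * m * s)" using adS m by (intro mult_left_mono) auto
  also have "\<dots> = 4 * s * m\<^sup>2" by algebra
  also have "\<dots> \<le> 4 * s * (\<kappa> * \<bar>a * d\<bar>)" using m by (intro mult_left_mono) (auto simp: s_def)
  also have "\<dots> = \<bar>a * d\<bar> * (4 * (\<kappa> * s))" by algebra
  finally have khs: "kh \<le> 4 * (\<kappa> * s)" using abd(4,5) by simp
  have "0 < \<bar>a * d\<bar> * S" using S abd by simp
  then have "0 < 2 * m * s" using adS by linarith
  then have s0: "0 < s" using m by (simp add: zero_less_mult_iff)
  \<comment> \<open>The error of the computed k is proportional to its hat, which may exceed k by
    the factor \<open>4 * \<kappa>\<close>. Smallness of \<open>\<kappa> * u\<close> keeps this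
    error from swallowing k.\<close>
  have "\<bar>K1 - k1\<bar> + \<bar>K2 - k2\<bar> \<le> 110 * u * kh"
    using K by (simp add: distrib_left kh_def k1_def k2_def)
  also have "\<dots> \<le> 110 * u * (4 * (\<kappa> * s))" using khs u by (intro mult_left_mono) auto
  also have "\<dots> = 440 * s * (\<kappa> * u)" by algebra
  also have "\<dots> \<le> 440 * s * (1/100000)" using u s0 by (intro mult_left_mono) auto
  finally have Ks: "s / 2 \<le> \<bar>K1\<bar> + \<bar>K2\<bar>"
    using s0 s_def abs_triangle_ineq2_sym[of k1 K1] abs_triangle_ineq2_sym[of k2 K2] by linarith
  then show "K1 \<noteq> 0 \<or> K2 \<noteq> 0" using s0 by auto
  \<comment> \<open>This gives \<open>8 * \<kappa>\<close>. The stated 50 leaves room; doubled by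
    the rounding of the quotient it becomes the threshold \<open>100 * \<kappa>\<close>.\<close>
  have "\<kappa> * (s / 2) \<le> \<kappa> * (\<bar>K1\<bar> + \<bar>K2\<bar>)" using Ks \<kappa> by (intro mult_left_mono) auto
  moreover have "0 \<le> \<kappa> * s" using \<kappa> s0 by simp
  ultimately have "kh \<le> 50 * (\<kappa> * (\<bar>K1\<bar> + \<bar>K2\<bar>))" using khs by simp
  then show "\<bar>d\<bar> * \<bar>g1\<bar> + (\<bar>b\<bar> * \<bar>g1\<bar> + \<bar>a\<bar> * gh2) \<le> 50 * \<kappa> * (\<bar>K1\<bar> + \<bar>K2\<bar>)"
    by (simp add: kh_def)
qed

subsection \<open>Rotations and their selection\<close>

text \<open>The reference length \<open>r\<close> is that of the computed vector (f, g), whose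
  direction is exact by construction; only then is (f, g) compared with x. The 4 is the given 2
  combined with \<open>\<bar>f\<bar> + \<bar>g\<bar> \<le> 2 * r\<close>.\<close>

lemma nearI:
  assumes nz: "f \<noteq> 0 \<or> g \<noteq> 0" and e: "0 \<le> e" and t: "0 \<le> t" and X: "0 \<le> X1" "0 \<le> X2"
    and f: "\<bar>f - x1\<bar> \<le> e * X1" and g: "\<bar>g - x2\<bar> \<le> e * X2"
    and le: "X1 + X2 \<le> 2 * t * (\<bar>f\<bar> + \<bar>g\<bar>)"
  shows "near (4 * t * e) (4 * t) x1 x2 X1 X2 (f / sqrt (f\<^sup>2 + g\<^sup>2)) (g / sqrt (f\<^sup>2 + g\<^sup>2))"
proof -
  define r where "r = sqrt (f\<^sup>2 + g\<^sup>2)"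
  have r2: "f\<^sup>2 + g\<^sup>2 > 0" using nz by (simp add: sum_power2_gt_zero_iff)
  then have r: "0 < r" "r\<^sup>2 = f\<^sup>2 + g\<^sup>2" by (simp_all add: r_def)
  have "\<bar>f\<bar> \<le> r" "\<bar>g\<bar> \<le> r" by (simp_all add: r_def)
  then have "2 * t * (\<bar>f\<bar> + \<bar>g\<bar>) \<le> 2 * t * (r + r)" using t by (intro mult_left_mono add_mono) auto
  also have "2 * t * (r + r) = 4 * t * r" by algebra
  finally have X12: "X1 \<le> 4 * t * r" "X2 \<le> 4 * t * r" using le X by linarith+
  have "e * X1 \<le> e * (4 * t * r)" "e * X2 \<le> e * (4 * t * r)"
    using X12 e by (simp_all only: mult_left_mono)
  then have "\<bar>x1 - f\<bar> \<le> 4 * t * e * r" "\<bar>x2 - g\<bar> \<le> 4 * t * e * r"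
    using f g by (simp_all add: abs_minus_commute algebra_simps)
  then have "\<bar>x1 - r * (f / r)\<bar> \<le> 4 * t * e * r" "\<bar>x2 - r * (g / r)\<bar> \<le> 4 * t * e * r"
    using r by simp_all
  moreover have "(f / r)\<^sup>2 + (g / r)\<^sup>2 = 1"
    using r r2 nz by (simp add: power_divide add_divide_distrib[symmetric])
  ultimately show ?thesis using r X12 unfolding near_def r_def[symmetric] by blast
qed

text \<open>\<open>R\<close> is the exact rotation for the computed data f, g: their errors go into
  \<open>near\<close>, and only the error of xLARTG separates \<open>R\<close> from the computed
  rotation. Both readings are recorded, one column parallel to the vector and the other orthogonal
  to it, because the second column is used for Q and the first for P.\<close>

lemma rotation_correct:
  assumes F: "xlartg_model u F" and nz: "f \<noteq> 0 \<or> g \<noteq> 0" and e: "0 \<le> e" and t: "0 \<le> t"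
    and X: "0 \<le> X1" "0 \<le> X2" and f: "\<bar>f - x1\<bar> \<le> e * X1" and g: "\<bar>g - x2\<bar> \<le> e * X2"
    and le: "X1 + X2 \<le> 2 * t * (\<bar>f\<bar> + \<bar>g\<bar>)"
  shows rot_first_correct: "\<exists>R. orthogonal_matrix R \<and> err (6 * u) (rot_first F f g) R \<bar>R\<bar> \<and>
      near (4 * t * e) (4 * t) x1 x2 X1 X2 (R$1$1) (R$2$1) \<and>
      near (4 * t * e) (4 * t) x1 x2 X1 X2 (R$2$2) (- (R$1$2))" (is ?first)
    and rot_second_correct: "\<exists>R. orthogonal_matrix R \<and> err (6 * u) (rot_second F f g) R \<bar>R\<bar> \<and>
      near (4 * t * e) (4 * t) x1 x2 X1 X2 (R$1$2) (R$2$2) \<and>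
      near (4 * t * e) (4 * t) x1 x2 X1 X2 (- (R$2$1)) (R$1$1)" (is ?second)
proof -
  define c s where "c = f / sqrt (f\<^sup>2 + g\<^sup>2)" and "s = g / sqrt (f\<^sup>2 + g\<^sup>2)"
  have near: "near (4 * t * e) (4 * t) x1 x2 X1 X2 c s"
    unfolding c_def s_def by (rule nearI[OF nz e t X f g le])
  then have cs: "c\<^sup>2 + s\<^sup>2 = 1" "s\<^sup>2 + c\<^sup>2 = 1" by (simp_all add: near_def add.commute)
  have neg: "\<bar>- x - - y\<bar> = \<bar>x - y\<bar>" for x y :: real by linarith
  obtain c' s' where fg: "fl_rot F f g = (c', s')" by fastforce
  have "rel_pert (6 * u) c c'" "rel_pert (6 * u) s s'"
    using F nz fg unfolding xlartg_model_def c_def s_def by (metis fst_conv snd_conv)+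
  then have "err (6 * u) (rot_first F f g) (mat2 c (- s) s c) \<bar>mat2 c (- s) s c\<bar>"
    using fg neg[of s' s] by (simp add: err_def forall_2 rot_first_def abs_mat22_nth rel_pert_abs)
  then show ?first
    using orthogonal_rotation(1)[OF cs(1)] near by (intro exI[of _ "mat2 c (- s) s c"]) simp
  \<comment> \<open>\<open>rot_second\<close> passes its arguments in reverse order, so the computed
    cosine approximates \<open>s\<close>.\<close>
  obtain c'' s'' where gf: "fl_rot F g f = (c'', s'')" by fastforce
  have "rel_pert (6 * u) s c''" "rel_pert (6 * u) c s''"
    using F nz gf unfolding xlartg_model_def c_def s_def by (metis fst_conv snd_conv add.commute)+
  then have "err (6 * u) (rot_second F f g) (mat2 s c (- c) s) \<bar>mat2 s c (- c) s\<bar>"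
    using gf neg[of s'' c] by (simp add: err_def forall_2 rot_second_def abs_mat22_nth rel_pert_abs)
  then show ?second
    using orthogonal_rotation(2)[OF cs(2)] near by (intro exI[of _ "mat2 s c (- c) s"]) simp
qed

text \<open>What selection and error analysis use of a computed factor \<open>\<eta>\<close> of \<open>y\<close>; \<open>X\<close> is its exact numerator.\<close>

definition eta_sound :: "fp_system \<Rightarrow> real \<Rightarrow> ereal \<Rightarrow> real \<Rightarrow> real \<Rightarrow> real \<Rightarrow> bool" where
  "eta_sound F t \<eta> y1 y2 X \<longleftrightarrow> (fl_add F \<bar>y1\<bar> \<bar>y2\<bar> = 0 \<longrightarrow> \<eta> = \<infinity>) \<and>
     (\<eta> \<le> ereal t \<longrightarrow> (y1 \<noteq> 0 \<or> y2 \<noteq> 0) \<and> X \<le> 2 * t * (\<bar>y1\<bar> + \<bar>y2\<bar>))"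

lemma eta_sound_minus [simp]: "eta_sound F t \<eta> (- y1) (- y2) X = eta_sound F t \<eta> y1 y2 X"
  by (simp add: eta_sound_def)

lemma eta_sound_fl_eta:
  assumes "arith_model u F" "0 \<le> u" "u \<le> 1/100000"
    "0 \<le> N1" "0 \<le> N2" "\<bar>n1 - N1\<bar> \<le> 110 * u * N1" "\<bar>n2 - N2\<bar> \<le> 110 * u * N2"
  shows "eta_sound F t (fl_eta F n1 n2 d1 d2) d1 d2 (N1 + N2)"
  unfolding eta_sound_def
proof (intro conjI impI)
  show "fl_eta F n1 n2 d1 d2 = \<infinity>" if "fl_add F \<bar>d1\<bar> \<bar>d2\<bar> = 0"
    using that by (simp add: fl_eta_def)
qed (use fl_eta_leD[OF assms] in blast)+

text \<open>A vanishing computed denominator makes the factor infinite, so the tests of steps 6 and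
  7, special cases included, pick the smaller factor. Finiteness of \<open>t\<close> excludes that
  both denominators vanish.\<close>

lemma selected_eta_le:
  fixes \<eta> \<eta>' t :: ereal
  assumes "min \<eta> \<eta>' \<le> t" "t \<noteq> \<infinity>" "z \<Longrightarrow> \<eta> = \<infinity>" "z' \<Longrightarrow> \<eta>' = \<infinity>"
  shows "if z' \<or> (\<not> z \<and> \<eta> \<le> \<eta>') then \<eta> \<le> t else \<eta>' \<le> t"
  using assms by (auto simp: min_def split: if_splits)

text \<open>\<open>G\<close>, \<open>H\<close>, \<open>K\<close>, \<open>L\<close> are any matrices
  within the error bounds, and of V^T M U only the (1,2) entry has to vanish. In this form the
  result covers both alternatives of step 5, the second one with all factors multiplied by
  \<open>J2\<close>.\<close>

lemma rsvd22_finish_annihilates: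
  fixes A B C U V G H K L :: mat22
  assumes F: "fp_model u F" and u: "0 \<le> u" "\<kappa> * u \<le> 1/100000" and \<kappa>: "1 \<le> \<kappa>"
    and tri: "A$2$1 = 0" "B$2$1 = 0" "C$2$1 = 0"
    and abd: "\<bar>A$1$1\<bar> \<le> m" "\<bar>A$1$2\<bar> \<le> m" "\<bar>A$2$2\<bar> \<le> m"
    and G: "err (110 * u) G (transpose V ** C) (transpose \<bar>V\<bar> ** \<bar>C\<bar>)"
    and L: "err (110 * u) L (B ** U) (\<bar>B\<bar> ** \<bar>U\<bar>)"
    and H: "err (110 * u) H (adj2 A ** (B ** U)) (\<bar>adj2 A\<bar> ** (\<bar>B\<bar> ** \<bar>U\<bar>))"
    and K: "err (110 * u) K ((transpose V ** C) ** adj2 A) ((transpose \<bar>V\<bar> ** \<bar>C\<bar>) ** \<bar>adj2 A\<bar>)"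
    and M: "\<bar>M$1$1 - C$1$1 * A$2$2 * B$1$1\<bar> \<le> 6 * u * \<bar>C$1$1 * A$2$2 * B$1$1\<bar>"
      "\<bar>M$1$2 - (C$1$1 * A$2$2 * B$1$2 + C$1$2 * A$1$1 * B$2$2 - C$1$1 * A$1$2 * B$2$2)\<bar>
        \<le> 6 * u * (\<bar>C$1$1 * A$2$2 * B$1$2\<bar> + \<bar>C$1$2 * A$1$1 * B$2$2\<bar> + \<bar>C$1$1 * A$1$2 * B$2$2\<bar>)"
      "\<bar>M$2$2 - C$2$2 * A$1$1 * B$2$2\<bar> \<le> 6 * u * \<bar>C$2$2 * A$1$1 * B$2$2\<bar>"
      "M$2$1 = 0" "(transpose V ** M ** U)$1$2 = 0"
    and \<eta>g: "eta_sound F (100 * \<kappa>) \<eta>g (G$1$1) (G$1$2)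
        ((transpose \<bar>V\<bar> ** \<bar>C\<bar>)$1$1 + (transpose \<bar>V\<bar> ** \<bar>C\<bar>)$1$2)"
    and \<eta>l: "eta_sound F (100 * \<kappa>) \<eta>l (L$1$2) (L$2$2) ((\<bar>B\<bar> ** \<bar>U\<bar>)$1$2 + (\<bar>B\<bar> ** \<bar>U\<bar>)$2$2)"
    and \<eta>h: "eta_sound F (100 * \<kappa>) \<eta>h (H$1$2) (H$2$2)
        ((\<bar>adj2 A\<bar> ** (\<bar>B\<bar> ** \<bar>U\<bar>))$1$2 + (\<bar>adj2 A\<bar> ** (\<bar>B\<bar> ** \<bar>U\<bar>))$2$2)"
    and \<eta>k: "eta_sound F (100 * \<kappa>) \<eta>k (K$1$1) (K$1$2)
        (((transpose \<bar>V\<bar> ** \<bar>C\<bar>) ** \<bar>adj2 A\<bar>)$1$1 + ((transpose \<bar>V\<bar> ** \<bar>C\<bar>) ** \<bar>adj2 A\<bar>)$1$2)"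
    and \<eta>: "eta_max \<eta>g \<eta>h \<eta>k \<eta>l \<le> ereal (100 * \<kappa>)"
    and res_def: "res = rsvd22_finish F w A U' V' G H K L \<eta>g \<eta>h \<eta>k \<eta>l"
  shows "\<exists>P Q. orthogonal_matrix P \<and> orthogonal_matrix Q \<and>
    err (6 * u) (out_P res) P \<bar>P\<bar> \<and> err (6 * u) (out_Q res) Q \<bar>Q\<bar> \<and>
    \<bar>(transpose P ** A ** Q)$1$2\<bar> \<le> 500000 * (\<kappa> * u * m)"
proof -
  define a b d where "a = A$1$1" and "b = A$1$2" and "d = A$2$2"
  define g1 g2 gh2 where "g1 = V$1$1 * C$1$1" and "g2 = V$1$1 * C$1$2 + V$2$1 * C$2$2"
    and "gh2 = \<bar>V$1$1 * C$1$2\<bar> + \<bar>V$2$1 * C$2$2\<bar>"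
  define l1 l2 lh1 where "l1 = B$1$1 * U$1$2 + B$1$2 * U$2$2" and "l2 = B$2$2 * U$2$2"
    and "lh1 = \<bar>B$1$1 * U$1$2\<bar> + \<bar>B$1$2 * U$2$2\<bar>"
  have gh: "(transpose \<bar>V\<bar> ** \<bar>C\<bar>)$1$1 = \<bar>g1\<bar>" "(transpose \<bar>V\<bar> ** \<bar>C\<bar>)$1$2 = gh2"
    and gx: "(transpose V ** C)$1$1 = g1" "(transpose V ** C)$1$2 = g2"
    using tri by (simp_all add: mm2_nth transpose2_nth abs_mat22_nth g1_def gh2_def g2_def abs_mult)
  have lh: "(\<bar>B\<bar> ** \<bar>U\<bar>)$1$2 = lh1" "(\<bar>B\<bar> ** \<bar>U\<bar>)$2$2 = \<bar>l2\<bar>"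
    and lx: "(B ** U)$1$2 = l1" "(B ** U)$2$2 = l2"
    using tri by (simp_all add: mm2_nth abs_mat22_nth l1_def l2_def lh1_def abs_mult)
  have hh: "(\<bar>adj2 A\<bar> ** (\<bar>B\<bar> ** \<bar>U\<bar>))$1$2 = \<bar>d\<bar> * lh1 + \<bar>b\<bar> * \<bar>l2\<bar>"
      "(\<bar>adj2 A\<bar> ** (\<bar>B\<bar> ** \<bar>U\<bar>))$2$2 = \<bar>a\<bar> * \<bar>l2\<bar>"
    and hx: "(adj2 A ** (B ** U))$1$2 = d * l1 - b * l2" "(adj2 A ** (B ** U))$2$2 = a * l2"
    using tri by (simp_all add: mm2_nth[of "adj2 A"] mm2_nth[of "\<bar>adj2 A\<bar>"] lh lx abs_mat22_nth adj2_nth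
        a_def b_def d_def)
  have kh: "((transpose \<bar>V\<bar> ** \<bar>C\<bar>) ** \<bar>adj2 A\<bar>)$1$1 = \<bar>d\<bar> * \<bar>g1\<bar>"
      "((transpose \<bar>V\<bar> ** \<bar>C\<bar>) ** \<bar>adj2 A\<bar>)$1$2 = \<bar>b\<bar> * \<bar>g1\<bar> + \<bar>a\<bar> * gh2"
    and kx: "((transpose V ** C) ** adj2 A)$1$1 = d * g1"
      "((transpose V ** C) ** adj2 A)$1$2 = a * g2 - b * g1"
    using tri by (simp_all add: mm2_nth[of "_ ** _"] gh gx abs_mat22_nth adj2_nth a_def b_def d_def)
  have hats: "0 \<le> gh2" "0 \<le> lh1" by (simp_all add: gh2_def lh1_def)
  have rot: "xlartg_model u F" using F by (simp add: fp_model_def)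
  have u1: "u \<le> \<kappa> * u" using \<kappa> u(1) by (simp add: mult_le_cancel_right1)
  define t e where "t = 100 * \<kappa>" and "e = 110 * u"
  \<comment> \<open>These are the two parameters delivered by \<open>nearI\<close>; 44000 below is 4
    * 100 * 110.\<close>
  define \<omega> T where "\<omega> = 4 * t * e" and "T = 4 * t"
  have t0: "0 \<le> t" and e0: "0 \<le> e" using \<kappa> u by (simp_all add: t_def e_def)
  have \<omega>: "0 \<le> \<omega>" "\<omega> \<le> 1" and \<omega>_eq: "\<omega> = 44000 * (\<kappa> * u)"
    using t0 e0 u by (simp_all add: \<omega>_def t_def e_def)
  have T: "0 \<le> T" using t0 by (simp add: T_def)
  define zg zh zk zl where "zg \<longleftrightarrow> fl_add F \<bar>G$1$1\<bar> \<bar>G$1$2\<bar> = 0"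
    and "zh \<longleftrightarrow> fl_add F \<bar>H$1$2\<bar> \<bar>H$2$2\<bar> = 0" and "zk \<longleftrightarrow> fl_add F \<bar>K$1$1\<bar> \<bar>K$1$2\<bar> = 0"
    and "zl \<longleftrightarrow> fl_add F \<bar>L$1$2\<bar> \<bar>L$2$2\<bar> = 0"
  have min: "min \<eta>g \<eta>h \<le> ereal t" "min \<eta>l \<eta>k \<le> ereal t"
    using \<eta> by (simp_all add: eta_max_def t_def min.commute)
  have z: "zg \<Longrightarrow> \<eta>g = \<infinity>" "zh \<Longrightarrow> \<eta>h = \<infinity>" "zl \<Longrightarrow> \<eta>l = \<infinity>" "zk \<Longrightarrow> \<eta>k = \<infinity>"
    using \<eta>g \<eta>h \<eta>k \<eta>l by (simp_all add: eta_sound_def zg_def zh_def zk_def zl_def)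
  have selQ: "if zh \<or> (\<not> zg \<and> \<eta>g \<le> \<eta>h) then \<eta>g \<le> ereal t else \<eta>h \<le> ereal t"
    by (rule selected_eta_le[OF min(1) _ z(1,2)]) auto
  have selP: "if zk \<or> (\<not> zl \<and> \<eta>l \<le> \<eta>k) then \<eta>l \<le> ereal t else \<eta>k \<le> ereal t"
    by (rule selected_eta_le[OF min(2) _ z(3,4)]) auto
  have outQ: "out_Q res = (if zh \<or> (\<not> zg \<and> \<eta>g \<le> \<eta>h)
      then rot_first F (G$1$1) (G$1$2) else rot_second F (H$1$2) (H$2$2))"
    and outP: "out_P res = (if zk \<or> (\<not> zl \<and> \<eta>l \<le> \<eta>k)
      then rot_second F (L$1$2) (L$2$2) else rot_first F (K$1$1) (K$1$2))"
    by (simp_all add: res_def rsvd22_finish_def Let_def zg_def zh_def zk_def zl_def)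
  note eG = errD(2)[OF G, folded e_def] and eL = errD(2)[OF L, folded e_def]
    and eH = errD(2)[OF H, folded e_def] and eK = errD(2)[OF K, folded e_def]
  have hn: "0 \<le> \<bar>d\<bar> * lh1 + \<bar>b\<bar> * \<bar>l2\<bar>" "0 \<le> \<bar>a\<bar> * \<bar>l2\<bar>" "0 \<le> \<bar>d\<bar> * \<bar>g1\<bar>"
    "0 \<le> \<bar>b\<bar> * \<bar>g1\<bar> + \<bar>a\<bar> * gh2"
    using hats by simp_all
  \<comment> \<open>The second column of Q matters: lower triangularity of GQ makes it orthogonal to
    the first row of G, that of Q^T H makes it parallel to the second column of H.\<close>
  obtain Q where Q: "orthogonal_matrix Q" "err (6 * u) (out_Q res) Q \<bar>Q\<bar>"
    "near \<omega> T g1 g2 \<bar>g1\<bar> gh2 (Q$2$2) (- (Q$1$2)) \<or>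
      near \<omega> T (d * l1 - b * l2) (a * l2) (\<bar>d\<bar> * lh1 + \<bar>b\<bar> * \<bar>l2\<bar>) (\<bar>a\<bar> * \<bar>l2\<bar>) (Q$1$2) (Q$2$2)"
  proof (cases "zh \<or> (\<not> zg \<and> \<eta>g \<le> \<eta>h)")
    case True
    then have "(G$1$1 \<noteq> 0 \<or> G$1$2 \<noteq> 0) \<and> \<bar>g1\<bar> + gh2 \<le> 2 * t * (\<bar>G$1$1\<bar> + \<bar>G$1$2\<bar>)"
      using selQ \<eta>g
      unfolding if_P[OF True] eta_sound_def gh t_def by blast
    then obtain R where "orthogonal_matrix R" "err (6 * u) (rot_first F (G$1$1) (G$1$2)) R \<bar>R\<bar>"
      "near (4 * t * e) (4 * t) g1 g2 \<bar>g1\<bar> gh2 (R$2$2) (- (R$1$2))"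
      using rot_first_correct[OF rot _ e0 t0 abs_ge_zero hats(1)
          eG[of 1 1, unfolded gh gx] eG[of 1 2, unfolded gh gx]] by blast
    then show thesis using that[of R] True outQ unfolding \<omega>_def T_def by simp
  next
    case False
    then have "(H$1$2 \<noteq> 0 \<or> H$2$2 \<noteq> 0) \<and>
        (\<bar>d\<bar> * lh1 + \<bar>b\<bar> * \<bar>l2\<bar>) + \<bar>a\<bar> * \<bar>l2\<bar> \<le> 2 * t * (\<bar>H$1$2\<bar> + \<bar>H$2$2\<bar>)"
      using selQ \<eta>h
      unfolding if_not_P[OF False] eta_sound_def hh t_def by blast
    then obtain R where "orthogonal_matrix R" "err (6 * u) (rot_second F (H$1$2) (H$2$2)) R \<bar>R\<bar>"
      "near (4 * t * e) (4 * t) (d * l1 - b * l2) (a * l2)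
        (\<bar>d\<bar> * lh1 + \<bar>b\<bar> * \<bar>l2\<bar>) (\<bar>a\<bar> * \<bar>l2\<bar>) (R$1$2) (R$2$2)"
      using rot_second_correct[OF rot _ e0 t0 hn(1,2)
          eH[of 1 2, unfolded hh hx] eH[of 2 2, unfolded hh hx]] by blast
    then show thesis using that[of R] False outQ unfolding \<omega>_def T_def by simp
  qed
  \<comment> \<open>Likewise the first column of P is orthogonal to the second column of L or
    parallel to the first row of K.\<close>
  obtain P where P: "orthogonal_matrix P" "err (6 * u) (out_P res) P \<bar>P\<bar>"
    "near \<omega> T l1 l2 lh1 \<bar>l2\<bar> (- (P$2$1)) (P$1$1) \<or>
      near \<omega> T (d * g1) (a * g2 - b * g1) (\<bar>d\<bar> * \<bar>g1\<bar>) (\<bar>b\<bar> * \<bar>g1\<bar> + \<bar>a\<bar> * gh2) (P$1$1) (P$2$1)"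
  proof (cases "zk \<or> (\<not> zl \<and> \<eta>l \<le> \<eta>k)")
    case True
    then have "(L$1$2 \<noteq> 0 \<or> L$2$2 \<noteq> 0) \<and> lh1 + \<bar>l2\<bar> \<le> 2 * t * (\<bar>L$1$2\<bar> + \<bar>L$2$2\<bar>)"
      using selP \<eta>l
      unfolding if_P[OF True] eta_sound_def lh t_def by blast
    then obtain R where "orthogonal_matrix R" "err (6 * u) (rot_second F (L$1$2) (L$2$2)) R \<bar>R\<bar>"
      "near (4 * t * e) (4 * t) l1 l2 lh1 \<bar>l2\<bar> (- (R$2$1)) (R$1$1)"
      using rot_second_correct[OF rot _ e0 t0 hats(2) abs_ge_zero
          eL[of 1 2, unfolded lh lx] eL[of 2 2, unfolded lh lx]] by blast
    then show thesis using that[of R] True outP unfolding \<omega>_def T_def by simp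
  next
    case False
    then have "(K$1$1 \<noteq> 0 \<or> K$1$2 \<noteq> 0) \<and>
        \<bar>d\<bar> * \<bar>g1\<bar> + (\<bar>b\<bar> * \<bar>g1\<bar> + \<bar>a\<bar> * gh2) \<le> 2 * t * (\<bar>K$1$1\<bar> + \<bar>K$1$2\<bar>)"
      using selP \<eta>k
      unfolding if_not_P[OF False] eta_sound_def kh t_def by blast
    then obtain R where "orthogonal_matrix R" "err (6 * u) (rot_first F (K$1$1) (K$1$2)) R \<bar>R\<bar>"
      "near (4 * t * e) (4 * t) (d * g1) (a * g2 - b * g1)
        (\<bar>d\<bar> * \<bar>g1\<bar>) (\<bar>b\<bar> * \<bar>g1\<bar> + \<bar>a\<bar> * gh2) (R$1$1) (R$2$1)"
      using rot_first_correct[OF rot _ e0 t0 hn(3,4)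
          eK[of 1 1, unfolded kh kx] eK[of 1 2, unfolded kh kx]] by blast
    then show thesis using that[of R] False outP unfolding \<omega>_def T_def by simp
  qed
  have "V$1$1 * M$1$1 * U$1$2 + V$1$1 * M$1$2 * U$2$2 + V$2$1 * M$2$2 * U$2$2 = 0"
    using M(4,5) by (simp add: mm2_nth transpose2_nth algebra_simps)
  from residual_bound[OF _ this M(1-3)] u
  have residual: "\<bar>g1 * (d * l1 - b * l2) + g2 * (a * l2)\<bar>
      \<le> 6 * u * (\<bar>g1\<bar> * \<bar>d\<bar> * lh1 + \<bar>g1\<bar> * \<bar>b\<bar> * \<bar>l2\<bar> + gh2 * \<bar>a\<bar> * \<bar>l2\<bar>)"
    unfolding g1_def g2_def gh2_def l1_def l2_def lh1_def a_def b_def d_def by simp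
  have "0 \<le> 6 * u" using u by simp
  from annihilated_entry_bound[OF abd[folded a_def b_def d_def] \<omega> this T hats residual Q(3) P(3)]
  have "\<bar>P$1$1 * (a * Q$1$2 + b * Q$2$2) + P$2$1 * (d * Q$2$2)\<bar>
      \<le> m * (9 * \<omega> + 6 * u * (4 * T + 4))" .
  moreover have "(transpose P ** A ** Q)$1$2
      = P$1$1 * (a * Q$1$2 + b * Q$2$2) + P$2$1 * (d * Q$2$2)"
    using tri by (simp add: mm2_nth transpose2_nth a_def b_def d_def algebra_simps)
  moreover have "m * (9 * \<omega> + 6 * u * (4 * T + 4)) \<le> m * (500000 * (\<kappa> * u))"
  proof (rule mult_left_mono)
    \<comment> \<open>405600 is 9 * 44000 from the directions plus 6 * 4 * 400 from the residual;
      the remaining \<open>24 * u\<close> is absorbed because u is at most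
      \<open>\<kappa> * u\<close>.\<close>
    have "9 * \<omega> + 6 * u * (4 * T + 4) = 405600 * (\<kappa> * u) + 24 * u"
      unfolding \<omega>_eq T_def t_def by algebra
    then show "9 * \<omega> + 6 * u * (4 * T + 4) \<le> 500000 * (\<kappa> * u)" using u1 u by linarith
    show "0 \<le> m" using abd(1) by linarith
  qed
  ultimately have "\<bar>(transpose P ** A ** Q)$1$2\<bar> \<le> m * (500000 * (\<kappa> * u))" by simp
  then have "\<bar>(transpose P ** A ** Q)$1$2\<bar> \<le> 500000 * (\<kappa> * u * m)" by (simp add: mult_ac)
  then show ?thesis using P(1,2) Q(1,2) by blast
qed

subsection \<open>The computed singular value decomposition\<close>

lemma fl_mul_mul_error:
  assumes F: "arith_model u F" and u: "0 \<le> u" "u \<le> 1/100000"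
  shows "\<bar>fl_mul F (fl_mul F x y) z - x * y * z\<bar> \<le> 3 * u * \<bar>x * y * z\<bar>"
    "\<bar>fl_mul F z (fl_mul F x y) - x * y * z\<bar> \<le> 3 * u * \<bar>x * y * z\<bar>"
proof -
  obtain e1 where e1: "\<bar>e1\<bar> \<le> u" "fl_mul F x y = x * y * (1 + e1)"
    using arith_modelD(3)[OF F] unfolding rel_pert_def by blast
  have *: "\<bar>w - x * y * z\<bar> \<le> 3 * u * \<bar>x * y * z\<bar>"
    if w: "rel_pert u (x * y * (1 + e1) * z) w" for w
  proof -
    obtain e2 where e2: "\<bar>e2\<bar> \<le> u" "w = x * y * (1 + e1) * z * (1 + e2)"
      using w unfolding rel_pert_def by blast
    have "w - x * y * z = (e1 + e2 + e1 * e2) * (x * y * z)" unfolding e2(2) by algebra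
    then have "\<bar>w - x * y * z\<bar> = \<bar>e1 + e2 + e1 * e2\<bar> * \<bar>x * y * z\<bar>" by (simp only: abs_mult)
    moreover have "\<bar>e1 * e2\<bar> \<le> 1 * u"
      unfolding abs_mult using e1 e2 u by (intro mult_mono) auto
    then have "\<bar>e1 + e2 + e1 * e2\<bar> \<le> 3 * u" using e1(1) e2(1) by linarith
    ultimately show ?thesis by (simp add: mult_right_mono)
  qed
  show "\<bar>fl_mul F (fl_mul F x y) z - x * y * z\<bar> \<le> 3 * u * \<bar>x * y * z\<bar>"
    using *[of "fl_mul F (fl_mul F x y) z"] arith_modelD(3)[OF F, of "fl_mul F x y" z] e1(2) by simp
  show "\<bar>fl_mul F z (fl_mul F x y) - x * y * z\<bar> \<le> 3 * u * \<bar>x * y * z\<bar>"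
    using *[of "fl_mul F z (fl_mul F x y)"] arith_modelD(3)[OF F, of z "fl_mul F x y"] e1(2)
    by (simp add: mult.commute mult.left_commute)
qed

text \<open>The terms bring \<open>3 * u\<close>, the addition and the subtraction together at most
  \<open>2.31 * u\<close>; the sum is rounded up to 6.\<close>

lemma fl_sub_add_error:
  assumes F: "arith_model u F" and u: "0 \<le> u" "u \<le> 1/100000"
    and p: "\<bar>p - p0\<bar> \<le> 3 * u * \<bar>p0\<bar>" and q: "\<bar>q - q0\<bar> \<le> 3 * u * \<bar>q0\<bar>"
    and r: "\<bar>r - r0\<bar> \<le> 3 * u * \<bar>r0\<bar>"
  shows "\<bar>fl_sub F (fl_add F p q) r - (p0 + q0 - r0)\<bar> \<le> 6 * u * (\<bar>p0\<bar> + \<bar>q0\<bar> + \<bar>r0\<bar>)"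
proof -
  have le: "\<bar>x\<bar> \<le> 11/10 * \<bar>x0\<bar>" if "\<bar>x - x0\<bar> \<le> 3 * u * \<bar>x0\<bar>" for x x0
  proof -
    have "u * \<bar>x0\<bar> \<le> (1/100000) * \<bar>x0\<bar>" using u by (intro mult_right_mono) auto
    then show ?thesis using that by linarith
  qed
  define s t where "s = fl_add F p q" and "t = fl_sub F s r"
  define S where "S = \<bar>p0\<bar> + \<bar>q0\<bar> + \<bar>r0\<bar>"
  have s: "\<bar>s - (p + q)\<bar> \<le> u * \<bar>p + q\<bar>" and t: "\<bar>t - (s - r)\<bar> \<le> u * \<bar>s - r\<bar>"
    unfolding s_def t_def by (intro rel_pert_abs arith_modelD[OF F])+
  define Y where "Y = \<bar>p\<bar> + \<bar>q\<bar> + \<bar>r\<bar>"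
  have Y: "Y \<le> 11/10 * S" "0 \<le> Y" "0 \<le> S" using le[OF p] le[OF q] le[OF r]
    by (simp_all add: Y_def S_def)
  have "\<bar>p + q\<bar> \<le> Y" unfolding Y_def by linarith
  then have "u * \<bar>p + q\<bar> \<le> u * Y" using u by (intro mult_left_mono)
  then have s': "\<bar>s - (p + q)\<bar> \<le> u * Y" using s by linarith
  have "u * Y \<le> (1/100000) * Y" using u Y by (intro mult_right_mono) auto
  moreover have "\<bar>s - r\<bar> \<le> \<bar>s - (p + q)\<bar> + Y" unfolding Y_def by linarith
  ultimately have "\<bar>s - r\<bar> \<le> 11/10 * Y" using s' Y(2) by linarith
  then have "u * \<bar>s - r\<bar> \<le> u * (11/10 * Y)" using u by (intro mult_left_mono)
  then have t': "\<bar>t - (s - r)\<bar> \<le> 11/10 * (u * Y)" using t by simp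
  have "u * Y \<le> u * (11/10 * S)" using Y u by (intro mult_left_mono)
  then have uY: "u * Y \<le> 11/10 * (u * S)" by simp
  have "3 * u * \<bar>p0\<bar> + 3 * u * \<bar>q0\<bar> + 3 * u * \<bar>r0\<bar> = 3 * (u * S)"
    unfolding S_def by algebra
  moreover have "\<bar>t - (p0 + q0 - r0)\<bar> \<le> \<bar>t - (s - r)\<bar> + \<bar>s - (p + q)\<bar> + (\<bar>p - p0\<bar> + \<bar>q - q0\<bar> + \<bar>r - r0\<bar>)"
    by linarith
  moreover have "0 \<le> u * S" using u Y by simp
  ultimately have "\<bar>t - (p0 + q0 - r0)\<bar> \<le> 6 * (u * S)" using t' s' uY p q r by linarith
  then show ?thesis by (simp add: t_def s_def S_def)
qed

lemma fl_M_error: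
  assumes F: "arith_model u F" and u: "0 \<le> u" "u \<le> 1/100000"
    and M_def: "M = fl_M F A B C"
  shows "\<bar>M$1$1 - C$1$1 * A$2$2 * B$1$1\<bar> \<le> 6 * u * \<bar>C$1$1 * A$2$2 * B$1$1\<bar>"
    "\<bar>M$1$2 - (C$1$1 * A$2$2 * B$1$2 + C$1$2 * A$1$1 * B$2$2 - C$1$1 * A$1$2 * B$2$2)\<bar>
        \<le> 6 * u * (\<bar>C$1$1 * A$2$2 * B$1$2\<bar> + \<bar>C$1$2 * A$1$1 * B$2$2\<bar> + \<bar>C$1$1 * A$1$2 * B$2$2\<bar>)"
    "\<bar>M$2$2 - C$2$2 * A$1$1 * B$2$2\<bar> \<le> 6 * u * \<bar>C$2$2 * A$1$1 * B$2$2\<bar>"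
    "M$2$1 = 0"
proof -
  note e = fl_mul_mul_error[OF F u]
  have le: "y \<le> 6 * u * x" if "y \<le> 3 * u * x" "0 \<le> x" for x y
    using that mult_nonneg_nonneg[OF u(1) that(2)] by linarith
  have a: "C$2$2 * A$1$1 * B$2$2 = A$1$1 * B$2$2 * C$2$2"
    "C$1$2 * A$1$1 * B$2$2 = A$1$1 * B$2$2 * C$1$2" by algebra+
  show "\<bar>M$1$1 - C$1$1 * A$2$2 * B$1$1\<bar> \<le> 6 * u * \<bar>C$1$1 * A$2$2 * B$1$1\<bar>"
    unfolding M_def by (rule le) (simp_all add: fl_M_def Let_def e)
  show "\<bar>M$2$2 - C$2$2 * A$1$1 * B$2$2\<bar> \<le> 6 * u * \<bar>C$2$2 * A$1$1 * B$2$2\<bar>"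
    unfolding M_def a by (rule le) (simp_all add: fl_M_def Let_def e)
  show "\<bar>M$1$2 - (C$1$1 * A$2$2 * B$1$2 + C$1$2 * A$1$1 * B$2$2 - C$1$1 * A$1$2 * B$2$2)\<bar>
        \<le> 6 * u * (\<bar>C$1$1 * A$2$2 * B$1$2\<bar> + \<bar>C$1$2 * A$1$1 * B$2$2\<bar> + \<bar>C$1$1 * A$1$2 * B$2$2\<bar>)"
    using fl_sub_add_error[OF F u e(1) e(2) e(1)] unfolding M_def a by (simp add: fl_M_def Let_def)
  show "M$2$1 = 0" unfolding M_def by (simp add: fl_M_def Let_def)
qed

section \<open>Entries that may be cleared when \<open>C$1$1 = 0\<close> or
  \<open>B$2$2 = 0\<close>\<close>

lemma fl_mul_zero:
  assumes "arith_model u F"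
  shows "fl_mul F 0 x = 0" "fl_mul F x 0 = 0"
  using assms by (simp_all add: arith_model_def)

lemma fl_mul_nonzero:
  assumes "arith_model u F" "u \<le> 1/100000" "x \<noteq> 0" "y \<noteq> 0"
  shows "fl_mul F x y \<noteq> 0"
proof -
  obtain e where "\<bar>e\<bar> \<le> u" "fl_mul F x y = x * y * (1 + e)"
    using arith_modelD(3)[OF assms(1)] unfolding rel_pert_def by blast
  then show ?thesis using assms by auto
qed

text \<open>
  If \<open>c\<^sub>1\<^sub>1 = 0\<close>, the second row of \<open>V\<^sup>TM\<close> vanishes because \<open>M\<close> has rank at most one; both entries
  of the second column of \<open>M\<close> contain the same computed factor \<open>a\<^sub>1\<^sub>1b\<^sub>2\<^sub>2\<close>, so \<open>g\<^sub>2\<^sub>2\<close> is of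
  the size of its rounding error and may be cleared. Likewise for \<open>l\<^sub>1\<^sub>2\<close>.
\<close>

lemma cleared_g22_bound:
  assumes F: "arith_model u F" and u: "0 \<le> u" "u \<le> 1/100000"
    and nz: "A$1$1 \<noteq> 0" "B$2$2 \<noteq> 0" "C$1$1 = 0"
    and svd: "unnormalized_svd (fl_M F A B C) U V \<sigma>1 \<sigma>2" "\<bar>\<sigma>2\<bar> \<le> \<bar>\<sigma>1\<bar>"
  shows "\<bar>V$1$2 * C$1$2 + V$2$2 * C$2$2\<bar> \<le> 6 * u * (\<bar>V$1$2 * C$1$2\<bar> + \<bar>V$2$2 * C$2$2\<bar>)"
proof -
  define M where "M = fl_M F A B C"
  define ab where "ab = fl_mul F (A$1$1) (B$2$2)"
  have ab: "ab \<noteq> 0" unfolding ab_def by (rule fl_mul_nonzero[OF F u(2) nz(1,2)])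
  have M0: "M$1$1 = 0" "M$2$1 = 0"
    by (simp_all add: M_def fl_M_def Let_def nz(3) fl_mul_zero[OF F])
  \<comment> \<open>Multiplication by zero is exact, but adding or subtracting zero may still round,
    so the general bound is applied with two zero terms.\<close>
  have "\<bar>fl_sub F (fl_add F 0 (fl_mul F (C$1$2) ab)) 0 - (0 + C$1$2 * ab - 0)\<bar>
      \<le> 6 * u * (\<bar>0\<bar> + \<bar>C$1$2 * ab\<bar> + \<bar>0\<bar>)"
    using rel_pert_abs[OF arith_modelD(3)[OF F, of "C$1$2" ab]] u
    by (intro fl_sub_add_error[OF F u]) (auto intro: order_trans mult_right_mono)
  then have M12: "\<bar>M$1$2 - C$1$2 * ab\<bar> \<le> 6 * u * \<bar>C$1$2 * ab\<bar>"
    by (simp add: M_def fl_M_def Let_def nz(3) fl_mul_zero[OF F] ab_def)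
  have "\<bar>M$2$2 - C$2$2 * ab\<bar> \<le> u * \<bar>C$2$2 * ab\<bar>"
    using rel_pert_abs[OF arith_modelD(3)[OF F, of "C$2$2" ab]]
    by (simp add: M_def fl_M_def Let_def ab_def)
  also have "\<dots> \<le> 6 * u * \<bar>C$2$2 * ab\<bar>" using u by (intro mult_right_mono) auto
  finally have M22: "\<bar>M$2$2 - C$2$2 * ab\<bar> \<le> 6 * u * \<bar>C$2$2 * ab\<bar>" .
  have U: "orthogonal_matrix U" and V: "orthogonal_matrix V"
    and eq: "transpose V ** M ** U = mat2 \<sigma>1 0 0 \<sigma>2"
    using svd(1) by (simp_all add: unnormalized_svd_def M_def)
  have "transpose V ** M = (transpose V ** M ** U) ** transpose U"
    using U by (simp add: orthogonal_matrix_def matrix_mul_assoc[symmetric])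
  then have VM: "transpose V ** M = mat2 \<sigma>1 0 0 \<sigma>2 ** transpose U" by (simp only: eq)
  \<comment> \<open>The first column of M vanishes while the first row of U does not, so one of the
    two values is zero; by their ordering \<open>\<sigma>2\<close> is zero in either case.\<close>
  then have "0 = \<sigma>1 * U$1$1" "0 = \<sigma>2 * U$1$2"
    and row: "V$1$2 * M$1$2 + V$2$2 * M$2$2 = \<sigma>2 * U$2$2"
    using M0 by (simp_all add: mat22_eq_iff mm2_nth transpose2_nth)
  moreover have "U$1$1 \<noteq> 0 \<or> U$1$2 \<noteq> 0" using orthogonal_mat22_rows(1)[OF U] by auto
  ultimately have "\<sigma>2 = 0" using svd(2) by auto
  with row have row0: "V$1$2 * M$1$2 + V$2$2 * M$2$2 = 0" by simp
  \<comment> \<open>Keeping the computed \<open>ab\<close> as the common factor means that its own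
    rounding error disappears on division.\<close>
  have "(V$1$2 * C$1$2 + V$2$2 * C$2$2) * ab
      = - (V$1$2 * (M$1$2 - C$1$2 * ab) + V$2$2 * (M$2$2 - C$2$2 * ab))"
    using row0 by algebra
  from arg_cong[OF this, of abs] have "\<bar>V$1$2 * C$1$2 + V$2$2 * C$2$2\<bar> * \<bar>ab\<bar>
      = \<bar>V$1$2 * (M$1$2 - C$1$2 * ab) + V$2$2 * (M$2$2 - C$2$2 * ab)\<bar>"
    by (simp only: abs_mult[symmetric] abs_minus_cancel)
  also have "\<dots> \<le> \<bar>V$1$2\<bar> * \<bar>M$1$2 - C$1$2 * ab\<bar> + \<bar>V$2$2\<bar> * \<bar>M$2$2 - C$2$2 * ab\<bar>"
    unfolding abs_mult[symmetric] by (rule abs_triangle_ineq)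
  also have "\<dots> \<le> \<bar>V$1$2\<bar> * (6 * u * \<bar>C$1$2 * ab\<bar>) + \<bar>V$2$2\<bar> * (6 * u * \<bar>C$2$2 * ab\<bar>)"
    using M12 M22 by (intro add_mono mult_left_mono) auto
  also have "\<dots> = 6 * u * (\<bar>V$1$2 * C$1$2\<bar> + \<bar>V$2$2 * C$2$2\<bar>) * \<bar>ab\<bar>"
    unfolding abs_mult by algebra
  finally show ?thesis using ab by (simp add: mult_le_cancel_right)
qed

lemma cleared_l12_bound:
  assumes F: "arith_model u F" and u: "0 \<le> u" "u \<le> 1/100000"
    and nz: "A$2$2 \<noteq> 0" "C$1$1 \<noteq> 0" "B$2$2 = 0"
    and svd: "unnormalized_svd (fl_M F A B C) U V \<sigma>1 \<sigma>2" "\<bar>\<sigma>2\<bar> \<le> \<bar>\<sigma>1\<bar>"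
  shows "\<bar>B$1$1 * U$1$2 + B$1$2 * U$2$2\<bar> \<le> 6 * u * (\<bar>B$1$1 * U$1$2\<bar> + \<bar>B$1$2 * U$2$2\<bar>)"
proof -
  define M where "M = fl_M F A B C"
  define ca where "ca = fl_mul F (C$1$1) (A$2$2)"
  have ca: "ca \<noteq> 0" unfolding ca_def by (rule fl_mul_nonzero[OF F u(2) nz(2,1)])
  have M0: "M$2$2 = 0" "M$2$1 = 0"
    by (simp_all add: M_def fl_M_def Let_def nz(3) fl_mul_zero[OF F])
  have "\<bar>fl_sub F (fl_add F (fl_mul F ca (B$1$2)) 0) 0 - (ca * B$1$2 + 0 - 0)\<bar>
      \<le> 6 * u * (\<bar>ca * B$1$2\<bar> + \<bar>0\<bar> + \<bar>0\<bar>)"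
    using rel_pert_abs[OF arith_modelD(3)[OF F, of ca "B$1$2"]] u
    by (intro fl_sub_add_error[OF F u]) (auto intro: order_trans mult_right_mono)
  then have M12: "\<bar>M$1$2 - ca * B$1$2\<bar> \<le> 6 * u * \<bar>ca * B$1$2\<bar>"
    by (simp add: M_def fl_M_def Let_def nz(3) fl_mul_zero[OF F] ca_def)
  have "\<bar>M$1$1 - ca * B$1$1\<bar> \<le> u * \<bar>ca * B$1$1\<bar>"
    using rel_pert_abs[OF arith_modelD(3)[OF F, of ca "B$1$1"]]
    by (simp add: M_def fl_M_def Let_def ca_def)
  also have "\<dots> \<le> 6 * u * \<bar>ca * B$1$1\<bar>" using u by (intro mult_right_mono) auto
  finally have M11: "\<bar>M$1$1 - ca * B$1$1\<bar> \<le> 6 * u * \<bar>ca * B$1$1\<bar>" .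
  have U: "orthogonal_matrix U" and V: "orthogonal_matrix V"
    and eq: "transpose V ** M ** U = mat2 \<sigma>1 0 0 \<sigma>2"
    using svd(1) by (simp_all add: unnormalized_svd_def M_def)
  have "M ** U = (V ** transpose V) ** (M ** U)" using V by (simp add: orthogonal_matrix_def)
  also have "\<dots> = V ** (transpose V ** M ** U)" by (simp add: matrix_mul_assoc)
  finally have "M ** U = V ** mat2 \<sigma>1 0 0 \<sigma>2" by (simp only: eq)
  \<comment> \<open>Now the second row of M vanishes, and the second row of V takes over the role of
    the first row of U.\<close>
  then have "0 = V$2$1 * \<sigma>1" "0 = V$2$2 * \<sigma>2"
    and col: "M$1$1 * U$1$2 + M$1$2 * U$2$2 = V$1$2 * \<sigma>2"
    using M0 by (simp_all add: mat22_eq_iff mm2_nth)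
  moreover have "V$2$1 \<noteq> 0 \<or> V$2$2 \<noteq> 0" using orthogonal_mat22_rows(2)[OF V] by auto
  ultimately have "\<sigma>2 = 0" using svd(2) by auto
  with col have col0: "M$1$1 * U$1$2 + M$1$2 * U$2$2 = 0" by simp
  have "(B$1$1 * U$1$2 + B$1$2 * U$2$2) * ca
      = - ((M$1$1 - ca * B$1$1) * U$1$2 + (M$1$2 - ca * B$1$2) * U$2$2)"
    using col0 by algebra
  from arg_cong[OF this, of abs] have "\<bar>B$1$1 * U$1$2 + B$1$2 * U$2$2\<bar> * \<bar>ca\<bar>
      = \<bar>(M$1$1 - ca * B$1$1) * U$1$2 + (M$1$2 - ca * B$1$2) * U$2$2\<bar>"
    by (simp only: abs_mult[symmetric] abs_minus_cancel)
  also have "\<dots> \<le> \<bar>M$1$1 - ca * B$1$1\<bar> * \<bar>U$1$2\<bar> + \<bar>M$1$2 - ca * B$1$2\<bar> * \<bar>U$2$2\<bar>"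
    unfolding abs_mult[symmetric] by (rule abs_triangle_ineq)
  also have "\<dots> \<le> (6 * u * \<bar>ca * B$1$1\<bar>) * \<bar>U$1$2\<bar> + (6 * u * \<bar>ca * B$1$2\<bar>) * \<bar>U$2$2\<bar>"
    using M12 M11 by (intro add_mono mult_right_mono) auto
  also have "\<dots> = 6 * u * (\<bar>B$1$1 * U$1$2\<bar> + \<bar>B$1$2 * U$2$2\<bar>) * \<bar>ca\<bar>"
    unfolding abs_mult by algebra
  finally show ?thesis using ca by (simp add: mult_le_cancel_right)
qed

section \<open>Multiplication by \<open>J2\<close> and the exact factors behind step 2\<close>

lemma abs_mult_J2: "\<bar>X ** J2\<bar> = \<bar>X\<bar> ** \<bar>J2\<bar>" for X :: mat22
  by (simp add: mat22_eq_iff mm2_nth abs_mat22_nth J2_nth)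

lemma err_mult_J2:
  assumes "err e X Y Z"
  shows "err e (X ** J2) (Y ** J2) (Z ** \<bar>J2\<bar>)"
proof -
  have "\<bar>- x - - y\<bar> = \<bar>x - y\<bar>" "\<bar>y - x\<bar> = \<bar>x - y\<bar>" for x y :: real by linarith+
  then show ?thesis
    using assms by (simp add: err_def forall_2 mm2_nth J2_nth abs_mat22_nth)
qed

lemma err_J2_mult:
  assumes "err e X Y Z"
  shows "err e (transpose J2 ** X) (transpose J2 ** Y) (transpose \<bar>J2\<bar> ** Z)"
  using err_transpose[OF err_mult_J2[OF err_transpose[OF assms]]]
  by (simp add: matrix_transpose_mul)

text \<open>The exchange in steps 2 and 5 turns the (2,1) entry into the (1,2) entry and conversely,
  which is why the vanishing of both is carried along.\<close>

lemma offdiagonal_mult_J2: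
  fixes V M U :: mat22
  shows
  "(transpose (V ** J2) ** M ** (U ** J2))$1$2 = - ((transpose V ** M ** U)$2$1)"
  "(transpose (V ** J2) ** M ** (U ** J2))$2$1 = - ((transpose V ** M ** U)$1$2)"
  by (simp_all add: mm2_nth transpose2_nth J2_nth algebra_simps)

text \<open>The exchange in step 2 destroys the ordering of the singular values on which the last
  two bounds rest. It is performed only if c11 and b22 are nonzero, and then these bounds are
  vacuous.\<close>

lemma rsvd22_step2_accurate:
  assumes F: "fp_model u F" and u: "0 \<le> u" "u \<le> 1/100000"
    and nz: "A$1$1 \<noteq> 0" "A$2$2 \<noteq> 0" "\<not> (C$1$1 = 0 \<and> B$2$2 = 0)"
    and step: "rsvd22_step2 F A B C = (Ub, Vb)"
  obtains U V where "orthogonal_matrix U" "orthogonal_matrix V"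
    "err (46.5 * u) Ub U \<bar>U\<bar>" "err (46.5 * u) Vb V \<bar>V\<bar>"
    "(transpose V ** fl_M F A B C ** U)$1$2 = 0" "(transpose V ** fl_M F A B C ** U)$2$1 = 0"
    "C$1$1 = 0 \<Longrightarrow>
      \<bar>V$1$2 * C$1$2 + V$2$2 * C$2$2\<bar> \<le> 6 * u * (\<bar>V$1$2 * C$1$2\<bar> + \<bar>V$2$2 * C$2$2\<bar>)"
    "B$2$2 = 0 \<Longrightarrow>
      \<bar>B$1$1 * U$1$2 + B$1$2 * U$2$2\<bar> \<le> 6 * u * (\<bar>B$1$1 * U$1$2\<bar> + \<bar>B$1$2 * U$2$2\<bar>)"
proof -
  define M where "M = fl_M F A B C"
  have ar: "arith_model u F" using F by (simp add: fp_model_def)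
  obtain U V \<sigma>1 \<sigma>2 where svd: "unnormalized_svd M U V \<sigma>1 \<sigma>2" "\<bar>\<sigma>2\<bar> \<le> \<bar>\<sigma>1\<bar>"
    "err (46.5 * u) (fst (fl_svd F M)) U \<bar>U\<bar>" "err (46.5 * u) (snd (fl_svd F M)) V \<bar>V\<bar>"
  proof (cases "M = 0")
    case True
    have "unnormalized_svd M (mat 1) (mat 1) 0 0"
      by (simp add: True unnormalized_svd_def orthogonal_matrix_id mat22_eq_iff mm2_nth)
    moreover have "err (46.5 * u) (mat 1) (mat 1) \<bar>mat 1\<bar>"
      using u by (intro err_mono[OF err_exact]) simp
    ultimately show thesis
      using that F True by (auto simp: fp_model_def xlasv2_model_def)
  next
    case False
    have "upper_triangular2 M" by (simp add: M_def upper_triangular2_def fl_M_def Let_def)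
    with False obtain U V \<sigma>1 \<sigma>2 where "unnormalized_svd M U V \<sigma>1 \<sigma>2" "\<bar>\<sigma>2\<bar> \<le> \<bar>\<sigma>1\<bar>"
      "rel_pert_mat (46.5 * u) U (fst (fl_svd F M))" "rel_pert_mat (46.5 * u) V (snd (fl_svd F M))"
      using F unfolding fp_model_def xlasv2_model_def by blast
    then show thesis using that err_rel_pert by blast
  qed
  define Ub0 Vb0 where "Ub0 = fst (fl_svd F M)" and "Vb0 = snd (fl_svd F M)"
  have orth: "orthogonal_matrix U" "orthogonal_matrix V"
    and diag: "(transpose V ** M ** U)$1$2 = 0" "(transpose V ** M ** U)$2$1 = 0"
    using svd(1) by (simp_all add: unnormalized_svd_def)
  have cases: "(Ub = Ub0 ** J2 \<and> Vb = Vb0 ** J2 \<and> C$1$1 \<noteq> 0 \<and> B$2$2 \<noteq> 0) \<or> (Ub = Ub0 \<and> Vb = Vb0)"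
    using step unfolding rsvd22_step2_def M_def[symmetric] Ub0_def Vb0_def
    by (auto simp: Let_def split: prod.splits if_splits)
  then show thesis
  proof (elim disjE conjE)
    assume J: "Ub = Ub0 ** J2" "Vb = Vb0 ** J2" and nz': "C$1$1 \<noteq> 0" "B$2$2 \<noteq> 0"
    have "err (46.5 * u) Ub (U ** J2) \<bar>U ** J2\<bar>" "err (46.5 * u) Vb (V ** J2) \<bar>V ** J2\<bar>"
      using err_mult_J2[OF svd(3)] err_mult_J2[OF svd(4)] by (simp_all add: J Ub0_def Vb0_def abs_mult_J2)
    then show thesis
      using that[of "U ** J2" "V ** J2"] orth orthogonal_J2 diag offdiagonal_mult_J2[of V M U] nz'
      by (simp add: orthogonal_matrix_mul M_def)
  next
    assume J: "Ub = Ub0" "Vb = Vb0"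
    show thesis
    proof (rule that[of U V])
      show "\<bar>V$1$2 * C$1$2 + V$2$2 * C$2$2\<bar> \<le> 6 * u * (\<bar>V$1$2 * C$1$2\<bar> + \<bar>V$2$2 * C$2$2\<bar>)"
        if "C$1$1 = 0"
        using nz that by (intro cleared_g22_bound[OF ar u _ _ _ svd(1,2)[unfolded M_def]]) auto
      show "\<bar>B$1$1 * U$1$2 + B$1$2 * U$2$2\<bar> \<le> 6 * u * (\<bar>B$1$1 * U$1$2\<bar> + \<bar>B$1$2 * U$2$2\<bar>)"
        if "B$2$2 = 0"
        using nz that by (intro cleared_l12_bound[OF ar u _ _ _ svd(1,2)[unfolded M_def]]) auto
    qed (use orth diag svd(3,4) in \<open>simp_all add: J Ub0_def Vb0_def M_def\<close>)
  qed
qed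

subsection \<open>Backward error of the computed matrix\<close>

text \<open>One index serves both factors because k comes from the same row as g. Each minimum in
  \<open>eta_max\<close> contains one of the two, so the whole maximum is bounded.\<close>

lemma some_row_eta_le:
  assumes F: "arith_model u F" and u: "0 \<le> u" "\<kappa> * u \<le> 1/100000" and \<kappa>: "1 \<le> \<kappa>"
    and tri: "A$2$1 = 0" "C$2$1 = 0"
    and abd: "\<bar>A$1$1\<bar> \<le> m" "\<bar>A$1$2\<bar> \<le> m" "\<bar>A$2$2\<bar> \<le> m" "A$1$1 \<noteq> 0" "A$2$2 \<noteq> 0"
    and m: "0 < m" "m\<^sup>2 \<le> \<kappa> * \<bar>A$1$1 * A$2$2\<bar>"
    and V: "orthogonal_matrix V" and C: "C$1$1 \<noteq> 0 \<or> C$1$2 \<noteq> 0 \<or> C$2$2 \<noteq> 0"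
    and G: "err (110 * u) G (transpose V ** C) (transpose \<bar>V\<bar> ** \<bar>C\<bar>)"
    and K: "err (110 * u) K ((transpose V ** C) ** adj2 A) ((transpose \<bar>V\<bar> ** \<bar>C\<bar>) ** \<bar>adj2 A\<bar>)"
    and Gh: "err (110 * u) Gh (transpose \<bar>V\<bar> ** \<bar>C\<bar>) (transpose \<bar>V\<bar> ** \<bar>C\<bar>)"
    and Kh: "err (110 * u) Kh ((transpose \<bar>V\<bar> ** \<bar>C\<bar>) ** \<bar>adj2 A\<bar>) ((transpose \<bar>V\<bar> ** \<bar>C\<bar>) ** \<bar>adj2 A\<bar>)"
  shows "\<exists>i. fl_eta F (Gh$i$1) (Gh$i$2) (G$i$1) (G$i$2) \<le> ereal (100 * \<kappa>) \<and>
    fl_eta F (Kh$i$1) (Kh$i$2) (K$i$1) (K$i$2) \<le> ereal (100 * \<kappa>)"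
proof -
  have u5: "u \<le> 1/100000" using u \<kappa> mult_right_mono[OF \<kappa> u(1)] by linarith
  have row: "fl_eta F (Gh$i$1) (Gh$i$2) (G$i$1) (G$i$2) \<le> ereal (100 * \<kappa>) \<and>
      fl_eta F (Kh$i$1) (Kh$i$2) (K$i$1) (K$i$2) \<le> ereal (100 * \<kappa>)"
    if small: "\<bar>V$1$i * C$1$2\<bar> + \<bar>V$2$i * C$2$2\<bar> \<le> 2 * \<bar>V$1$i * C$1$2 + V$2$i * C$2$2\<bar>"
      and nz: "V$1$i * C$1$1 \<noteq> 0 \<or> V$1$i * C$1$2 + V$2$i * C$2$2 \<noteq> 0" for i
  proof -
    define g1 g2 gh2 where "g1 = V$1$i * C$1$1" and "g2 = V$1$i * C$1$2 + V$2$i * C$2$2"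
      and "gh2 = \<bar>V$1$i * C$1$2\<bar> + \<bar>V$2$i * C$2$2\<bar>"
    have gh: "(transpose \<bar>V\<bar> ** \<bar>C\<bar>)$i$1 = \<bar>g1\<bar>" "(transpose \<bar>V\<bar> ** \<bar>C\<bar>)$i$2 = gh2"
      and gx: "(transpose V ** C)$i$1 = g1" "(transpose V ** C)$i$2 = g2"
      using tri by (simp_all add: mm2_nth transpose2_nth abs_mat22_nth g1_def gh2_def g2_def abs_mult)
    have kh: "((transpose \<bar>V\<bar> ** \<bar>C\<bar>) ** \<bar>adj2 A\<bar>)$i$1 = \<bar>A$2$2\<bar> * \<bar>g1\<bar>"
        "((transpose \<bar>V\<bar> ** \<bar>C\<bar>) ** \<bar>adj2 A\<bar>)$i$2 = \<bar>A$1$2\<bar> * \<bar>g1\<bar> + \<bar>A$1$1\<bar> * gh2"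
      and kx: "((transpose V ** C) ** adj2 A)$i$1 = A$2$2 * g1"
        "((transpose V ** C) ** adj2 A)$i$2 = A$1$1 * g2 - A$1$2 * g1"
      using tri by (simp_all add: mm2_nth[of "_ ** _"] gh gx abs_mat22_nth adj2_nth)
    have "\<bar>g2\<bar> \<le> gh2" by (simp add: g2_def gh2_def)
    note bc = bounded_cancellation[OF abd m \<kappa> u nz[folded g1_def g2_def]
        small[folded g2_def gh2_def] this
        errD(2)[OF G, of i 1, unfolded gh gx] errD(2)[OF G, of i 2, unfolded gh gx]
        errD(2)[OF K, of i 1, unfolded kh kx] errD(2)[OF K, of i 2, unfolded kh kx]]
    have nn: "0 \<le> \<bar>g1\<bar>" "0 \<le> gh2" "0 \<le> \<bar>A$2$2\<bar> * \<bar>g1\<bar>" "0 \<le> \<bar>A$1$2\<bar> * \<bar>g1\<bar> + \<bar>A$1$1\<bar> * gh2"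
      by (simp_all add: gh2_def)
    have "fl_eta F (Gh$i$1) (Gh$i$2) (G$i$1) (G$i$2) \<le> ereal (2 * (50 * \<kappa>))"
      by (rule fl_eta_leI[OF F u(1) u5 nn(1,2) errD(2)[OF Gh, of i 1, unfolded gh]
            errD(2)[OF Gh, of i 2, unfolded gh] bc(1,2)])
    moreover have "fl_eta F (Kh$i$1) (Kh$i$2) (K$i$1) (K$i$2) \<le> ereal (2 * (50 * \<kappa>))"
      by (rule fl_eta_leI[OF F u(1) u5 nn(3,4) errD(2)[OF Kh, of i 1, unfolded kh]
            errD(2)[OF Kh, of i 2, unfolded kh] bc(3,4)])
    ultimately show ?thesis by simp
  qed
  show ?thesis
    using one_column_without_cancellation[OF orthogonal_mat22_rows[OF V]
        orthogonal_mat22_columns(1,2)[OF V] C] row[of 1] row[of 2] by blast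
qed

text \<open>The mirror image: (l2, l1) replaces (g1, g2) and the diagonal entries of A change
  places. It takes over when C = 0, where no row of V^T C is nonzero.\<close>

lemma some_column_eta_le:
  assumes F: "arith_model u F" and u: "0 \<le> u" "\<kappa> * u \<le> 1/100000" and \<kappa>: "1 \<le> \<kappa>"
    and tri: "A$2$1 = 0" "B$2$1 = 0"
    and abd: "\<bar>A$1$1\<bar> \<le> m" "\<bar>A$1$2\<bar> \<le> m" "\<bar>A$2$2\<bar> \<le> m" "A$1$1 \<noteq> 0" "A$2$2 \<noteq> 0"
    and m: "0 < m" "m\<^sup>2 \<le> \<kappa> * \<bar>A$1$1 * A$2$2\<bar>"
    and U: "orthogonal_matrix U" and B: "B$2$2 \<noteq> 0 \<or> B$1$2 \<noteq> 0 \<or> B$1$1 \<noteq> 0"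
    and L: "err (110 * u) L (B ** U) (\<bar>B\<bar> ** \<bar>U\<bar>)"
    and H: "err (110 * u) H (adj2 A ** (B ** U)) (\<bar>adj2 A\<bar> ** (\<bar>B\<bar> ** \<bar>U\<bar>))"
    and Lh: "err (110 * u) Lh (\<bar>B\<bar> ** \<bar>U\<bar>) (\<bar>B\<bar> ** \<bar>U\<bar>)"
    and Hh: "err (110 * u) Hh (\<bar>adj2 A\<bar> ** (\<bar>B\<bar> ** \<bar>U\<bar>)) (\<bar>adj2 A\<bar> ** (\<bar>B\<bar> ** \<bar>U\<bar>))"
  shows "\<exists>j. fl_eta F (Lh$1$j) (Lh$2$j) (L$1$j) (L$2$j) \<le> ereal (100 * \<kappa>) \<and>
    fl_eta F (Hh$1$j) (Hh$2$j) (H$1$j) (H$2$j) \<le> ereal (100 * \<kappa>)"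
proof -
  have u5: "u \<le> 1/100000" using u \<kappa> mult_right_mono[OF \<kappa> u(1)] by linarith
  have m': "m\<^sup>2 \<le> \<kappa> * \<bar>A$2$2 * A$1$1\<bar>" using m(2) by (simp add: mult.commute)
  have col: "fl_eta F (Lh$1$j) (Lh$2$j) (L$1$j) (L$2$j) \<le> ereal (100 * \<kappa>) \<and>
      fl_eta F (Hh$1$j) (Hh$2$j) (H$1$j) (H$2$j) \<le> ereal (100 * \<kappa>)"
    if small: "\<bar>U$2$j * B$1$2\<bar> + \<bar>U$1$j * B$1$1\<bar> \<le> 2 * \<bar>U$2$j * B$1$2 + U$1$j * B$1$1\<bar>"
      and nz: "U$2$j * B$2$2 \<noteq> 0 \<or> U$2$j * B$1$2 + U$1$j * B$1$1 \<noteq> 0" for j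
  proof -
    define l1 l2 lh1 where "l1 = U$2$j * B$1$2 + U$1$j * B$1$1" and "l2 = U$2$j * B$2$2"
      and "lh1 = \<bar>U$2$j * B$1$2\<bar> + \<bar>U$1$j * B$1$1\<bar>"
    have lh: "(\<bar>B\<bar> ** \<bar>U\<bar>)$1$j = lh1" "(\<bar>B\<bar> ** \<bar>U\<bar>)$2$j = \<bar>l2\<bar>"
      and lx: "(B ** U)$1$j = l1" "(B ** U)$2$j = l2"
      using tri by (simp_all add: mm2_nth abs_mat22_nth l1_def l2_def lh1_def abs_mult mult.commute)
    have hh: "(\<bar>adj2 A\<bar> ** (\<bar>B\<bar> ** \<bar>U\<bar>))$2$j = \<bar>A$1$1\<bar> * \<bar>l2\<bar>"
        "(\<bar>adj2 A\<bar> ** (\<bar>B\<bar> ** \<bar>U\<bar>))$1$j = \<bar>A$1$2\<bar> * \<bar>l2\<bar> + \<bar>A$2$2\<bar> * lh1"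
      and hx: "(adj2 A ** (B ** U))$2$j = A$1$1 * l2"
        "(adj2 A ** (B ** U))$1$j = A$2$2 * l1 - A$1$2 * l2"
      using tri by (simp_all add: mm2_nth[of "adj2 A"] mm2_nth[of "\<bar>adj2 A\<bar>"] lh lx
          abs_mat22_nth adj2_nth)
    have "\<bar>l1\<bar> \<le> lh1" by (simp add: l1_def lh1_def)
    note bc = bounded_cancellation[OF abd(3,2,1,5,4) m(1) m' \<kappa> u nz[folded l1_def l2_def]
        small[folded l1_def lh1_def] this
        errD(2)[OF L, of 2 j, unfolded lh lx] errD(2)[OF L, of 1 j, unfolded lh lx]
        errD(2)[OF H, of 2 j, unfolded hh hx] errD(2)[OF H, of 1 j, unfolded hh hx]]
    have nn: "0 \<le> lh1" "0 \<le> \<bar>l2\<bar>" "0 \<le> \<bar>A$1$2\<bar> * \<bar>l2\<bar> + \<bar>A$2$2\<bar> * lh1" "0 \<le> \<bar>A$1$1\<bar> * \<bar>l2\<bar>"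
      by (simp_all add: lh1_def)
    have "L$1$j \<noteq> 0 \<or> L$2$j \<noteq> 0" "H$1$j \<noteq> 0 \<or> H$2$j \<noteq> 0" using bc(1,3) by blast+
    note nz' = this
    have "lh1 + \<bar>l2\<bar> \<le> 50 * \<kappa> * (\<bar>L$1$j\<bar> + \<bar>L$2$j\<bar>)"
      "(\<bar>A$1$2\<bar> * \<bar>l2\<bar> + \<bar>A$2$2\<bar> * lh1) + \<bar>A$1$1\<bar> * \<bar>l2\<bar> \<le> 50 * \<kappa> * (\<bar>H$1$j\<bar> + \<bar>H$2$j\<bar>)"
      using bc(2,4) by (simp_all only: add.commute)
    note le = this
    have "fl_eta F (Lh$1$j) (Lh$2$j) (L$1$j) (L$2$j) \<le> ereal (2 * (50 * \<kappa>))"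
      by (rule fl_eta_leI[OF F u(1) u5 nn(1,2) errD(2)[OF Lh, of 1 j, unfolded lh]
            errD(2)[OF Lh, of 2 j, unfolded lh] nz'(1) le(1)])
    moreover have "fl_eta F (Hh$1$j) (Hh$2$j) (H$1$j) (H$2$j) \<le> ereal (2 * (50 * \<kappa>))"
      by (rule fl_eta_leI[OF F u(1) u5 nn(3,4) errD(2)[OF Hh, of 1 j, unfolded hh]
            errD(2)[OF Hh, of 2 j, unfolded hh] nz'(2) le(2)])
    ultimately show ?thesis by simp
  qed
  have rows: "(U$2$1)\<^sup>2 + (U$2$2)\<^sup>2 = 1" "(U$1$1)\<^sup>2 + (U$1$2)\<^sup>2 = 1"
      "U$2$1 * U$1$1 + U$2$2 * U$1$2 = 0"
    and cols: "(U$2$1)\<^sup>2 + (U$1$1)\<^sup>2 = 1" "(U$2$2)\<^sup>2 + (U$1$2)\<^sup>2 = 1"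
    using orthogonal_mat22_rows[OF U] orthogonal_mat22_columns[OF U]
    by (simp_all add: add.commute mult.commute)
  show ?thesis
    using one_column_without_cancellation[OF rows cols B] col[of 1] col[of 2] by blast
qed

lemma err_set_zero:
  assumes "err e X Y Z" "\<bar>Y$i0$j0\<bar> \<le> e * Z$i0$j0"
  shows "err e (set_zero i0 j0 X) Y Z"
  using assms by (simp add: err_def set_zero_def)

lemma eta_sound_err:
  assumes "arith_model u F" "0 \<le> u" "u \<le> 1/100000" and N: "err (110 * u) Nb N N"
  shows "eta_sound F t (fl_eta F (Nb$i$j) (Nb$k$l) d1 d2) d1 d2 (N$i$j + N$k$l)"
  using errD[OF N, of i j] errD[OF N, of k l]
  by (intro eta_sound_fl_eta[OF assms(1-3)]) (auto intro: order_trans[OF abs_ge_zero])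

lemma mult_J2_nth:
  fixes X :: mat22
  shows
  "(transpose J2 ** X)$1$j = - (X$2$j)" "(transpose \<bar>J2\<bar> ** X)$1$j = X$2$j"
  "(X ** J2)$j$2 = X$j$1" "(X ** \<bar>J2\<bar>)$j$2 = X$j$1"
  by (simp_all add: mm2_nth transpose2_nth abs_mat22_nth J2_nth)

lemma triple_product_hat_bound:
  fixes A :: mat22
  assumes P: "orthogonal_matrix P" and Q: "orthogonal_matrix Q" and A: "\<And>i j. \<bar>A$i$j\<bar> \<le> m"
  shows "(transpose \<bar>P\<bar> ** \<bar>A\<bar> ** \<bar>Q\<bar>)$i$j \<le> 4 * m"
proof -
  have m0: "0 \<le> m" using A[of 1 1] by linarith
  have le: "\<bar>P$k$i\<bar> * \<bar>A$k$l\<bar> * \<bar>Q$l$j\<bar> \<le> m" for k l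
  proof -
    have "\<bar>P$k$i\<bar> * \<bar>A$k$l\<bar> * \<bar>Q$l$j\<bar> \<le> 1 * m * 1"
      by (rule mult3_mono) (fact abs_ge_zero A orthogonal_mat22_abs_le_1[OF P] orthogonal_mat22_abs_le_1[OF Q])+
    then show ?thesis by simp
  qed
  have "(transpose \<bar>P\<bar> ** \<bar>A\<bar> ** \<bar>Q\<bar>)$i$j
      = \<bar>P$1$i\<bar> * \<bar>A$1$1\<bar> * \<bar>Q$1$j\<bar> + \<bar>P$2$i\<bar> * \<bar>A$2$1\<bar> * \<bar>Q$1$j\<bar>
        + \<bar>P$1$i\<bar> * \<bar>A$1$2\<bar> * \<bar>Q$2$j\<bar> + \<bar>P$2$i\<bar> * \<bar>A$2$2\<bar> * \<bar>Q$2$j\<bar>"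
    by (simp add: mm2_nth transpose2_nth abs_mat22_nth algebra_simps)
  then show ?thesis using le[of 1 1] le[of 2 1] le[of 1 2] le[of 2 2] by linarith
qed

lemma backward_error_of_cleared_product:
  assumes F: "arith_model u F" and u: "0 \<le> u" "u \<le> 1/100000"
    and P: "orthogonal_matrix P" "err (6 * u) Pb P \<bar>P\<bar>"
    and Q: "orthogonal_matrix Q" "err (6 * u) Qb Q \<bar>Q\<bar>"
    and A: "\<And>i j. \<bar>A$i$j\<bar> \<le> m"
    and D: "136 * (u * m) \<le> D" and annih: "\<bar>(transpose P ** A ** Q)$1$2\<bar> \<le> D"
  shows "\<exists>\<delta>. set_zero 1 2 (fl_mm3 F w (transpose Pb) A Qb) = transpose P ** (A + \<delta>) ** Q
    \<and> spectral_norm \<delta> \<le> 16 * D"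
proof (rule backward_error_of_product[OF P(1) Q(1)])
  fix i j
  \<comment> \<open>The two rotations give 12 + 12 and the roundings 10, in total 34; hatted entries
    of at most \<open>4 * m\<close> turn this into 136.\<close>
  have "err (2 * (6 * u) + 2 * (6 * u) + 10 * u) (fl_mm3 F w (transpose Pb) A Qb)
      (transpose P ** A ** Q) (transpose \<bar>P\<bar> ** \<bar>A\<bar> ** \<bar>Q\<bar>)"
    using u by (intro err_fl_mm3[OF F _ _ err_transpose[OF P(2)] err_exact Q(2)]) auto
  from errD(2)[OF this, of i j]
  have "\<bar>fl_mm3 F w (transpose Pb) A Qb$i$j - (transpose P ** A ** Q)$i$j\<bar>
      \<le> 34 * u * (transpose \<bar>P\<bar> ** \<bar>A\<bar> ** \<bar>Q\<bar>)$i$j"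
    by simp
  also have "\<dots> \<le> 34 * u * (4 * m)"
    using triple_product_hat_bound[OF P(1) Q(1) A, of i j] u by (intro mult_left_mono) auto
  also have "\<dots> \<le> D" using D by simp
  finally show "\<bar>set_zero 1 2 (fl_mm3 F w (transpose Pb) A Qb)$i$j - (transpose P ** A ** Q)$i$j\<bar> \<le> D"
    using annih by (simp add: set_zero_def)
qed

lemma rsvd22_A_backward_error:
  assumes F: "fp_model u F" and tri: "upper_triangular2 A" "upper_triangular2 B" "upper_triangular2 C"
    and inv: "invertible A" and u: "0 \<le> u" "cond_num A * u \<le> 1/100000"
  shows "\<exists>P Q \<delta>A. orthogonal_matrix P \<and> orthogonal_matrix Q \<and>
    out_A (rsvd22 F w (8 * cond_num A) A B C) = transpose P ** (A + \<delta>A) ** Q \<and>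
    spectral_norm \<delta>A \<le> 8000000 * (cond_num A * u * spectral_norm A)"
proof -
  define \<kappa> where "\<kappa> = cond_num A"
  obtain m where m: "0 < m" "m\<^sup>2 \<le> \<kappa> * \<bar>A$1$1 * A$2$2\<bar>" "m \<le> spectral_norm A"
    and abd: "\<bar>A$1$1\<bar> \<le> m" "\<bar>A$1$2\<bar> \<le> m" "\<bar>A$2$2\<bar> \<le> m" "A$1$1 \<noteq> 0" "A$2$2 \<noteq> 0"
    and \<kappa>: "1 \<le> \<kappa>"
    using max_entry_cond_num[OF tri(1) inv] unfolding \<kappa>_def by blast
  have tri': "A$2$1 = 0" "B$2$1 = 0" "C$2$1 = 0"
    using tri by (simp_all add: upper_triangular2_def)
  have A: "\<bar>A$i$j\<bar> \<le> m" for i j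
  proof -
    have "\<forall>i j. \<bar>A$i$j\<bar> \<le> m" using abd tri' m(1) by (simp add: forall_2)
    then show ?thesis by blast
  qed
  have ar: "arith_model u F" using F by (simp add: fp_model_def)
  have \<kappa>u: "\<kappa> * u \<le> 1/100000" using u by (simp add: \<kappa>_def)
  have u\<kappa>: "u \<le> \<kappa> * u" using mult_right_mono[OF \<kappa> u(1)] by simp
  then have u5: "u \<le> 1/100000" using \<kappa>u by linarith
  \<comment> \<open>The bound for the annihilated entry, which dominates the roundoff of the product
    in the other entries; 16 times it gives the final 8000000.\<close>
  define D where "D = 500000 * (\<kappa> * u * m)"
  have "u * m \<le> \<kappa> * u * m" using u\<kappa> m by (intro mult_right_mono) auto
  moreover have "0 \<le> u * m" using u m by simp
  ultimately have D: "136 * (u * m) \<le> D" unfolding D_def by linarith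
  have "\<kappa> * u * m \<le> \<kappa> * u * spectral_norm A" using m \<kappa> u by (intro mult_left_mono) auto
  then have Dnorm: "16 * D \<le> 8000000 * (\<kappa> * u * spectral_norm A)" unfolding D_def by linarith
  show ?thesis
  proof (cases "C$1$1 = 0 \<and> B$2$2 = 0")
    case True
    \<comment> \<open>Step 1 clears no entry of A' and uses exact factors, so only the rounding of
      the product remains.\<close>
    have out: "out_A (rsvd22 F w (8 * cond_num A) A B C) = fl_mm3 F (left_A' w) (transpose J2) A J2"
      using True by (simp add: rsvd22_def rsvd22_step1_def Let_def)
    have "err (2 * 0 + 2 * 0 + 10 * u) (fl_mm3 F (left_A' w) (transpose J2) A J2)
        (transpose J2 ** A ** J2) (transpose \<bar>J2\<bar> ** \<bar>A\<bar> ** \<bar>J2\<bar>)"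
      using u u5 by (intro err_fl_mm3[OF ar _ _ err_transpose[OF err_exact] err_exact err_exact]) auto
    then have e: "err (10 * u) (fl_mm3 F (left_A' w) (transpose J2) A J2)
        (transpose J2 ** A ** J2) (transpose \<bar>J2\<bar> ** \<bar>A\<bar> ** \<bar>J2\<bar>)" by simp
    have "\<bar>fl_mm3 F (left_A' w) (transpose J2) A J2$i$j - (transpose J2 ** A ** J2)$i$j\<bar> \<le> D" for i j
    proof -
      have "10 * u * (transpose \<bar>J2\<bar> ** \<bar>A\<bar> ** \<bar>J2\<bar>)$i$j \<le> 10 * u * (4 * m)"
        using triple_product_hat_bound[OF orthogonal_J2 orthogonal_J2 A, of i j] u
        by (intro mult_left_mono) auto
      moreover have "10 * u * (4 * m) = 40 * (u * m)" by simp
      ultimately show ?thesis using errD(2)[OF e, of i j] D \<open>0 \<le> u * m\<close> by linarith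
    qed
    from backward_error_of_product[OF orthogonal_J2 orthogonal_J2 this] show ?thesis
      using orthogonal_J2 Dnorm unfolding out \<kappa>_def by (meson order_trans)
  next
    case False
    obtain Ub Vb where step: "rsvd22_step2 F A B C = (Ub, Vb)" by fastforce
    obtain U V where UV: "orthogonal_matrix U" "orthogonal_matrix V"
      and eU: "err (46.5 * u) Ub U \<bar>U\<bar>" and eV: "err (46.5 * u) Vb V \<bar>V\<bar>"
      and diag: "(transpose V ** fl_M F A B C ** U)$1$2 = 0" "(transpose V ** fl_M F A B C ** U)$2$1 = 0"
      and clear: "C$1$1 = 0 \<Longrightarrow>
        \<bar>V$1$2 * C$1$2 + V$2$2 * C$2$2\<bar> \<le> 6 * u * (\<bar>V$1$2 * C$1$2\<bar> + \<bar>V$2$2 * C$2$2\<bar>)"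
      "B$2$2 = 0 \<Longrightarrow>
        \<bar>B$1$1 * U$1$2 + B$1$2 * U$2$2\<bar> \<le> 6 * u * (\<bar>B$1$1 * U$1$2\<bar> + \<bar>B$1$2 * U$2$2\<bar>)"
      by (rule rsvd22_step2_accurate[OF F u(1) u5 abd(4,5) False step]) blast
    define G0 where "G0 = fl_mm F (transpose Vb) C"
    define G where "G = (if clear_g22 w \<and> C$1$1 = 0 then set_zero 2 2 G0 else G0)"
    define L0 where "L0 = fl_mm F B Ub"
    define L where "L = (if clear_l12 w \<and> B$2$2 = 0 then set_zero 1 2 L0 else L0)"
    define Gh where "Gh = fl_mm F (transpose \<bar>Vb\<bar>) \<bar>C\<bar>"
    define H where "H = fl_mm F (adj2 A) L"
    define Hh where "Hh = fl_mm3 F (left_Hhat w) \<bar>adj2 A\<bar> \<bar>B\<bar> \<bar>Ub\<bar>"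
    define K where "K = fl_mm F G (adj2 A)"
    define Kh where "Kh = fl_mm3 F (left_Khat w) (transpose \<bar>Vb\<bar>) \<bar>C\<bar> \<bar>adj2 A\<bar>"
    define Lh where "Lh = fl_mm F \<bar>B\<bar> \<bar>Ub\<bar>"
    define \<eta>g where "\<eta>g i = fl_eta F (Gh$i$1) (Gh$i$2) (G$i$1) (G$i$2)" for i
    define \<eta>k where "\<eta>k i = fl_eta F (Kh$i$1) (Kh$i$2) (K$i$1) (K$i$2)" for i
    define \<eta>h where "\<eta>h j = fl_eta F (Hh$1$j) (Hh$2$j) (H$1$j) (H$2$j)" for j
    define \<eta>l where "\<eta>l j = fl_eta F (Lh$1$j) (Lh$2$j) (L$1$j) (L$2$j)" for j
    \<comment> \<open>Row 1 of G and K goes with column 2 of H and L, as they meet in the (1,2)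
      entry of V^T M U; row 2 and column 1 meet in the (2,1) entry.\<close>
    define \<eta>1 where "\<eta>1 = eta_max (\<eta>g 1) (\<eta>h 2) (\<eta>k 1) (\<eta>l 2)"
    define \<eta>2 where "\<eta>2 = eta_max (\<eta>g 2) (\<eta>h 1) (\<eta>k 2) (\<eta>l 1)"
    define res1 where "res1 = rsvd22_finish F w A Ub Vb G H K L (\<eta>g 1) (\<eta>h 2) (\<eta>k 1) (\<eta>l 2)"
    define res2 where "res2 = rsvd22_finish F w A (Ub ** J2) (Vb ** J2) (transpose J2 ** G) (H ** J2)
        (transpose J2 ** K) (L ** J2) (\<eta>g 2) (\<eta>h 1) (\<eta>k 2) (\<eta>l 1)"
    have res: "rsvd22 F w (8 * cond_num A) A B C
        = (if \<eta>1 \<le> ereal (8 * \<kappa>) \<or> \<eta>1 \<le> \<eta>2 then res1 else res2)"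
      unfolding rsvd22_def step Let_def prod.case if_not_P[OF False] res1_def res2_def \<eta>1_def \<eta>2_def
        \<eta>g_def \<eta>h_def \<eta>k_def \<eta>l_def Lh_def Kh_def K_def Hh_def H_def Gh_def L_def L0_def G_def G0_def
        \<kappa>_def ..
    have out_A: "out_A (rsvd22_finish F w A U' V' G' H' K' L' e1 e2 e3 e4)
        = set_zero 1 2 (fl_mm3 F (left_A' w)
            (transpose (out_P (rsvd22_finish F w A U' V' G' H' K' L' e1 e2 e3 e4))) A
            (out_Q (rsvd22_finish F w A U' V' G' H' K' L' e1 e2 e3 e4)))"
      for U' V' G' H' K' L' e1 e2 e3 e4
      by (simp add: rsvd22_finish_def Let_def)
    have uu: "u * u \<le> u * (1/100000)" using u u5 by (intro mult_left_mono)
    \<comment> \<open>A product with U or V stays below \<open>51 * u\<close> and a further product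
      with adj(A) below \<open>55 * u\<close>; 110 is set by the threefold hats, where 2 * 46.5 + 10
      = 103.\<close>
    have c1: "46.5 * u + 0 + 46.5 * u * 0 + 3 * u * ((1 + 46.5 * u) * (1 + 0)) \<le> 51 * u"
      "0 + 46.5 * u + 0 * (46.5 * u) + 3 * u * ((1 + 0) * (1 + 46.5 * u)) \<le> 51 * u"
      "51 * u + 0 + 51 * u * 0 + 3 * u * ((1 + 51 * u) * (1 + 0)) \<le> 110 * u"
      "0 + 51 * u + 0 * (51 * u) + 3 * u * ((1 + 0) * (1 + 51 * u)) \<le> 110 * u"
      using uu u(1) by (simp_all add: distrib_left mult.left_commute)
    have u3: "u \<le> 1/1000" using u5 by simp
    have c0: "0 \<le> 46.5 * u" "0 \<le> 51 * u" "(0::real) \<le> 0" using u by simp_all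
    have exact: "err 0 \<bar>X\<bar> \<bar>X\<bar> \<bar>X\<bar>" for X by (simp add: err_def abs_mat22_nth)
    have eG0: "err (51 * u) G0 (transpose V ** C) (transpose \<bar>V\<bar> ** \<bar>C\<bar>)"
      unfolding G0_def by (rule err_fl_mm[OF ar u(1) u3 err_transpose[OF eV] err_exact c0(1,3) c1(1)])
    have eL0: "err (51 * u) L0 (B ** U) (\<bar>B\<bar> ** \<bar>U\<bar>)"
      unfolding L0_def by (rule err_fl_mm[OF ar u(1) u3 err_exact eU c0(3,1) c1(2)])
    have le51: "x \<le> 51 * u * y" if "x \<le> 6 * u * y" "0 \<le> y" for x y
      using that mult_nonneg_nonneg[OF u(1) that(2)] by linarith
    have eG51: "err (51 * u) G (transpose V ** C) (transpose \<bar>V\<bar> ** \<bar>C\<bar>)"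
    proof (cases "clear_g22 w \<and> C$1$1 = 0")
      case True
      have "\<bar>(transpose V ** C)$2$2\<bar> \<le> 51 * u * (transpose \<bar>V\<bar> ** \<bar>C\<bar>)$2$2"
        using clear(1) True
        by (intro le51) (simp_all add: mm2_nth transpose2_nth abs_mat22_nth abs_mult)
      then show ?thesis unfolding G_def if_P[OF True] by (rule err_set_zero[OF eG0])
    next
      case False
      show ?thesis unfolding G_def if_not_P[OF False] by (rule eG0)
    qed
    have eL51: "err (51 * u) L (B ** U) (\<bar>B\<bar> ** \<bar>U\<bar>)"
    proof (cases "clear_l12 w \<and> B$2$2 = 0")
      case True
      have "\<bar>(B ** U)$1$2\<bar> \<le> 51 * u * (\<bar>B\<bar> ** \<bar>U\<bar>)$1$2"
        using clear(2) True by (intro le51) (simp_all add: mm2_nth abs_mat22_nth abs_mult)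
      then show ?thesis unfolding L_def if_P[OF True] by (rule err_set_zero[OF eL0])
    next
      case False
      show ?thesis unfolding L_def if_not_P[OF False] by (rule eL0)
    qed
    have up: "51 * u \<le> 110 * u" "2 * (46.5 * u) + 2 * 0 + 10 * u \<le> 110 * u"
      "2 * 0 + 2 * (46.5 * u) + 10 * u \<le> 110 * u"
      using u by simp_all
    have small: "46.5 * u \<le> 1/10" "(0::real) \<le> 1/10" using u5 by simp_all
    note eG = err_mono[OF eG51 up(1)] and eL = err_mono[OF eL51 up(1)]
    have eH: "err (110 * u) H (adj2 A ** (B ** U)) (\<bar>adj2 A\<bar> ** (\<bar>B\<bar> ** \<bar>U\<bar>))"
      unfolding H_def by (rule err_fl_mm[OF ar u(1) u3 err_exact eL51 c0(3,2) c1(4)])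
    have eK: "err (110 * u) K ((transpose V ** C) ** adj2 A) ((transpose \<bar>V\<bar> ** \<bar>C\<bar>) ** \<bar>adj2 A\<bar>)"
      unfolding K_def by (rule err_fl_mm[OF ar u(1) u3 eG51 err_exact c0(2,3) c1(3)])
    have eGh: "err (110 * u) Gh (transpose \<bar>V\<bar> ** \<bar>C\<bar>) (transpose \<bar>V\<bar> ** \<bar>C\<bar>)"
      unfolding Gh_def
      by (rule err_mono[OF err_fl_mm[OF ar u(1) u3 err_transpose[OF err_abs[OF eV]] exact c0(1,3) c1(1)] up(1)])
    have eLh: "err (110 * u) Lh (\<bar>B\<bar> ** \<bar>U\<bar>) (\<bar>B\<bar> ** \<bar>U\<bar>)"
      unfolding Lh_def
      by (rule err_mono[OF err_fl_mm[OF ar u(1) u3 exact err_abs[OF eU] c0(3,1) c1(2)] up(1)])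
    have eHh: "err (110 * u) Hh (\<bar>adj2 A\<bar> ** (\<bar>B\<bar> ** \<bar>U\<bar>)) (\<bar>adj2 A\<bar> ** (\<bar>B\<bar> ** \<bar>U\<bar>))"
      unfolding Hh_def matrix_mul_assoc
      by (rule err_mono[OF err_fl_mm3[OF ar u(1) u3 exact exact err_abs[OF eU] c0(3,1) small(2,1)] up(3)])
    have eKh: "err (110 * u) Kh ((transpose \<bar>V\<bar> ** \<bar>C\<bar>) ** \<bar>adj2 A\<bar>) ((transpose \<bar>V\<bar> ** \<bar>C\<bar>) ** \<bar>adj2 A\<bar>)"
      unfolding Kh_def
      by (rule err_mono[OF err_fl_mm3[OF ar u(1) u3 err_transpose[OF err_abs[OF eV]] exact exact
              c0(1,3) small(1,2)] up(2)])
    have one: "(1::ereal) \<le> ereal (100 * \<kappa>)" using \<kappa> by (simp add: one_ereal_def)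
    have "\<eta>1 \<le> ereal (100 * \<kappa>) \<or> \<eta>2 \<le> ereal (100 * \<kappa>)"
    proof (cases "C$1$1 \<noteq> 0 \<or> C$1$2 \<noteq> 0 \<or> C$2$2 \<noteq> 0")
      case True
      then obtain i where "\<eta>g i \<le> ereal (100 * \<kappa>)" "\<eta>k i \<le> ereal (100 * \<kappa>)"
        using some_row_eta_le[OF ar u(1) \<kappa>u \<kappa> tri'(1,3) abd m(1,2) UV(2) True eG eK eGh eKh]
        unfolding \<eta>g_def \<eta>k_def by blast
      then show ?thesis
        using exhaust_2[of i] one by (auto simp: \<eta>1_def \<eta>2_def eta_max_def min.coboundedI1)
    next
      case zero: False
      \<comment> \<open>With C = 0, the failure of the test in step 1 means that b22 is
        nonzero.\<close>
      then have "B$2$2 \<noteq> 0 \<or> B$1$2 \<noteq> 0 \<or> B$1$1 \<noteq> 0" using False by blast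
      then obtain j where "\<eta>l j \<le> ereal (100 * \<kappa>)" "\<eta>h j \<le> ereal (100 * \<kappa>)"
        using some_column_eta_le[OF ar u(1) \<kappa>u \<kappa> tri'(1,2) abd m(1,2) UV(1) _ eL eH eLh eHh]
        unfolding \<eta>l_def \<eta>h_def by blast
      then show ?thesis
        using exhaust_2[of j] one by (auto simp: \<eta>1_def \<eta>2_def eta_max_def min.coboundedI2)
    qed
    moreover have "ereal (8 * \<kappa>) \<le> ereal (100 * \<kappa>)" using \<kappa> by simp
    \<comment> \<open>Acceptance by the tolerance bounds \<open>\<eta>1\<close> directly; otherwise
      the comparison selects the smaller maximum, and one of the two is known to be small.\<close>
    ultimately have chosen: "if \<eta>1 \<le> ereal (8 * \<kappa>) \<or> \<eta>1 \<le> \<eta>2 then \<eta>1 \<le> ereal (100 * \<kappa>)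
        else \<eta>2 \<le> ereal (100 * \<kappa>)"
      by (auto intro: order_trans)
    note M = fl_M_error[OF ar u(1) u5 refl, of A B C]
    note sound = eta_sound_err[OF ar u(1) u5 eGh] eta_sound_err[OF ar u(1) u5 eLh]
      eta_sound_err[OF ar u(1) u5 eHh] eta_sound_err[OF ar u(1) u5 eKh]
    have ann1: "\<exists>P Q. orthogonal_matrix P \<and> orthogonal_matrix Q \<and>
        err (6 * u) (out_P res1) P \<bar>P\<bar> \<and> err (6 * u) (out_Q res1) Q \<bar>Q\<bar> \<and>
        \<bar>(transpose P ** A ** Q)$1$2\<bar> \<le> D" if "\<eta>1 \<le> ereal (100 * \<kappa>)"
      unfolding D_def
      by (rule rsvd22_finish_annihilates[OF F u(1) \<kappa>u \<kappa> tri' abd(1-3) eG eL eH eK M diag(1) _ _ _ _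
            that[unfolded \<eta>1_def] res1_def])
        (unfold \<eta>g_def \<eta>h_def \<eta>k_def \<eta>l_def, (rule sound)+)
    have ann2: "\<exists>P Q. orthogonal_matrix P \<and> orthogonal_matrix Q \<and>
        err (6 * u) (out_P res2) P \<bar>P\<bar> \<and> err (6 * u) (out_Q res2) Q \<bar>Q\<bar> \<and>
        \<bar>(transpose P ** A ** Q)$1$2\<bar> \<le> D" if "\<eta>2 \<le> ereal (100 * \<kappa>)"
    proof -
      \<comment> \<open>Exact products and hats are exchanged by \<open>J2\<close> in the same way
        as the computed matrices, so the error bounds carry over; the sign changes do not affect the
        factors eta.\<close>
      have hats: "transpose \<bar>V ** J2\<bar> ** \<bar>C\<bar> = transpose \<bar>J2\<bar> ** (transpose \<bar>V\<bar> ** \<bar>C\<bar>)"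
        "\<bar>B\<bar> ** \<bar>U ** J2\<bar> = \<bar>B\<bar> ** \<bar>U\<bar> ** \<bar>J2\<bar>"
        by (simp_all add: abs_mult_J2 matrix_transpose_mul matrix_mul_assoc)
      have hats': "transpose \<bar>V ** J2\<bar> ** \<bar>C\<bar> ** \<bar>adj2 A\<bar>
          = transpose \<bar>J2\<bar> ** (transpose \<bar>V\<bar> ** \<bar>C\<bar> ** \<bar>adj2 A\<bar>)"
        "\<bar>adj2 A\<bar> ** (\<bar>B\<bar> ** \<bar>U ** J2\<bar>) = \<bar>adj2 A\<bar> ** (\<bar>B\<bar> ** \<bar>U\<bar>) ** \<bar>J2\<bar>"
        by (simp_all add: hats matrix_mul_assoc)
      have exacts: "transpose (V ** J2) ** C = transpose J2 ** (transpose V ** C)"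
        "B ** (U ** J2) = B ** U ** J2"
        "transpose (V ** J2) ** C ** adj2 A = transpose J2 ** (transpose V ** C ** adj2 A)"
        "adj2 A ** (B ** (U ** J2)) = adj2 A ** (B ** U) ** J2"
        by (simp_all add: matrix_transpose_mul matrix_mul_assoc)
      have eG': "err (110 * u) (transpose J2 ** G) (transpose (V ** J2) ** C) (transpose \<bar>V ** J2\<bar> ** \<bar>C\<bar>)"
        unfolding hats exacts by (rule err_J2_mult[OF eG])
      have eL': "err (110 * u) (L ** J2) (B ** (U ** J2)) (\<bar>B\<bar> ** \<bar>U ** J2\<bar>)"
        unfolding hats exacts by (rule err_mult_J2[OF eL])
      have eH': "err (110 * u) (H ** J2) (adj2 A ** (B ** (U ** J2))) (\<bar>adj2 A\<bar> ** (\<bar>B\<bar> ** \<bar>U ** J2\<bar>))"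
        unfolding hats' exacts(4) by (rule err_mult_J2[OF eH])
      have eK': "err (110 * u) (transpose J2 ** K) (transpose (V ** J2) ** C ** adj2 A)
          (transpose \<bar>V ** J2\<bar> ** \<bar>C\<bar> ** \<bar>adj2 A\<bar>)"
        unfolding hats' exacts(3) by (rule err_J2_mult[OF eK])
      have diag': "(transpose (V ** J2) ** fl_M F A B C ** (U ** J2))$1$2 = 0"
        using diag(2) by (simp add: offdiagonal_mult_J2)
      show ?thesis
        unfolding D_def
        by (rule rsvd22_finish_annihilates[OF F u(1) \<kappa>u \<kappa> tri' abd(1-3) eG' eL' eH' eK' M diag' _ _ _ _
              that[unfolded \<eta>2_def] res2_def];
            unfold hats hats'[unfolded hats] mult_J2_nth eta_sound_minus \<eta>g_def \<eta>h_def \<eta>k_def \<eta>l_def)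
          (rule sound)+
    qed
    have "\<exists>P Q. orthogonal_matrix P \<and> orthogonal_matrix Q \<and> (\<exists>\<delta>.
        out_A (rsvd22 F w (8 * cond_num A) A B C) = transpose P ** (A + \<delta>) ** Q \<and>
        spectral_norm \<delta> \<le> 16 * D)"
    proof (cases "\<eta>1 \<le> ereal (8 * \<kappa>) \<or> \<eta>1 \<le> \<eta>2")
      case True
      obtain P Q where PQ: "orthogonal_matrix P" "orthogonal_matrix Q"
        "err (6 * u) (out_P res1) P \<bar>P\<bar>" "err (6 * u) (out_Q res1) Q \<bar>Q\<bar>"
        "\<bar>(transpose P ** A ** Q)$1$2\<bar> \<le> D"
        using ann1 chosen[unfolded if_P[OF True]] by blast
      have "out_A res1 = set_zero 1 2 (fl_mm3 F (left_A' w) (transpose (out_P res1)) A (out_Q res1))"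
        unfolding res1_def by (rule out_A)
      then show ?thesis
        using backward_error_of_cleared_product[OF ar u(1) u5 PQ(1,3,2,4) A D PQ(5), of "left_A' w"] PQ(1,2)
        unfolding res if_P[OF True] by metis
    next
      case F2: False
      obtain P Q where PQ: "orthogonal_matrix P" "orthogonal_matrix Q"
        "err (6 * u) (out_P res2) P \<bar>P\<bar>" "err (6 * u) (out_Q res2) Q \<bar>Q\<bar>"
        "\<bar>(transpose P ** A ** Q)$1$2\<bar> \<le> D"
        using ann2 chosen[unfolded if_not_P[OF F2]] by blast
      have "out_A res2 = set_zero 1 2 (fl_mm3 F (left_A' w) (transpose (out_P res2)) A (out_Q res2))"
        unfolding res2_def by (rule out_A)
      then show ?thesis
        using backward_error_of_cleared_product[OF ar u(1) u5 PQ(1,3,2,4) A D PQ(5), of "left_A' w"] PQ(1,2)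
        unfolding res if_not_P[OF F2] by metis
    qed
    then show ?thesis using Dnorm unfolding \<kappa>_def by (meson order_trans)
  qed
qed

theorem mainTheorem3:
  shows "\<forall>c > 0. \<exists>K > 0. \<exists>\<epsilon>\<^sub>0 > 0.
    \<forall>(A :: real^2^2) (B :: real^2^2) (C :: real^2^2) (\<epsilon> :: real) (u :: real)
      (F :: fp_system) (w :: rsvd22_variant).
      upper_triangular2 A \<and> upper_triangular2 B \<and> upper_triangular2 C \<and> invertible A \<and>
      0 < \<epsilon> \<and> \<epsilon> \<le> \<epsilon>\<^sub>0 \<and>
      0 \<le> u \<and> u \<le> c * (\<epsilon> / cond_num A) \<and> fp_model u F \<longrightarrow>
      (\<exists>(P :: real^2^2) (Q :: real^2^2) (\<delta>A :: real^2^2).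
         orthogonal_matrix P \<and> orthogonal_matrix Q \<and>
         out_A (rsvd22 F w (8 * cond_num A) A B C) = transpose P ** (A + \<delta>A) ** Q \<and>
         spectral_norm \<delta>A \<le> K * (\<epsilon> * spectral_norm A))"
proof (intro allI impI)
  fix c :: real
  assume c: "0 < c"
  \<comment> \<open>Here \<open>c\<close> is the constant hidden in u = O(\<epsilon>/\<kappa>(A)).
    It scales the final constant, and the upper limit for \<epsilon> is chosen to give \<kappa>(A) u
    \<le> 1/100000.\<close>
  have main: "\<exists>P Q \<delta>A. orthogonal_matrix P \<and> orthogonal_matrix Q \<and>
        out_A (rsvd22 F w (8 * cond_num A) A B C) = transpose P ** (A + \<delta>A) ** Q \<and>
        spectral_norm \<delta>A \<le> 8000000 * c * (\<epsilon> * spectral_norm A)"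
    if tri: "upper_triangular2 A" "upper_triangular2 B" "upper_triangular2 C" and inv: "invertible A"
      and \<epsilon>: "0 < \<epsilon>" "\<epsilon> \<le> 1 / (100000 * c)"
      and u: "0 \<le> u" "u \<le> c * (\<epsilon> / cond_num A)" and F: "fp_model u F"
    for A B C :: mat22 and \<epsilon> u and F w
  proof -
    obtain m where m: "0 < m" "m \<le> spectral_norm A" and \<kappa>: "1 \<le> cond_num A"
      using max_entry_cond_num[OF tri(1) inv] by blast
    have "cond_num A * u \<le> cond_num A * (c * (\<epsilon> / cond_num A))"
      using u(2) \<kappa> by (intro mult_left_mono) auto
    then have \<kappa>u: "cond_num A * u \<le> c * \<epsilon>" using \<kappa> by simp
    have "c * \<epsilon> \<le> c * (1 / (100000 * c))" using c \<epsilon> by (intro mult_left_mono) auto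
    then have "cond_num A * u \<le> 1/100000" using \<kappa>u c by simp
    from rsvd22_A_backward_error[OF F tri inv u(1) this, of w]
    obtain P Q \<delta>A where PQ: "orthogonal_matrix P" "orthogonal_matrix Q"
      "out_A (rsvd22 F w (8 * cond_num A) A B C) = transpose P ** (A + \<delta>A) ** Q"
      "spectral_norm \<delta>A \<le> 8000000 * (cond_num A * u * spectral_norm A)" by blast
    have "cond_num A * u * spectral_norm A \<le> c * \<epsilon> * spectral_norm A"
      using \<kappa>u m by (intro mult_right_mono) auto
    then have "spectral_norm \<delta>A \<le> 8000000 * c * (\<epsilon> * spectral_norm A)" using PQ(4) by simp
    then show ?thesis using PQ by blast
  qed
  show "\<exists>K > 0. \<exists>\<epsilon>\<^sub>0 > 0.
    \<forall>(A :: real^2^2) (B :: real^2^2) (C :: real^2^2) (\<epsilon> :: real) (u :: real)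
      (F :: fp_system) (w :: rsvd22_variant).
      upper_triangular2 A \<and> upper_triangular2 B \<and> upper_triangular2 C \<and> invertible A \<and>
      0 < \<epsilon> \<and> \<epsilon> \<le> \<epsilon>\<^sub>0 \<and>
      0 \<le> u \<and> u \<le> c * (\<epsilon> / cond_num A) \<and> fp_model u F \<longrightarrow>
      (\<exists>(P :: real^2^2) (Q :: real^2^2) (\<delta>A :: real^2^2).
         orthogonal_matrix P \<and> orthogonal_matrix Q \<and>
         out_A (rsvd22 F w (8 * cond_num A) A B C) = transpose P ** (A + \<delta>A) ** Q \<and>
         spectral_norm \<delta>A \<le> K * (\<epsilon> * spectral_norm A))"
    using main c by (intro exI[of _ "8000000 * c"] exI[of _ "1 / (100000 * c)"] conjI allI impI)
      (simp_all, blast)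
qed

end
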